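(* Consider a random walk model in the quarter plane with small steps, non-degenerate and with zero drift, with kernel $K$, branch $X_+$ and conformal gluing function $\omega$ as in the context. Let $(H_n^k)_{n,k\ge1}$ be a family of generating functions of discrete polyharmonic functions such that (1) for every $k\ge1$, $H_1^k(x,y)=\frac{P_k(\omega(x))-P_k(\omega(X_+(y)))}{K(x,y)}$ with $P_k$ as in the context; (2) $\Delta H_{n+1}^k=H_n^k$ for all $n,k\ge1$; (3) for every $n\ge1$ and every real sequence $(a_k)_{k\ge1}$, the series $\sum_{k=1}^\infty a_kH_n^k$ converges (as a formal power series). Then for every $n\ge1$ and every $H_n\in\mathcal{H}_n$ there exist real numbers $a_{i,j}$, $1\le i\le n$, $j\ge1$, such that $$H_n=\sum_{i=1}^n\sum_{j=1}^\infty a_{i,j}H_i^j.$$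
   Context: A model is given by transition probabilities $p_{i,j}\ge 0$, $(i,j)\in\{-1,0,1\}^2$, summing to $1$, non-degenerate (the cyclic list $p_{1,1},p_{1,0},p_{1,-1},p_{0,-1},p_{-1,-1},p_{-1,0},p_{-1,1},p_{0,1}$ contains no three consecutive zeros) and with zero drift ($\sum ip_{i,j}=\sum jp_{i,j}=0$). For $f:\mathbb{Z}_{\ge0}^2\to\mathbb{R}$ extended by $0$ outside $\mathbb{Z}_{\ge0}^2$ (Dirichlet boundary conditions), $\Delta f(i,j)=\sum p_{u,v}f(i+u,j+v)-f(i,j)$ on $\mathbb{Z}_{\ge0}^2$; $f$ is $n$-polyharmonic if $\Delta^nf=0$, and $\mathcal{H}_n$ denotes the real vector space of $n$-polyharmonic functions, identified with their generating functions $H(x,y)=\sum_{i,j\ge0}h(i,j)x^iy^j$ (the Laplacian acts on generating functions accordingly). Kernel: $K(x,y)=xy(\sum p_{i,j}x^{-i}y^{-j}-1)=\tilde a(y)x^2+\tilde b(y)x+\tilde c(y)$; $X_\pm(y)=\frac{-\tilde b\pm\sqrt{\tilde b^2-4\tilde a\tilde c}}{2\tilde a}$. With $y_1\in[-1,1)$ the root of the discriminant $\tilde b^2-4\tilde a\tilde c$ other than the double root $1$ and the root outside $(-1,1)$, $\mathcal{G}$ is the domain bounded by the curve $X_\pm([y_1,1])$, and $\theta=\arccos\big(-\sum ijp_{i,j}/\sqrt{\sum i^2p_{i,j}\sum j^2p_{i,j}}\big)$. $\omega$ is the conformal gluing function of $\mathcal{G}$: analytic in $\mathcal{G}$, conformal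 there, $\omega(0)=0$, $\omega(X_+(y))=\omega(X_-(y))$ for $y\in[y_1,1]$, with a pole-like singularity of order $\pi/\theta$ at $1$. Let $d_0=\omega(X_+(0))$ and define polynomials $P_{2m}(z)=z^m(z-d_0)^m$, $P_{2m+1}(z)=z^{m+1}(z-d_0)^m$. *)

theory Defs
  imports "HOL-Complex_Analysis.Complex_Analysis"
begin

text \<open>A walk with small steps is given by its weights \<open>p i j\<close> for \<open>i, j \<in> {-1, 0, 1}\<close>;
  the values of \<open>p\<close> elsewhere are never used.\<close>

definition transition_probs :: "(int \<Rightarrow> int \<Rightarrow> real) \<Rightarrow> bool" where
  "transition_probs p \<longleftrightarrow>
     (\<forall>i\<in>{-1..1}. \<forall>j\<in>{-1..1}. p i j \<ge> 0) \<and> (\<Sum>i\<in>{-1..1}. \<Sum>j\<in>{-1..1}. p i j) = 1"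

definition cyclic_steps :: "(int \<Rightarrow> int \<Rightarrow> real) \<Rightarrow> real list" where
  "cyclic_steps p =
     [p 1 1, p 1 0, p 1 (-1), p 0 (-1), p (-1) (-1), p (-1) 0, p (-1) 1, p 0 1]"

definition non_degenerate :: "(int \<Rightarrow> int \<Rightarrow> real) \<Rightarrow> bool" where
  "non_degenerate p \<longleftrightarrow>
     \<not> (\<exists>m<8. cyclic_steps p ! m = 0 \<and> cyclic_steps p ! ((m + 1) mod 8) = 0
               \<and> cyclic_steps p ! ((m + 2) mod 8) = 0)"

definition zero_drift :: "(int \<Rightarrow> int \<Rightarrow> real) \<Rightarrow> bool" where
  "zero_drift p \<longleftrightarrow>
     (\<Sum>i\<in>{-1..1}. \<Sum>j\<in>{-1..1}. of_int i * p i j) = 0 \<and>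
     (\<Sum>i\<in>{-1..1}. \<Sum>j\<in>{-1..1}. of_int j * p i j) = 0"

text \<open>A function on the quarter plane is identified with its generating function:
  \<open>h i j\<close> is both the value at \<open>(i, j)\<close> and the coefficient of \<open>x^i y^j\<close>.\<close>

definition zero_ext :: "(nat \<Rightarrow> nat \<Rightarrow> real) \<Rightarrow> int \<Rightarrow> int \<Rightarrow> real" where
  "zero_ext f i j = (if 0 \<le> i \<and> 0 \<le> j then f (nat i) (nat j) else 0)"

definition laplacian ::
    "(int \<Rightarrow> int \<Rightarrow> real) \<Rightarrow> (nat \<Rightarrow> nat \<Rightarrow> real) \<Rightarrow> nat \<Rightarrow> nat \<Rightarrow> real" where
  "laplacian p f i j =
     (\<Sum>u\<in>{-1..1}. \<Sum>v\<in>{-1..1}. p u v * zero_ext f (int i + u) (int j + v)) - f i j"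

definition polyharmonic :: "(int \<Rightarrow> int \<Rightarrow> real) \<Rightarrow> nat \<Rightarrow> (nat \<Rightarrow> nat \<Rightarrow> real) set" where
  "polyharmonic p n = {f. (laplacian p ^^ n) f = (\<lambda>i j. 0)}"

text \<open>The kernel \<open>x y (\<Sum> p i j x^(-i) y^(-j) - 1)\<close>, multiplied out so that it is a polynomial
  also at \<open>x = 0\<close> or \<open>y = 0\<close>.\<close>

definition walk_kernel :: "(int \<Rightarrow> int \<Rightarrow> real) \<Rightarrow> complex \<Rightarrow> complex \<Rightarrow> complex" where
  "walk_kernel p x y =
     (\<Sum>i\<in>{-1..1}. \<Sum>j\<in>{-1..1}. of_real (p i j) * x ^ nat (1 - i) * y ^ nat (1 - j)) - x * y"

definition ker_a :: "(int \<Rightarrow> int \<Rightarrow> real) \<Rightarrow> complex \<Rightarrow> complex" where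
  "ker_a p y = (\<Sum>j\<in>{-1..1}. of_real (p (-1) j) * y ^ nat (1 - j))"

definition ker_b :: "(int \<Rightarrow> int \<Rightarrow> real) \<Rightarrow> complex \<Rightarrow> complex" where
  "ker_b p y = (\<Sum>j\<in>{-1..1}. of_real (p 0 j) * y ^ nat (1 - j)) - y"

definition ker_c :: "(int \<Rightarrow> int \<Rightarrow> real) \<Rightarrow> complex \<Rightarrow> complex" where
  "ker_c p y = (\<Sum>j\<in>{-1..1}. of_real (p 1 j) * y ^ nat (1 - j))"

lemma walk_kernel_quadratic: "walk_kernel p x y = ker_a p y * x\<^sup>2 + ker_b p y * x + ker_c p y"
proof -
  have "{-1..1::int} = {-1, 0, 1}" by auto
  then show ?thesis
    by (simp add: walk_kernel_def ker_a_def ker_b_def ker_c_def algebra_simps)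
qed

definition discr :: "(int \<Rightarrow> int \<Rightarrow> real) \<Rightarrow> complex \<Rightarrow> complex" where
  "discr p y = (ker_b p y)\<^sup>2 - 4 * ker_a p y * ker_c p y"

definition X_plus :: "(int \<Rightarrow> int \<Rightarrow> real) \<Rightarrow> complex \<Rightarrow> complex" where
  "X_plus p y = (- ker_b p y + csqrt (discr p y)) / (2 * ker_a p y)"

definition X_minus :: "(int \<Rightarrow> int \<Rightarrow> real) \<Rightarrow> complex \<Rightarrow> complex" where
  "X_minus p y = (- ker_b p y - csqrt (discr p y)) / (2 * ker_a p y)"

text \<open>The discriminant has exactly one root in \<open>[-1, 1)\<close>: the remaining roots are the double
  root \<open>1\<close> and a root outside \<open>(-1, 1)\<close> (possibly at infinity), and the latter can be
  \<open>-1\<close> only if the discriminant is even, in which case \<open>-1\<close> is a double root.\<close>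

definition y_one :: "(int \<Rightarrow> int \<Rightarrow> real) \<Rightarrow> real" where
  "y_one p = (THE y. -1 \<le> y \<and> y < 1 \<and> discr p (of_real y) = 0)"

text \<open>If \<open>p (-1) 1 = p 0 1 = 0\<close>, then \<open>y_one p = 0\<close>, \<open>ker_a p 0 = 0\<close> and the two branches
  tend to infinity at \<open>0\<close>. The point at infinity has to be left out, since division by zero would
  place it at \<open>0\<close>. Elsewhere on the interval, \<open>ker_a\<close> is positive.\<close>

definition gluing_curve :: "(int \<Rightarrow> int \<Rightarrow> real) \<Rightarrow> complex set" where
  "gluing_curve p =
     (\<Union>y\<in>{y \<in> {y_one p..1}. ker_a p (of_real y) \<noteq> 0}.
        {X_plus p (of_real y), X_minus p (of_real y)})"

text \<open>In the case just mentioned, the curve passes through infinity and the domain is the side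
  of it that contains \<open>0\<close>; in all other cases it is a Jordan curve. If \<open>p 1 1 = p 0 1 = 0\<close>, the
  point \<open>0\<close> lies on the curve.\<close>

definition gluing_domain :: "(int \<Rightarrow> int \<Rightarrow> real) \<Rightarrow> complex set" where
  "gluing_domain p =
     (if bounded (gluing_curve p) then inside (gluing_curve p)
      else connected_component_set (- gluing_curve p) 0)"

definition angle_theta :: "(int \<Rightarrow> int \<Rightarrow> real) \<Rightarrow> real" where
  "angle_theta p =
     arccos (- (\<Sum>i\<in>{-1..1}. \<Sum>j\<in>{-1..1}. of_int i * of_int j * p i j) /
             sqrt ((\<Sum>i\<in>{-1..1}. \<Sum>j\<in>{-1..1}. (of_int i)\<^sup>2 * p i j) *
                   (\<Sum>i\<in>{-1..1}. \<Sum>j\<in>{-1..1}. (of_int j)\<^sup>2 * p i j)))"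

text \<open>The values on the boundary are those of the continuous extension from the domain. The limit at
  infinity gives a meaning to the value at the point at infinity of an unbounded curve; it is
  void for a bounded domain. The last clause says that \<open>w x\<close> is asymptotically
  \<open>c / (1 - x)^(\<pi> / \<theta>)\<close>.\<close>

definition conformal_gluing ::
    "(int \<Rightarrow> int \<Rightarrow> real) \<Rightarrow> (complex \<Rightarrow> complex) \<Rightarrow> bool" where
  "conformal_gluing p w \<longleftrightarrow>
     w holomorphic_on gluing_domain p \<and>
     inj_on w (gluing_domain p) \<and>
     continuous_on (closure (gluing_domain p) - {1}) w \<and>
     (\<exists>l. (w \<longlongrightarrow> l) (inf at_infinity (principal (closure (gluing_domain p))))) \<and>
     w 0 = 0 \<and>
     (\<forall>y\<in>{y_one p..1}. ker_a p (of_real y) \<noteq> 0 \<longrightarrow>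
        w (X_plus p (of_real y)) = w (X_minus p (of_real y))) \<and>
     (\<exists>c. c \<noteq> 0 \<and>
        ((\<lambda>x. w x * (1 - x) powr of_real (pi / angle_theta p)) \<longlongrightarrow> c)
          (at 1 within gluing_domain p))"

text \<open>The value \<open>w (X_plus p 0)\<close>. It is taken as a limit because \<open>X_plus p 0\<close> is a quotient
  \<open>0 / 0\<close> or infinite when \<open>p (-1) 1 = 0\<close>. For small \<open>y > 0\<close> the point \<open>X_plus p y\<close> always lies
  in the domain or on the curve.\<close>

definition d_zero :: "(int \<Rightarrow> int \<Rightarrow> real) \<Rightarrow> (complex \<Rightarrow> complex) \<Rightarrow> complex" where
  "d_zero p w = Lim (at_right 0) (\<lambda>y::real. w (X_plus p (of_real y)))"

definition base_poly :: "complex \<Rightarrow> nat \<Rightarrow> complex poly" where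
  "base_poly d k =
     (let m = k div 2 in
      if even k then [:0, 1:] ^ m * [:- d, 1:] ^ m else [:0, 1:] ^ (m + 1) * [:- d, 1:] ^ m)"

text \<open>Convergence of the series of \<open>F 1, F 2, \<dots>\<close> to \<open>S\<close> in the ring of formal power series: each
  coefficient of the partial sums is eventually constant.\<close>

definition formal_sums ::
    "(nat \<Rightarrow> nat \<Rightarrow> nat \<Rightarrow> real) \<Rightarrow> (nat \<Rightarrow> nat \<Rightarrow> real) \<Rightarrow> bool" where
  "formal_sums F S \<longleftrightarrow>
     (\<forall>i j. \<forall>\<^sub>F N in sequentially. (\<Sum>k=1..N. F k i j) = S i j)"

end

theory Submission
  imports Defs
begin

text \<open>
  Multiplying a generating function by \<open>K\<close> turns harmonicity into the statement that only pure powers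
  of \<open>x\<close> and of \<open>y\<close> survive, and for \<open>H\<^sub>1\<^sup>k\<close> these are \<open>P\<^sub>k(A(x)) - P\<^sub>k(B(y))\<close>, where \<open>A\<close> and \<open>B\<close>
  are the power series of \<open>\<omega>\<close> and of \<open>\<omega> \<circ> X\<^sub>+\<close> at \<open>0\<close>. Once the orders of vanishing of these series are
  known, the coefficients of an expansion of a harmonic function are the solution of a triangular
  linear system; applying powers of the Laplacian reduces the polyharmonic case to this one.

  The analytic input is that \<open>A'(0) \<noteq> 0\<close> or \<open>B'(0) \<noteq> 0\<close> and that \<open>d\<^sub>0 = B(0)\<close> vanishes only if
  \<open>p\<^sub>1\<^sub>,\<^sub>1 = 0\<close>. In the coordinates \<open>\<xi> = 1/(1-x)\<close>, \<open>\<eta> = 1/(1-y)\<close> zero drift makes the kernel curve a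
  conic, parametrised by \<open>\<xi> = \<xi>\<^sub>0 + s + \<kappa>/s\<close> and \<open>\<eta> = \<eta>\<^sub>0 + c (s e\<^sup>-\<^sup>i\<^sup>\<theta> + \<kappa> e\<^sup>i\<^sup>\<theta>/s)\<close>; the gluing
  domain is the image of the sector \<open>|arg s| < \<theta>\<close>, bounded by a branch of a hyperbola. Gluing along the two
  boundary rays shows that \<open>B(y) = \<omega>(x)\<close> for some \<open>x\<close> in the domain with \<open>K(x, y) = 0\<close>, for all nonreal
  \<open>y\<close> near \<open>0\<close>, so that \<open>B\<close> inherits injectivity from \<open>\<omega>\<close>.
\<close>

subsection \<open>Multiplication by the kernel on coefficients\<close>

text \<open>The obstacle is the boundary. For small \<open>y > 0\<close> the point
  \<open>X_plus p y\<close> lies in the domain if \<open>y_one p > 0\<close>, but on the gluing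
  curve if \<open>y_one p <= 0\<close>, where \<open>w\<close> is merely continuous; and
  \<open>0\<close> itself is on the curve if \<open>p 1 1 = p 0 1 = 0\<close>. So \<open>A\<close>
  and \<open>B\<close> cannot be had by composing analytic functions. They are read off from
  \<open>H 1 1\<close>: since \<open>P_1(z) = z\<close>, the kernel times this series equals
  \<open>w x - w (X_plus p y)\<close>, and separating the variables shows that both terms are power
  series.

  The polynomials \<open>P_k\<close> are built for the triangular system. As \<open>A\<close> and
  \<open>B - d_zero\<close> vanish at the origin, \<open>P_k(A(x))\<close> starts at
  \<open>x\<close> to the power \<open>(k + 1) div 2\<close> and \<open>P_k(B(y))\<close> at
  \<open>y\<close> to the power \<open>k div 2\<close>, so each new \<open>k\<close> reaches exactly
  one new monomial. This needs \<open>d_zero\<close> and both derivatives to be nonzero. If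
  \<open>d_zero = 0\<close>, then \<open>P_k(z) = z^k\<close>, and one nonzero derivative is enough.

  On the curve, the gluing condition gives \<open>B\<close> only along a piece of a real line in the
  parameter plane. The identity is continued into both adjacent half-balls, which accounts for
  nonreal \<open>y\<close>; real \<open>y\<close> are recovered afterwards by the open mapping
  theorem.\<close>

lemma interval_minus_one_one: "{-1..1::int} = {-1, 0, 1}"
  by auto

text \<open>\<open>kernel_mult p f i j\<close> is the coefficient of \<open>x^i y^j\<close> in the product of the kernel with the
  generating function of \<open>f\<close>.\<close>

definition kernel_mult ::
    "(int \<Rightarrow> int \<Rightarrow> real) \<Rightarrow> (nat \<Rightarrow> nat \<Rightarrow> real) \<Rightarrow> nat \<Rightarrow> nat \<Rightarrow> real" where
  "kernel_mult p f i j =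
     (\<Sum>u\<in>{-1..1}. \<Sum>v\<in>{-1..1}. p u v * zero_ext f (int i - 1 + u) (int j - 1 + v))
       - zero_ext f (int i - 1) (int j - 1)"

text \<open>The factor \<open>x y\<close> in the kernel shifts both indices by one. Harmonicity thus
  concerns the coefficients with two positive indices, and row 0 and column 0 of the product are the
  data that an expansion has to match.\<close>

lemma laplacian_eq_kernel_mult: "laplacian p f i j = kernel_mult p f (Suc i) (Suc j)"
  by (simp add: laplacian_def kernel_mult_def zero_ext_def)

lemma zero_ext_sum:
  "zero_ext (\<lambda>i j. \<Sum>k\<in>A. c k * f k i j) i j = (\<Sum>k\<in>A. c k * zero_ext (f k) i j)"
  by (auto simp: zero_ext_def)

lemma kernel_mult_sum:
  "kernel_mult p (\<lambda>i j. \<Sum>k\<in>A. c k * f k i j) i j = (\<Sum>k\<in>A. c k * kernel_mult p (f k) i j)"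
  unfolding kernel_mult_def zero_ext_sum interval_minus_one_one
  by (simp add: sum.distrib sum_distrib_left right_diff_distrib distrib_left sum_subtractf
      mult.left_commute)

lemma kernel_mult_diff:
  "kernel_mult p (\<lambda>i j. f i j - g i j) i j = kernel_mult p f i j - kernel_mult p g i j"
proof -
  have "zero_ext (\<lambda>i j. f i j - g i j) i j = zero_ext f i j - zero_ext g i j" for i j
    by (simp add: zero_ext_def)
  then show ?thesis
    unfolding kernel_mult_def interval_minus_one_one by (simp add: right_diff_distrib)
qed

lemma laplacian_funpow_diff:
  "(laplacian p ^^ n) (\<lambda>i j. f i j - g i j) =
     (\<lambda>i j. (laplacian p ^^ n) f i j - (laplacian p ^^ n) g i j)"
proof (induction n)
  case (Suc n)
  have "laplacian p (\<lambda>i j. f i j - g i j) = (\<lambda>i j. laplacian p f i j - laplacian p g i j)" for f g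
    by (simp add: fun_eq_iff laplacian_eq_kernel_mult kernel_mult_diff)
  with Suc show ?case by simp
qed simp

lemma formal_sums_unique: "formal_sums F S \<Longrightarrow> formal_sums F T \<Longrightarrow> S = T"
proof (intro ext)
  fix i j assume "formal_sums F S" "formal_sums F T"
  then have "\<forall>\<^sub>F N in sequentially. (\<Sum>k=1..N. F k i j) = S i j \<and> (\<Sum>k=1..N. F k i j) = T i j"
    unfolding formal_sums_def by (auto intro: eventually_conj)
  then have "\<forall>\<^sub>F N in sequentially. S i j = T i j"
    by (rule eventually_mono) auto
  then show "S i j = T i j" by simp
qed

text \<open>A coefficient of the product involves only finitely many coefficients of the factor, so
  all of them are constant from a common \<open>N\<close> on.\<close>

lemma formal_sums_kernel_mult:
  assumes "formal_sums (\<lambda>k i j. a k * F k i j) S"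
  shows "formal_sums (\<lambda>k i j. a k * kernel_mult p (F k) i j) (kernel_mult p S)"
  unfolding formal_sums_def
proof (intro allI)
  fix i j
  have "\<forall>\<^sub>F N in sequentially.
      \<forall>x\<in>{..i + 1} \<times> {..j + 1}. (\<Sum>k=1..N. a k * F k (fst x) (snd x)) = S (fst x) (snd x)"
    using assms by (intro eventually_ball_finite) (auto simp: formal_sums_def)
  then show "\<forall>\<^sub>F N in sequentially.
      (\<Sum>k=1..N. a k * kernel_mult p (F k) i j) = kernel_mult p S i j"
  proof (rule eventually_mono)
    fix N
    assume *: "\<forall>x\<in>{..i + 1} \<times> {..j + 1}.
      (\<Sum>k=1..N. a k * F k (fst x) (snd x)) = S (fst x) (snd x)"
    have "zero_ext (\<lambda>i j. \<Sum>k=1..N. a k * F k i j) i' j' = zero_ext S i' j'"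
      if "i' \<le> int i" "j' \<le> int j" for i' j'
      using that * by (auto simp: zero_ext_def)
    then have "kernel_mult p (\<lambda>i j. \<Sum>k=1..N. a k * F k i j) i j = kernel_mult p S i j"
      unfolding kernel_mult_def interval_minus_one_one by simp
    then show "(\<Sum>k=1..N. a k * kernel_mult p (F k) i j) = kernel_mult p S i j"
      by (simp add: kernel_mult_sum)
  qed
qed

lemma formal_sums_laplacian:
  assumes "formal_sums (\<lambda>k i j. a k * F k i j) S"
  shows "formal_sums (\<lambda>k i j. a k * laplacian p (F k) i j) (laplacian p S)"
  using formal_sums_kernel_mult[OF assms, of p]
  by (auto simp: formal_sums_def laplacian_eq_kernel_mult)

lemma formal_sums_laplacian_funpow:
  assumes "formal_sums (\<lambda>k i j. a k * F k i j) S"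
  shows "formal_sums (\<lambda>k i j. a k * (laplacian p ^^ n) (F k) i j) ((laplacian p ^^ n) S)"
  by (induction n) (use assms formal_sums_laplacian in auto)

section \<open>Triangular systems and division by the kernel\<close>

fun triangular_solution :: "(nat \<Rightarrow> nat \<Rightarrow> real) \<Rightarrow> (nat \<Rightarrow> real) \<Rightarrow> nat \<Rightarrow> real" where
  "triangular_solution L t i =
     (t i - (\<Sum>k<i. triangular_solution L t k * L i k)) / L i i"

declare triangular_solution.simps [simp del]

lemma triangular_system_solvable:
  fixes L :: "nat \<Rightarrow> nat \<Rightarrow> real" and t :: "nat \<Rightarrow> real"
  assumes "\<And>i. L i i \<noteq> 0"
  shows "\<exists>a. \<forall>i. (\<Sum>k\<le>i. a k * L i k) = t i"
proof (intro exI allI)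
  fix i
  have "(\<Sum>k\<le>i. triangular_solution L t k * L i k) =
      (\<Sum>k<i. triangular_solution L t k * L i k) + triangular_solution L t i * L i i"
    by (simp add: lessThan_Suc_atMost[symmetric])
  also have "triangular_solution L t i * L i i =
      t i - (\<Sum>k<i. triangular_solution L t k * L i k)"
    using assms[of i] by (subst triangular_solution.simps) simp
  finally show "(\<Sum>k\<le>i. triangular_solution L t k * L i k) = t i" by simp
qed

text \<open>\<open>p 1 1\<close> is the constant term of the kernel, which is therefore a unit among
  the formal power series. Induction on the total degree carries out the division.\<close>

lemma eq_zero_if_kernel_mult_zero:
  assumes "p 1 1 \<noteq> 0" "\<And>i j. kernel_mult p D i j = 0"
  shows "D i j = 0"
proof (induction "i + j" arbitrary: i j rule: less_induct)
  case less
  have z: "zero_ext D i' j' = 0" if "i' \<le> int i" "j' \<le> int j" "i' + j' < int (i + j)" for i' j'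
    using that less[of "nat i'" "nat j'"] by (auto simp: zero_ext_def)
  have "kernel_mult p D i j = p 1 1 * D i j"
    unfolding kernel_mult_def interval_minus_one_one by (simp add: z) (simp add: zero_ext_def)
  then show ?case using assms by simp
qed

text \<open>Without a constant term, the leading term of the kernel is \<open>p 0 1 * x\<close> if
  monomials are ordered by their degree in \<open>y\<close> and then by their degree in
  \<open>x\<close>. The two inductions are nested in this order.\<close>

lemma eq_zero_if_kernel_mult_zero_x:
  assumes "p 1 1 = 0" "p 0 1 \<noteq> 0" "\<And>i j. kernel_mult p D (Suc i) j = 0"
  shows "D i j = 0"
proof (induction j arbitrary: i rule: less_induct)
  case outer: (less j)
  show ?case
  proof (induction i rule: less_induct)
    case inner: (less i)
    have z: "zero_ext D i' j' = 0" if "j' < int j \<or> j' = int j \<and> i' < int i" for i' j'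
      using that outer[of "nat j'" "nat i'"] inner[of "nat i'"] by (auto simp: zero_ext_def)
    have "kernel_mult p D (Suc i) j = p 0 1 * D i j"
      unfolding kernel_mult_def interval_minus_one_one using assms(1)
      by (simp add: z) (simp add: zero_ext_def)
    then show ?case using assms by simp
  qed
qed

lemma eq_zero_if_kernel_mult_zero_y:
  assumes "p 1 1 = 0" "p 1 0 \<noteq> 0" "\<And>i j. kernel_mult p D i (Suc j) = 0"
  shows "D i j = 0"
proof (induction i arbitrary: j rule: less_induct)
  case outer: (less i)
  show ?case
  proof (induction j rule: less_induct)
    case inner: (less j)
    have z: "zero_ext D i' j' = 0" if "i' < int i \<or> i' = int i \<and> j' < int j" for i' j'
      using that outer[of "nat i'" "nat j'"] inner[of "nat j'"] by (auto simp: zero_ext_def)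
    have "kernel_mult p D i (Suc j) = p 1 0 * D i j"
      unfolding kernel_mult_def interval_minus_one_one using assms(1)
      by (simp add: z) (simp add: zero_ext_def)
    then show ?case using assms by simp
  qed
qed

text \<open>\<open>c 0\<close>, \<open>c 1\<close>, ... are the positions at which coefficients are
  to be matched. Since \<open>F (Suc k)\<close> contributes nothing at positions before
  \<open>c k\<close>, the coefficient of the infinite sum at \<open>c i\<close> is a finite sum and
  the conditions form a triangular system.\<close>

lemma kernel_mult_expansion_exists:
  fixes F :: "nat \<Rightarrow> nat \<Rightarrow> nat \<Rightarrow> real" and c :: "nat \<Rightarrow> nat \<times> nat"
  assumes conv: "\<And>a. \<exists>S. formal_sums (\<lambda>k i j. a k * F k i j) S"
    and diag: "\<And>k. kernel_mult p (F (Suc k)) (fst (c k)) (snd (c k)) \<noteq> 0"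
    and upper: "\<And>i k. i < k \<Longrightarrow> kernel_mult p (F (Suc k)) (fst (c i)) (snd (c i)) = 0"
  obtains a S where "formal_sums (\<lambda>k i j. a k * F k i j) S"
    "\<And>i. kernel_mult p S (fst (c i)) (snd (c i)) = kernel_mult p h (fst (c i)) (snd (c i))"
proof -
  define L where "L i k = kernel_mult p (F (Suc k)) (fst (c i)) (snd (c i))" for i k
  obtain b where b: "\<And>i. (\<Sum>k\<le>i. b k * L i k) = kernel_mult p h (fst (c i)) (snd (c i))"
    using triangular_system_solvable[of L "\<lambda>i. kernel_mult p h (fst (c i)) (snd (c i))"] diag
    unfolding L_def by blast
  \<comment> \<open>The family is numbered from 1 and the unknowns from 0. The value
    \<open>a 0\<close> does not enter, since the sums start at 1.\<close>
  define a where "a k = b (k - 1)" for k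
  obtain S where S: "formal_sums (\<lambda>k i j. a k * F k i j) S" using conv by blast
  show ?thesis
  proof (rule that[OF S])
    fix i
    have "\<forall>\<^sub>F N in sequentially.
        (\<Sum>k=1..N. a k * kernel_mult p (F k) (fst (c i)) (snd (c i))) =
          kernel_mult p S (fst (c i)) (snd (c i))"
      using formal_sums_kernel_mult[OF S, of p] by (simp add: formal_sums_def)
    then have "\<forall>\<^sub>F N in sequentially. i < N \<and>
        (\<Sum>k=1..N. a k * kernel_mult p (F k) (fst (c i)) (snd (c i))) =
          kernel_mult p S (fst (c i)) (snd (c i))"
      by (intro eventually_conj eventually_gt_at_top)
    then obtain N where N: "N > i"
      "(\<Sum>k=1..N. a k * kernel_mult p (F k) (fst (c i)) (snd (c i))) =
          kernel_mult p S (fst (c i)) (snd (c i))"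
      using eventually_happens trivial_limit_sequentially by blast
    have "(\<Sum>k=1..N. a k * kernel_mult p (F k) (fst (c i)) (snd (c i))) = (\<Sum>k<N. b k * L i k)"
      by (rule sum.reindex_bij_witness[of _ Suc "\<lambda>k. k - 1"]) (auto simp: a_def L_def)
    also have "\<dots> = (\<Sum>k\<le>i. b k * L i k)"
      using N(1) upper by (intro sum.mono_neutral_right) (auto simp: L_def)
    finally show "kernel_mult p S (fst (c i)) (snd (c i)) = kernel_mult p h (fst (c i)) (snd (c i))"
      using N b by simp
  qed
qed

text \<open>For \<open>h\<close> in level \<open>n + 1\<close>, the \<open>n\<close>-fold Laplacian
  of \<open>h\<close> is harmonic and has an expansion in the \<open>H 1 k\<close>. The same
  coefficients are put in front of the \<open>H (n + 1) k\<close>; the \<open>n\<close>-fold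
  Laplacian maps this sum to the expansion, so subtracting it from \<open>h\<close> leaves a
  function of level \<open>n\<close>.\<close>

lemma polyharmonic_expansion:
  fixes H :: "nat \<Rightarrow> nat \<Rightarrow> nat \<Rightarrow> nat \<Rightarrow> real"
  assumes base: "\<And>h. h \<in> polyharmonic p 1 \<Longrightarrow> \<exists>a. formal_sums (\<lambda>k i j. a k * H 1 k i j) h"
    and step: "\<And>n k. n \<ge> 1 \<Longrightarrow> k \<ge> 1 \<Longrightarrow> laplacian p (H (n + 1) k) = H n k"
    and conv: "\<And>n (a :: nat \<Rightarrow> real). n \<ge> 1 \<Longrightarrow>
      \<exists>S. formal_sums (\<lambda>k i j. a k * H n k i j) S"
  assumes "n \<ge> 1" "h \<in> polyharmonic p n"
  shows "\<exists>(a :: nat \<Rightarrow> nat \<Rightarrow> real) (S :: nat \<Rightarrow> nat \<Rightarrow> nat \<Rightarrow> real).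
      (\<forall>i\<in>{1..n}. formal_sums (\<lambda>j r s. a i j * H i j r s) (S i)) \<and>
      h = (\<lambda>r s. \<Sum>i=1..n. S i r s)"
  using assms(4,5)
proof (induction n arbitrary: h rule: dec_induct)
  case base
  obtain a where "formal_sums (\<lambda>k i j. a k * H 1 k i j) h" using assms(1)[OF base] by blast
  then show ?case by (intro exI[of _ "\<lambda>_. a"] exI[of _ "\<lambda>_. h"]) auto
next
  case (step n)
  have iter: "(laplacian p ^^ m) (H (Suc m) k) = H 1 k" if "k \<ge> 1" for m k
  proof (induction m)
    case (Suc m)
    then show ?case using assms(2)[of "Suc m" k] that by (simp add: funpow_Suc_right del: funpow.simps)
  qed simp
  have "(laplacian p ^^ n) h \<in> polyharmonic p 1"
    using step.prems by (simp add: polyharmonic_def)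
  then obtain b where b: "formal_sums (\<lambda>k i j. b k * H 1 k i j) ((laplacian p ^^ n) h)"
    using assms(1) by blast
  obtain T where T: "formal_sums (\<lambda>k i j. b k * H (Suc n) k i j) T"
    using conv[of "Suc n" b] by auto
  have "formal_sums (\<lambda>k i j. b k * (laplacian p ^^ n) (H (Suc n) k) i j) ((laplacian p ^^ n) T)"
    by (rule formal_sums_laplacian_funpow[OF T])
  then have "formal_sums (\<lambda>k i j. b k * H 1 k i j) ((laplacian p ^^ n) T)"
    unfolding formal_sums_def by (simp add: iter)
  with b have "(laplacian p ^^ n) h = (laplacian p ^^ n) T" by (rule formal_sums_unique)
  then have "(\<lambda>i j. h i j - T i j) \<in> polyharmonic p n"
    by (simp add: polyharmonic_def laplacian_funpow_diff)
  then obtain a S where aS: "\<forall>i\<in>{1..n}. formal_sums (\<lambda>j r s. a i j * H i j r s) (S i)"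
    "(\<lambda>i j. h i j - T i j) = (\<lambda>r s. \<Sum>i=1..n. S i r s)"
    using step.IH by blast
  have "h i j = T i j + (\<Sum>i'=1..n. S i' i j)" for i j
    using fun_cong[OF fun_cong[OF aS(2), of i], of j] by simp
  then have "h = (\<lambda>r s. \<Sum>i=1..Suc n. (S(Suc n := T)) i r s)"
    by (intro ext) (simp add: sum.cong[of "{1..n}" "{1..n}"])
  moreover have "\<forall>i\<in>{1..Suc n}.
      formal_sums (\<lambda>j r s. (a(Suc n := b)) i j * H i j r s) ((S(Suc n := T)) i)"
    using aS(1) T by (auto simp: le_Suc_eq)
  ultimately show ?case by blast
qed

subsection \<open>Separation of variables in the generating functions\<close>

lemma has_sum_finite_sum:
  fixes f :: "'k \<Rightarrow> 'a \<Rightarrow> 'b :: topological_comm_monoid_add"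
  assumes "finite I" "\<And>k. k \<in> I \<Longrightarrow> (f k has_sum s k) A"
  shows "((\<lambda>x. \<Sum>k\<in>I. f k x) has_sum (\<Sum>k\<in>I. s k)) A"
  using assms by (induction I rule: finite_induct) (auto intro: has_sum_add)

lemma has_sum_shift:
  fixes x y s :: complex
  assumes "((\<lambda>(i, j). of_real (h i j) * x ^ i * y ^ j) has_sum s) UNIV"
  shows "((\<lambda>(i, j). of_real (zero_ext h (int i - int a) (int j - int b)) * x ^ i * y ^ j)
    has_sum (x ^ a * y ^ b * s)) UNIV"
proof -
  let ?g = "\<lambda>(i, j). of_real (zero_ext h (int i - int a) (int j - int b)) * x ^ i * y ^ j"
  let ?\<phi> = "\<lambda>(i::nat, j::nat). (i + a, j + b)"
  have "((\<lambda>z. x ^ a * y ^ b * (case z of (i, j) \<Rightarrow> of_real (h i j) * x ^ i * y ^ j))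
      has_sum (x ^ a * y ^ b * s)) UNIV"
    by (rule has_sum_cmult_right[OF assms])
  moreover have "(\<lambda>z. x ^ a * y ^ b * (case z of (i, j) \<Rightarrow> of_real (h i j) * x ^ i * y ^ j)) = ?g \<circ> ?\<phi>"
    by (auto simp: fun_eq_iff zero_ext_def power_add)
  ultimately have "(?g \<circ> ?\<phi> has_sum (x ^ a * y ^ b * s)) UNIV" by simp
  moreover have "inj_on ?\<phi> UNIV" by (auto simp: inj_on_def)
  ultimately have "(?g has_sum (x ^ a * y ^ b * s)) (range ?\<phi>)"
    by (simp add: has_sum_reindex)
  moreover have "?g z = 0" if "z \<notin> range ?\<phi>" for z
  proof -
    obtain i j where z: "z = (i, j)" by (cases z)
    have "i < a \<or> j < b"
    proof (rule ccontr)
      assume "\<not> (i < a \<or> j < b)"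
      then have "z = ?\<phi> (i - a, j - b)" by (simp add: z)
      with that show False by blast
    qed
    then show ?thesis by (auto simp: z zero_ext_def)
  qed
  ultimately show ?thesis
    by (subst (asm) has_sum_cong_neutral[where T = UNIV and g = ?g]) auto
qed

lemma has_sum_kernel_mult:
  fixes x y s :: complex
  assumes "((\<lambda>(i, j). of_real (h i j) * x ^ i * y ^ j) has_sum s) UNIV"
  shows "((\<lambda>(i, j). of_real (kernel_mult p h i j) * x ^ i * y ^ j)
    has_sum (walk_kernel p x y * s)) UNIV"
proof -
  let ?t = "\<lambda>a b z. case z of (i, j) \<Rightarrow>
    of_real (zero_ext h (int i - int a) (int j - int b)) * x ^ i * y ^ j"
  have "((\<lambda>z. (\<Sum>u\<in>{-1..1}. \<Sum>v\<in>{-1..1}. of_real (p u v) * ?t (nat (1 - u)) (nat (1 - v)) z)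
      + (-1) * ?t 1 1 z) has_sum
      (\<Sum>u\<in>{-1..1}. \<Sum>v\<in>{-1..1}. of_real (p u v) * (x ^ nat (1 - u) * y ^ nat (1 - v) * s))
      + (-1) * (x ^ 1 * y ^ 1 * s)) UNIV"
    by (intro has_sum_add has_sum_finite_sum has_sum_cmult_right has_sum_shift assms) auto
  moreover have "(\<Sum>u\<in>{-1..1}. \<Sum>v\<in>{-1..1}. of_real (p u v) * ?t (nat (1 - u)) (nat (1 - v)) z)
      + (-1) * ?t 1 1 z = (case z of (i, j) \<Rightarrow> of_real (kernel_mult p h i j) * x ^ i * y ^ j)" for z
    by (cases z) (simp add: interval_minus_one_one kernel_mult_def distrib_right
        left_diff_distrib mult.assoc)
  moreover have "(\<Sum>u\<in>{-1..1}. \<Sum>v\<in>{-1..1}. of_real (p u v) * (x ^ nat (1 - u) * y ^ nat (1 - v) * s))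
      + (-1) * (x ^ 1 * y ^ 1 * s) = walk_kernel p x y * s"
    by (simp add: interval_minus_one_one walk_kernel_def algebra_simps)
  ultimately show ?thesis by simp
qed

lemma fps_eq_0_if_zeros_accumulate:
  fixes F :: "complex fps"
  assumes "ereal R \<le> fps_conv_radius F" "S \<subseteq> ball 0 R" "z \<in> ball 0 R" "z islimpt S"
    and "\<And>x. x \<in> S \<Longrightarrow> eval_fps F x = 0"
  shows "F = 0"
proof -
  have R: "R > 0" using assms(3) by (auto intro: le_less_trans[OF norm_ge_zero])
  have zero: "eval_fps F x = 0" if "x \<in> ball 0 R" for x
    using assms that
    by (intro analytic_continuation[of "eval_fps F" "ball 0 R" S z x] holomorphic_on_eval_fps
        ball_eball_mono) auto
  show "F = 0"
  proof (rule eval_fps_eqD)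
    show "fps_conv_radius F > 0" using assms(1) R
      by (metis ereal_less(2) less_le_trans)
    have "eventually (\<lambda>x::complex. x \<in> ball 0 R) (nhds 0)"
      using R by (intro eventually_nhds_in_open) auto
    then show "eventually (\<lambda>x. eval_fps F x = eval_fps 0 x) (nhds 0)"
      by eventually_elim (use zero in auto)
  qed auto
qed

lemma of_real_interval_islimpt:
  assumes "0 < (r::real)"
  shows "(0::complex) islimpt of_real ` {0<..<r}"
  unfolding islimpt_approachable
proof (intro allI impI)
  fix e :: real assume "e > 0"
  then show "\<exists>x'\<in>of_real ` {0<..<r}. x' \<noteq> (0::complex) \<and> dist x' 0 < e"
    using assms by (intro bexI[of _ "of_real (min e r / 2)"] imageI) auto
qed

lemma islimpt_Int_ball:
  fixes z :: "'a :: metric_space"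
  assumes "z islimpt S" "r > 0"
  shows "z islimpt (S \<inter> ball z r)"
  unfolding islimpt_approachable
proof (intro allI impI)
  fix e :: real assume "e > 0"
  then have "min e r > 0" using assms by simp
  then have "\<exists>x\<in>S. x \<noteq> z \<and> dist x z < min e r"
    using assms unfolding islimpt_approachable by blast
  then show "\<exists>x\<in>S \<inter> ball z r. x \<noteq> z \<and> dist x z < e"
    by (auto simp: dist_commute)
qed

lemma fps_eqI_near_0:
  fixes F G :: "complex fps"
  assumes "fps_conv_radius F > 0" "fps_conv_radius G > 0" "0 islimpt S"
    and "\<And>x. x \<in> S \<Longrightarrow> norm x < r \<Longrightarrow> eval_fps F x = eval_fps G x" and "r > 0"
  shows "F = G"
proof -
  obtain R where R: "0 < R" "ereal R < fps_conv_radius F" "ereal R < fps_conv_radius G"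
    using ereal_dense2[of 0 "min (fps_conv_radius F) (fps_conv_radius G)"] assms(1,2)
    by (auto simp: zero_ereal_def)
  define R' where "R' = min R r"
  have R': "R' > 0" "R' \<le> R" "R' \<le> r" using R assms(5) by (auto simp: R'_def)
  have "F - G = 0"
  proof (rule fps_eq_0_if_zeros_accumulate)
    have "ereal R' \<le> min (fps_conv_radius F) (fps_conv_radius G)"
      using R R' by (auto intro: order.trans[of _ "ereal R"])
    also have "\<dots> \<le> fps_conv_radius (F - G)" by (rule fps_conv_radius_diff)
    finally show "ereal R' \<le> fps_conv_radius (F - G)" .
    show "S \<inter> ball 0 R' \<subseteq> ball 0 R'" "0 \<in> ball 0 R'" using R' by auto
    show "0 islimpt (S \<inter> ball 0 R')"
      using assms(3) R' by (intro islimpt_Int_ball)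
    fix x assume x: "x \<in> S \<inter> ball 0 R'"
    have "ereal (norm x) < ereal R" using x R' by auto
    then have "ereal (norm x) < fps_conv_radius F" "ereal (norm x) < fps_conv_radius G"
      using less_trans[OF _ R(2)] less_trans[OF _ R(3)] by blast+
    then show "eval_fps (F - G) x = 0"
      using x R' assms(4)[of x] by (simp add: eval_fps_diff)
  qed
  then show ?thesis by simp
qed

text \<open>Unconditional summability permits regrouping by powers of \<open>y\<close>. The factor
  \<open>y ^ j\<close> is then cancelled from each inner series, which uses
  \<open>y \<noteq> 0\<close>.\<close>

lemma double_series_sections:
  fixes M :: "nat \<Rightarrow> nat \<Rightarrow> complex"
  assumes "((\<lambda>(i, j). M i j * x ^ i * y ^ j) has_sum s) UNIV" "y \<noteq> 0"
  defines "C \<equiv> \<lambda>j. Abs_fps (\<lambda>i. M i j)"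
  shows "\<And>j. fps_conv_radius (C j) \<ge> norm x"
    and "(\<lambda>j. eval_fps (C j) x * y ^ j) sums s"
proof -
  have sw: "((\<lambda>(j, i). M i j * x ^ i * y ^ j) has_sum s) (UNIV \<times> UNIV)"
    using assms(1) has_sum_swap[of "\<lambda>(i, j). M i j * x ^ i * y ^ j" UNIV UNIV s] by simp
  have row: "((\<lambda>i. M i j * x ^ i) has_sum eval_fps (C j) x) UNIV" for j
  proof -
    have "(\<lambda>i. M i j * x ^ i * y ^ j) summable_on UNIV"
      using summable_on_SigmaD1[of "\<lambda>j i. M i j * x ^ i * y ^ j" UNIV "\<lambda>_. UNIV" j]
        has_sum_imp_summable[OF sw] by simp
    then have "(\<lambda>i. y ^ j * (M i j * x ^ i)) summable_on UNIV" by (simp add: mult_ac)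
    then have "(\<lambda>i. M i j * x ^ i) summable_on UNIV"
      using assms(2) by (subst (asm) summable_on_cmult_right') auto
    then obtain t where t: "((\<lambda>i. M i j * x ^ i) has_sum t) UNIV" by (auto simp: summable_on_def)
    then have "(\<lambda>i. M i j * x ^ i) sums t" by (rule has_sum_imp_sums)
    then have "t = eval_fps (C j) x" by (simp add: eval_fps_def C_def sums_iff)
    with t show ?thesis by simp
  qed
  show "fps_conv_radius (C j) \<ge> norm x" for j
    unfolding fps_conv_radius_def
    by (rule conv_radius_geI) (use has_sum_imp_sums[OF row[of j]] in \<open>simp add: C_def sums_iff\<close>)
  have "((\<lambda>j. eval_fps (C j) x * y ^ j) has_sum s) UNIV"
    by (rule has_sum_SigmaD[OF sw]) (use has_sum_cmult_left[OF row] in simp)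
  then show "(\<lambda>j. eval_fps (C j) x * y ^ j) sums s" by (rule has_sum_imp_sums)
qed

text \<open>Neither \<open>g\<close> nor \<open>f\<close> is assumed to be analytic at 0, and
  \<open>G\<close> need only accumulate there. The assumption on \<open>walk_kernel p x 0\<close>
  makes small \<open>y\<close> admissible for each fixed \<open>x\<close>; the finiteness assumption
  supplies an admissible \<open>x\<close> for each fixed \<open>y\<close>.\<close>

lemma kernel_mult_split:
  fixes g :: "complex \<Rightarrow> complex" and f :: "real \<Rightarrow> complex"
  assumes lim: "0 islimpt G"
    and "r0 > 0" and kx: "\<And>x. 0 < norm x \<Longrightarrow> norm x < r0 \<Longrightarrow> walk_kernel p x 0 \<noteq> 0"
    and ky: "\<And>y::real. y > 0 \<Longrightarrow> finite {x. walk_kernel p x (of_real y) = 0}"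
    and "\<epsilon> > 0"
    and base: "\<And>x y. x \<in> G \<Longrightarrow> norm x < \<epsilon> \<Longrightarrow> 0 < y \<Longrightarrow> y < \<epsilon> \<Longrightarrow>
      walk_kernel p x (of_real y) \<noteq> 0 \<Longrightarrow>
      ((\<lambda>(i, j). of_real (h i j) * x ^ i * of_real y ^ j) has_sum
         ((g x - f y) / walk_kernel p x (of_real y))) UNIV"
  obtains A B r where "fps_conv_radius A > 0" "fps_conv_radius B > 0" "r > 0"
    "\<And>x. x \<in> G \<Longrightarrow> x \<noteq> 0 \<Longrightarrow> norm x < r \<Longrightarrow> g x = eval_fps A x"
    "\<And>y. 0 < y \<Longrightarrow> y < r \<Longrightarrow> f y = eval_fps B (of_real y)"
    "\<And>i j. complex_of_real (kernel_mult p h i j) =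
       (if j = 0 then fps_nth A i else 0) - (if i = 0 then fps_nth B j else 0)"
proof -
  define M where "M i j = complex_of_real (kernel_mult p h i j)" for i j
  define C where "C j = Abs_fps (\<lambda>i. M i j)" for j
  define r where "r = min \<epsilon> r0"
  have r: "r > 0" "r \<le> \<epsilon>" "r \<le> r0" using assms by (auto simp: r_def)
  define G' where "G' = {x \<in> G. x \<noteq> 0 \<and> norm x < r}"
  have G': "x \<in> G" "x \<noteq> 0" "norm x < \<epsilon>" "norm x < r0" if "x \<in> G'" for x
    using that r by (auto simp: G'_def)
  have G'_eq: "G' = (G - {0}) \<inter> ball 0 r" by (auto simp: G'_def)
  have lim': "0 islimpt G'"
  proof -
    have "0 islimpt (G \<inter> ball 0 r)"
      using lim r by (intro islimpt_Int_ball)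
    moreover have "G \<inter> ball 0 r - {0} = G'" by (auto simp: G'_eq)
    ultimately show ?thesis using islimpt_punctured[of 0 "G \<inter> ball 0 r"] by simp
  qed
  have sums: "(\<lambda>j. eval_fps (C j) x * of_real y ^ j) sums (g x - f y)"
    and rad: "\<And>j. fps_conv_radius (C j) \<ge> norm x"
    if "x \<in> G'" "0 < y" "y < \<epsilon>" "walk_kernel p x (of_real y) \<noteq> 0" for x y
  proof -
    have "((\<lambda>(i, j). M i j * x ^ i * of_real y ^ j) has_sum (g x - f y)) UNIV"
      using has_sum_kernel_mult[OF base[OF G'(1,3) that(2-4)], of p] that by (simp add: M_def)
    from double_series_sections[OF this] that
    show "(\<lambda>j. eval_fps (C j) x * of_real y ^ j) sums (g x - f y)"
      "\<And>j. fps_conv_radius (C j) \<ge> norm x" by (auto simp: C_def)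
  qed
  have small: "\<exists>e>0. e \<le> \<epsilon> \<and> (\<forall>y. 0 < y \<longrightarrow> y < e \<longrightarrow> walk_kernel p x (of_real y) \<noteq> 0)"
    if "x \<in> G'" for x
  proof -
    have "isCont (\<lambda>y::real. walk_kernel p x (of_real y)) 0"
      unfolding walk_kernel_def by (intro continuous_intros)
    moreover have "walk_kernel p x (of_real 0) \<noteq> 0" using kx[of x] G'[OF that] by simp
    ultimately obtain e where "e > 0" "\<And>y::real. dist 0 y < e \<Longrightarrow> walk_kernel p x (of_real y) \<noteq> 0"
      using continuous_at_avoid[of 0 "\<lambda>y::real. walk_kernel p x (of_real y)" 0] by auto
    then show ?thesis using assms by (intro exI[of _ "min e \<epsilon>"]) auto
  qed
  \<comment> \<open>Subtracting the expansions in \<open>y\<close> at two points \<open>x\<close>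
    and \<open>x'\<close> eliminates \<open>f\<close>. What remains is the constant
    \<open>g x - g x'\<close>, so all coefficients of positive powers of \<open>y\<close>
    agree.\<close>
  have const: "eval_fps (C j) x = eval_fps (C j) x'" if "x \<in> G'" "x' \<in> G'" "j > 0" for x x' j
  proof -
    obtain e1 where e1: "e1 > 0" "e1 \<le> \<epsilon>" "\<And>y. 0 < y \<Longrightarrow> y < e1 \<Longrightarrow> walk_kernel p x (of_real y) \<noteq> 0"
      using small[OF \<open>x \<in> G'\<close>] by blast
    obtain e2 where e2: "e2 > 0" "e2 \<le> \<epsilon>" "\<And>y. 0 < y \<Longrightarrow> y < e2 \<Longrightarrow> walk_kernel p x' (of_real y) \<noteq> 0"
      using small[OF \<open>x' \<in> G'\<close>] by blast
    define e where "e = min e1 e2"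
    define E where "E = Abs_fps (\<lambda>j. eval_fps (C j) x - eval_fps (C j) x')"
    have s: "(\<lambda>j. fps_nth E j * of_real y ^ j) sums (g x - g x')" if "0 < y" "y < e" for y
    proof -
      have "(\<lambda>j. eval_fps (C j) x * of_real y ^ j) sums (g x - f y)"
        "(\<lambda>j. eval_fps (C j) x' * of_real y ^ j) sums (g x' - f y)"
        using sums[of x y] sums[of x' y] e1 e2 that \<open>x \<in> G'\<close> \<open>x' \<in> G'\<close> by (auto simp: e_def)
      from sums_diff[OF this] show ?thesis by (simp add: E_def left_diff_distrib)
    qed
    have e: "e > 0" using e1 e2 by (simp add: e_def)
    have "summable (\<lambda>j. fps_nth E j * complex_of_real (e / 2) ^ j)"
      using s[of "e / 2"] e by (auto simp: sums_iff)
    then have "fps_conv_radius E \<ge> norm (complex_of_real (e / 2))"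
      unfolding fps_conv_radius_def by (rule conv_radius_geI)
    moreover have "norm (complex_of_real (e / 2)) > 0" using e by simp
    ultimately have "fps_conv_radius E > 0" using ereal_less(2) less_le_trans by blast
    then have "E = fps_const (g x - g x')"
    proof (rule fps_eqI_near_0[OF _ _ of_real_interval_islimpt[OF e] _ zero_less_one])
      fix z :: complex assume "z \<in> of_real ` {0<..<e}"
      then show "eval_fps E z = eval_fps (fps_const (g x - g x')) z"
        unfolding eval_fps_const using s by (auto simp: eval_fps_def sums_iff)
    qed auto
    then have "fps_nth E j = 0" using that(3) by simp
    then show ?thesis by (simp add: E_def)
  qed
  obtain x1 where x1: "x1 \<in> G'" using lim' unfolding islimpt_def by blast
  have posC: "fps_conv_radius (C j) > 0" for j
  proof -
    obtain e where "e > 0" "e \<le> \<epsilon>" "\<And>y. 0 < y \<Longrightarrow> y < e \<Longrightarrow> walk_kernel p x1 (of_real y) \<noteq> 0"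
      using small[OF x1] by blast
    then have "fps_conv_radius (C j) \<ge> norm x1"
      by (intro rad[OF x1, of "e / 2"]) (auto simp del: of_real_divide)
    moreover have "0 < ereal (norm x1)" using G'(2)[OF x1] by (simp add: zero_ereal_def)
    ultimately show ?thesis by (rule less_le_trans[rotated])
  qed
  have M0: "M i j = 0" if "i > 0" "j > 0" for i j
  proof -
    have "C j = fps_const (eval_fps (C j) x1)"
      by (rule fps_eqI_near_0[OF posC _ lim' _ zero_less_one])
        (use const[OF _ x1 \<open>j > 0\<close>] in auto)
    then have "fps_nth (C j) i = 0" using that(1)
      by (metis fps_nth_fps_const less_irrefl)
    then show ?thesis by (simp add: C_def)
  qed
  have C_eq: "C j = fps_const (M 0 j)" if "j > 0" for j
    using M0[OF _ that] by (intro fps_ext) (simp add: C_def)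
  \<comment> \<open>The part with positive powers of \<open>y\<close>, which by \<open>C_eq\<close>
    no longer depends on \<open>x\<close>.\<close>
  define E where "E = Abs_fps (\<lambda>j. if j = 0 then 0 else M 0 j)"
  have E: "f y + eval_fps E (of_real y) = g x - eval_fps (C 0) x"
    and sumE: "summable (\<lambda>j. fps_nth E j * complex_of_real y ^ j)"
    if "x \<in> G'" "0 < y" "y < \<epsilon>" "walk_kernel p x (of_real y) \<noteq> 0" for x y
  proof -
    have s: "(\<lambda>j. eval_fps (C j) x * of_real y ^ j) sums (g x - f y)" using sums that by blast
    then have "(\<lambda>j. eval_fps (C j) x * of_real y ^ j - (if j = 0 then eval_fps (C 0) x else 0))
        sums (g x - f y - eval_fps (C 0) x)"
      using sums_single[of 0 "\<lambda>_. eval_fps (C 0) x"] by (intro sums_diff) simp_all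
    moreover have "(\<lambda>j. eval_fps (C j) x * of_real y ^ j - (if j = 0 then eval_fps (C 0) x else 0)) =
        (\<lambda>j. fps_nth E j * of_real y ^ j)"
      by (auto simp: fun_eq_iff E_def C_eq)
    ultimately have s: "(\<lambda>j. fps_nth E j * of_real y ^ j) sums (g x - f y - eval_fps (C 0) x)" by simp
    then show "summable (\<lambda>j. fps_nth E j * complex_of_real y ^ j)" by (simp add: sums_iff)
    have "eval_fps E (of_real y) = g x - f y - eval_fps (C 0) x"
      using s by (simp add: eval_fps_def sums_iff)
    then show "f y + eval_fps E (of_real y) = g x - eval_fps (C 0) x" by simp
  qed
  \<comment> \<open>The separation constant: \<open>g x - eval_fps (C 0) x\<close> depends only on
    \<open>x\<close>, \<open>f y + eval_fps E y\<close> only on \<open>y\<close>, and they are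
    equal.\<close>
  define c where "c = g x1 - eval_fps (C 0) x1"
  have gx: "g x = c + eval_fps (C 0) x" if "x \<in> G'" for x
  proof -
    obtain e1 where e1: "e1 > 0" "e1 \<le> \<epsilon>" "\<And>y. 0 < y \<Longrightarrow> y < e1 \<Longrightarrow> walk_kernel p x (of_real y) \<noteq> 0"
      using small[OF \<open>x \<in> G'\<close>] by blast
    obtain e2 where e2: "e2 > 0" "e2 \<le> \<epsilon>" "\<And>y. 0 < y \<Longrightarrow> y < e2 \<Longrightarrow> walk_kernel p x1 (of_real y) \<noteq> 0"
      using small[OF x1] by blast
    define y where "y = min e1 e2 / 2"
    have "0 < y" "y < e1" "y < e2" using e1 e2 by (auto simp: y_def)
    then have "g x - eval_fps (C 0) x = c"
      unfolding c_def using E[OF that, of y] E[OF x1, of y] e1 e2 by auto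
    then show ?thesis by (simp add: algebra_simps)
  qed
  have ex: "\<exists>x\<in>G'. walk_kernel p x (of_real y) \<noteq> 0" if "y > 0" for y
  proof -
    have "infinite G'" using lim' islimpt_finite by blast
    with ky[OF that] have "\<not> G' \<subseteq> {x. walk_kernel p x (of_real y) = 0}"
      using finite_subset by blast
    then show ?thesis by blast
  qed
  have fy: "f y = c - eval_fps E (of_real y)" if "0 < y" "y < r" for y
  proof -
    obtain x where x: "x \<in> G'" "walk_kernel p x (of_real y) \<noteq> 0" using ex \<open>0 < y\<close> by blast
    then have "f y + eval_fps E (of_real y) = c" using E[OF x(1), of y] gx[OF x(1)] that r by auto
    then show ?thesis by (simp add: algebra_simps)
  qed
  obtain x where x: "x \<in> G'" "walk_kernel p x (of_real (r / 2)) \<noteq> 0" using ex[of "r / 2"] r by auto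
  have "fps_conv_radius E \<ge> norm (complex_of_real (r / 2))"
    unfolding fps_conv_radius_def
    by (rule conv_radius_geI) (use sumE[OF x(1), of "r / 2"] x r in auto)
  then have radE: "fps_conv_radius E \<ge> ereal (r / 2)" using r by simp
  have posE: "fps_conv_radius E > 0"
    using radE r by (auto intro: less_le_trans[rotated] simp: zero_ereal_def)
  obtain r' where r': "0 < r'" "ereal r' < fps_conv_radius (C 0)"
    using ereal_dense2[OF posC[of 0]] by (auto simp: zero_ereal_def)
  show ?thesis
  proof (rule that[of "fps_const c + C 0" "fps_const c - E" "min (r / 2) r'"])
    have "0 < min (fps_conv_radius (fps_const c)) (fps_conv_radius (C 0))" using posC by simp
    then show "fps_conv_radius (fps_const c + C 0) > 0"
      using fps_conv_radius_add less_le_trans by blast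
    have "0 < min (fps_conv_radius (fps_const c)) (fps_conv_radius E)" using posE by simp
    then show "fps_conv_radius (fps_const c - E) > 0"
      using fps_conv_radius_diff less_le_trans by blast
    show "min (r / 2) r' > 0" using r r' by simp
    show "g x = eval_fps (fps_const c + C 0) x" if "x \<in> G" "x \<noteq> 0" "norm x < min (r / 2) r'" for x
    proof -
      have "ereal (norm x) < fps_conv_radius (C 0)"
        using that r' by (auto intro: less_trans[of _ "ereal r'"])
      moreover have "x \<in> G'" using that r by (auto simp: G'_def)
      ultimately show ?thesis by (simp add: gx eval_fps_add)
    qed
    show "f y = eval_fps (fps_const c - E) (of_real y)" if "0 < y" "y < min (r / 2) r'" for y
    proof -
      have "ereal (norm (complex_of_real y)) < fps_conv_radius E"
        using that radE by (auto intro: less_le_trans[of _ "ereal (r / 2)"])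
      then show ?thesis using that r by (simp add: fy eval_fps_diff)
    qed
    show "complex_of_real (kernel_mult p h i j) =
       (if j = 0 then fps_nth (fps_const c + C 0) i else 0)
         - (if i = 0 then fps_nth (fps_const c - E) j else 0)" for i j
      using M0[of i j] by (auto simp: M_def C_def E_def)
  qed
qed

subsection \<open>The kernel curve as a conic\<close>

locale zero_drift_walk =
  fixes p :: "int \<Rightarrow> int \<Rightarrow> real"
  assumes probs: "transition_probs p" and nondeg: "non_degenerate p" and drift: "zero_drift p"
begin

lemma p_nonneg [simp]:
  "p 1 1 \<ge> 0" "p 1 0 \<ge> 0" "p 1 (-1) \<ge> 0" "p 0 1 \<ge> 0" "p 0 0 \<ge> 0" "p 0 (-1) \<ge> 0"
  "p (-1) 1 \<ge> 0" "p (-1) 0 \<ge> 0" "p (-1) (-1) \<ge> 0"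
  using probs unfolding transition_probs_def interval_minus_one_one by auto

lemma p_sum: "p 1 1 + p 1 0 + p 1 (-1) + p 0 1 + p 0 0 + p 0 (-1)
    + p (-1) 1 + p (-1) 0 + p (-1) (-1) = 1"
  using probs unfolding transition_probs_def interval_minus_one_one by simp

lemma p_drift:
  "p 1 1 + p 1 0 + p 1 (-1) = p (-1) 1 + p (-1) 0 + p (-1) (-1)"
  "p 1 1 + p 0 1 + p (-1) 1 = p 1 (-1) + p 0 (-1) + p (-1) (-1)"
  using drift unfolding zero_drift_def interval_minus_one_one by simp_all

lemma p_nondeg:
  "\<not> (p 1 1 = 0 \<and> p 1 0 = 0 \<and> p 1 (-1) = 0)" (is ?thesis1)
  "\<not> (p 1 0 = 0 \<and> p 1 (-1) = 0 \<and> p 0 (-1) = 0)" (is ?thesis2)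
  "\<not> (p 1 (-1) = 0 \<and> p 0 (-1) = 0 \<and> p (-1) (-1) = 0)" (is ?thesis3)
  "\<not> (p 0 (-1) = 0 \<and> p (-1) (-1) = 0 \<and> p (-1) 0 = 0)" (is ?thesis4)
  "\<not> (p (-1) (-1) = 0 \<and> p (-1) 0 = 0 \<and> p (-1) 1 = 0)" (is ?thesis5)
  "\<not> (p (-1) 0 = 0 \<and> p (-1) 1 = 0 \<and> p 0 1 = 0)" (is ?thesis6)
  "\<not> (p (-1) 1 = 0 \<and> p 0 1 = 0 \<and> p 1 1 = 0)" (is ?thesis7)
  "\<not> (p 0 1 = 0 \<and> p 1 1 = 0 \<and> p 1 0 = 0)" (is ?thesis8)
proof -
  have *: "\<not> (cyclic_steps p ! m = 0 \<and> cyclic_steps p ! ((m + 1) mod 8) = 0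
               \<and> cyclic_steps p ! ((m + 2) mod 8) = 0)" if "m < 8" for m
    using nondeg that unfolding non_degenerate_def by blast
  show ?thesis1 ?thesis2 ?thesis3 ?thesis4 ?thesis5 ?thesis6 ?thesis7 ?thesis8
    using *[of 0] *[of 1] *[of 2] *[of 3] *[of 4] *[of 5] *[of 6] *[of 7]
    by (simp_all add: cyclic_steps_def)
qed

lemma p_00_less_1: "p 0 0 < 1"
  using p_sum p_nonneg p_nondeg(1) by argo

section \<open>Second moments and the angle\<close>

definition var_x :: real where
  "var_x = p 1 1 + p 1 0 + p 1 (-1) + p (-1) 1 + p (-1) 0 + p (-1) (-1)"

definition var_y :: real where
  "var_y = p 1 1 + p 0 1 + p (-1) 1 + p 1 (-1) + p 0 (-1) + p (-1) (-1)"

definition covar :: real where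
  "covar = p 1 1 + p (-1) (-1) - p 1 (-1) - p (-1) 1"

lemma var_pos [simp]: "var_x > 0" "var_y > 0"
proof -
  show "var_x > 0" unfolding var_x_def using p_nonneg p_nondeg(1) by argo
  show "var_y > 0" unfolding var_y_def using p_nonneg p_nondeg(3) by argo
qed

text \<open>Strict Cauchy-Schwarz inequality. Equality would put all steps on one line, and each
  possible slope then yields three consecutive zeros in the cyclic list of weights.\<close>

lemma covar_squared_less: "covar\<^sup>2 < var_x * var_y"
proof -
  \<comment> \<open>The minimiser of the expectation of \<open>(s * i - j)\<^sup>2\<close>, which is
    the left side of \<open>sq\<close>.\<close>
  define s where "s = covar / var_x"
  have sq: "p 1 1 * (s - 1)\<^sup>2 + p (-1) (-1) * (s - 1)\<^sup>2 + p 1 (-1) * (s + 1)\<^sup>2 + p (-1) 1 * (s + 1)\<^sup>2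
      + (p 1 0 + p (-1) 0) * s\<^sup>2 + (p 0 1 + p 0 (-1)) = s\<^sup>2 * var_x - 2 * s * covar + var_y"
    by (simp add: var_x_def var_y_def covar_def power2_eq_square algebra_simps)
  have "s\<^sup>2 * var_x - 2 * s * covar + var_y = var_y - covar\<^sup>2 / var_x"
    unfolding s_def using var_pos(1) by (simp add: field_simps power2_eq_square)
  moreover have "p 1 1 * (s - 1)\<^sup>2 + p (-1) (-1) * (s - 1)\<^sup>2 + p 1 (-1) * (s + 1)\<^sup>2 + p (-1) 1 * (s + 1)\<^sup>2
      + (p 1 0 + p (-1) 0) * s\<^sup>2 + (p 0 1 + p 0 (-1)) > 0"
  proof (rule ccontr)
    assume "\<not> ?thesis"
    moreover have "p 1 1 * (s - 1)\<^sup>2 \<ge> 0" "p (-1) (-1) * (s - 1)\<^sup>2 \<ge> 0" "p 1 (-1) * (s + 1)\<^sup>2 \<ge> 0"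
      "p (-1) 1 * (s + 1)\<^sup>2 \<ge> 0" "(p 1 0 + p (-1) 0) * s\<^sup>2 \<ge> 0" "p 0 1 \<ge> 0" "p 0 (-1) \<ge> 0"
      by simp_all
    ultimately have z: "p 1 1 * (s - 1)\<^sup>2 = 0" "p (-1) (-1) * (s - 1)\<^sup>2 = 0" "p 1 (-1) * (s + 1)\<^sup>2 = 0"
      "p (-1) 1 * (s + 1)\<^sup>2 = 0" "(p 1 0 + p (-1) 0) * s\<^sup>2 = 0" "p 0 1 = 0" "p 0 (-1) = 0"
      by linarith+
    consider "s = 1" | "s = -1" | "s = 0" | "s \<noteq> 1" "s \<noteq> -1" "s \<noteq> 0" by blast
    then show False
    proof cases
      case 1
      then have "p 1 (-1) = 0" "p 1 0 + p (-1) 0 = 0" using z by auto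
      moreover then have "p 1 0 = 0" using p_nonneg by linarith
      ultimately show False using z p_nondeg(2) by simp
    next
      case 2
      then have "p 1 1 = 0" "p 1 0 + p (-1) 0 = 0" using z by auto
      moreover then have "p 1 0 = 0" using p_nonneg by linarith
      ultimately show False using z p_nondeg(8) by simp
    next
      case 3
      then show False using z p_nondeg(7) by simp
    next
      case 4
      then have "s + 1 \<noteq> 0" by simp
      with 4 show False using z p_nondeg(7) by simp
    qed
  qed
  ultimately have "covar\<^sup>2 / var_x < var_y" using sq by linarith
  then show ?thesis using var_pos(1) by (simp add: field_simps)
qed

definition cos_angle :: real where
  "cos_angle = - covar / sqrt (var_x * var_y)"

definition sin_angle :: real where
  "sin_angle = sqrt (1 - cos_angle\<^sup>2)"

lemma cos_angle_squared: "cos_angle\<^sup>2 = covar\<^sup>2 / (var_x * var_y)"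
  by (simp add: cos_angle_def power_divide less_imp_le)

lemma cos_angle_squared_less: "cos_angle\<^sup>2 < 1"
  using covar_squared_less var_pos by (simp add: cos_angle_squared field_simps)

lemma abs_cos_angle_less: "\<bar>cos_angle\<bar> < 1"
  using cos_angle_squared_less by (simp add: abs_square_less_1)

lemma sin_angle_pos [simp]: "sin_angle > 0"
  using cos_angle_squared_less by (simp add: sin_angle_def)

lemma sin_cos_angle: "sin_angle\<^sup>2 + cos_angle\<^sup>2 = 1"
  using cos_angle_squared_less by (simp add: sin_angle_def)

definition mom_x :: real where "mom_x = p 1 (-1) - p (-1) (-1)"
definition mom_y :: real where "mom_y = p (-1) 1 - p (-1) (-1)"

text \<open>With \<open>eta = eta0 + scale * v\<close>, the coefficients of the two squares in the
  conic agree.\<close>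

definition scale :: real where "scale = sqrt (var_y / var_x)"

text \<open>\<open>(xi0, eta0)\<close> is the centre of the conic: Cramer's rule for the vanishing
  of the gradient, with a nonzero determinant by \<open>covar_squared_less\<close>.\<close>

definition xi0 :: real where
  "xi0 = ((var_y / 2 - mom_x) * var_x - covar * (var_x / 2 - mom_y)) / (var_x * var_y - covar\<^sup>2)"

definition eta0 :: real where
  "eta0 = ((var_x / 2 - mom_y) * var_y - covar * (var_y / 2 - mom_x)) / (var_x * var_y - covar\<^sup>2)"

text \<open>The kernel divided by \<open>(1 - x)\<^sup>2 * (1 - y)\<^sup>2\<close>, in terms of
  \<open>xi = 1 / (1 - x)\<close> and \<open>eta = 1 / (1 - y)\<close>. A Taylor term of the kernel
  at \<open>(1, 1)\<close> of total order \<open>m\<close> becomes a monomial of degree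
  \<open>4 - m\<close>. Total mass one and zero drift exclude orders below 2, so the degree is at
  most 2.\<close>

definition walk_conic :: "complex \<Rightarrow> complex \<Rightarrow> complex" where
  "walk_conic xi eta = of_real (var_y / 2) * (xi\<^sup>2 - xi) + of_real (var_x / 2) * (eta\<^sup>2 - eta)
     + of_real covar * xi * eta + of_real mom_x * xi + of_real mom_y * eta + of_real (p (-1) (-1))"

text \<open>Normalised so that the conic is parametrised by \<open>v = s + kappa / s\<close> and
  \<open>u = s * rho + kappa / (s * rho)\<close> with a unit complex number
  \<open>rho\<close>.\<close>

definition kappa :: real where
  "kappa = - Re (walk_conic (of_real xi0) (of_real eta0)) / (2 * var_y * sin_angle\<^sup>2)"

lemma scale_pos [simp]: "scale > 0"
  using var_pos by (simp add: scale_def)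

lemma scale_eqs: "var_x * scale\<^sup>2 = var_y" "covar * scale = - cos_angle * var_y"
proof -
  show "var_x * scale\<^sup>2 = var_y"
    using var_pos by (simp add: scale_def less_imp_le less_imp_neq[THEN not_sym])
  define a b where "a = sqrt var_x" and "b = sqrt var_y"
  have ab: "a > 0" "b > 0" "var_y = b * b" "scale = b / a" "cos_angle = - covar / (a * b)"
    by (simp_all add: a_def b_def scale_def cos_angle_def real_sqrt_divide real_sqrt_mult less_imp_le)
  show "covar * scale = - cos_angle * var_y"
    unfolding ab(3-5) using ab(1,2) by simp
qed

lemma center_eqs:
  "var_y * xi0 + covar * eta0 = var_y / 2 - mom_x"
  "covar * xi0 + var_x * eta0 = var_x / 2 - mom_y"
proof -
  define d where "d = var_x * var_y - covar\<^sup>2"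
  have d: "d \<noteq> 0" using covar_squared_less by (simp add: d_def)
  have x: "xi0 * d = (var_y / 2 - mom_x) * var_x - covar * (var_x / 2 - mom_y)"
    and e: "eta0 * d = (var_x / 2 - mom_y) * var_y - covar * (var_y / 2 - mom_x)"
    using d by (simp_all add: xi0_def eta0_def d_def)
  have "(var_y * xi0 + covar * eta0) * d = var_y * (xi0 * d) + covar * (eta0 * d)"
    by (simp add: algebra_simps)
  also have "\<dots> = (var_y / 2 - mom_x) * d"
    unfolding x e by (simp add: d_def algebra_simps power2_eq_square)
  finally show "var_y * xi0 + covar * eta0 = var_y / 2 - mom_x" using d by simp
  have "(covar * xi0 + var_x * eta0) * d = covar * (xi0 * d) + var_x * (eta0 * d)"
    by (simp add: algebra_simps)
  also have "\<dots> = (var_x / 2 - mom_y) * d"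
    unfolding x e by (simp add: d_def algebra_simps power2_eq_square)
  finally show "covar * xi0 + var_x * eta0 = var_x / 2 - mom_y" using d by simp
qed

definition normal_conic :: "complex \<Rightarrow> complex \<Rightarrow> complex" where
  "normal_conic u v = u\<^sup>2 - 2 * of_real cos_angle * u * v + v\<^sup>2 - of_real (4 * kappa * sin_angle\<^sup>2)"

lemma conic_normal_form:
  "walk_conic (of_real xi0 + u) (of_real eta0 + of_real scale * v) =
     of_real (var_y / 2) * normal_conic u v"
proof -
  \<comment> \<open>The value at the centre is real, so \<open>Re\<close> in the definition of
    \<open>kappa\<close> loses nothing.\<close>
  have "Im (walk_conic (of_real xi0) (of_real eta0)) = 0"
    by (simp add: walk_conic_def power2_eq_square)
  then have c: "walk_conic (of_real xi0) (of_real eta0) = - of_real (2 * var_y * sin_angle\<^sup>2 * kappa)"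
    using less_imp_neq[OF var_pos(2)] less_imp_neq[OF sin_angle_pos]
    by (simp add: complex_eq_iff kappa_def)
  have expand: "A * ((x + u)\<^sup>2 - (x + u)) + C * ((y + e)\<^sup>2 - (y + e)) + B * (x + u) * (y + e)
      + D * (x + u) + E * (y + e) + F =
      (A * (x\<^sup>2 - x) + C * (y\<^sup>2 - y) + B * x * y + D * x + E * y + F)
      + (2 * A * x + B * y - A + D) * u + (B * x + 2 * C * y - C + E) * e
      + A * u\<^sup>2 + B * u * e + C * e\<^sup>2" for A B C D E F x y e :: complex
    by (simp add: power2_eq_square algebra_simps)
  define e :: "complex" where "e = of_real scale * v"
  have z: "2 * of_real (var_y / 2) * of_real xi0 + of_real covar * of_real eta0 - of_real (var_y / 2)
      + of_real mom_x = (0::complex)"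
    "of_real covar * of_real xi0 + 2 * of_real (var_x / 2) * of_real eta0 - of_real (var_x / 2)
      + of_real mom_y = (0::complex)"
    using arg_cong[OF center_eqs(1), of complex_of_real] arg_cong[OF center_eqs(2), of complex_of_real]
    by simp_all
  have 1: "walk_conic (of_real xi0 + u) (of_real eta0 + e) = walk_conic (of_real xi0) (of_real eta0)
      + of_real (var_y / 2) * u\<^sup>2 + of_real covar * u * e + of_real (var_x / 2) * e\<^sup>2"
    unfolding walk_conic_def expand z by simp
  have 2: "of_real (var_x / 2) * e\<^sup>2 = of_real (var_y / 2) * v\<^sup>2"
    unfolding scale_eqs(1)[symmetric] e_def by (simp add: power_mult_distrib)
  have 3: "of_real covar * u * e = - of_real (cos_angle * var_y) * u * v"
    using arg_cong[OF scale_eqs(2), of complex_of_real] by (simp add: e_def mult_ac)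
  show ?thesis
    unfolding e_def[symmetric] 1 c 2 3 normal_conic_def
    by (simp add: algebra_simps)
qed

lemma ker_expand:
  "ker_a p y = of_real (p (-1) 1) + of_real (p (-1) 0) * y + of_real (p (-1) (-1)) * y\<^sup>2"
  "ker_b p y = of_real (p 0 1) + of_real (p 0 0) * y + of_real (p 0 (-1)) * y\<^sup>2 - y"
  "ker_c p y = of_real (p 1 1) + of_real (p 1 0) * y + of_real (p 1 (-1)) * y\<^sup>2"
  by (simp_all add: ker_a_def ker_b_def ker_c_def interval_minus_one_one add_ac)

text \<open>The left side is \<open>xi\<^sup>2\<close> times the kernel at
  \<open>x = (xi - 1) / xi\<close>. This polynomial form admits \<open>xi = 0\<close>, which stands
  for \<open>x\<close> at infinity.\<close>

lemma kernel_conic: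
  assumes "y \<noteq> 1"
  shows "ker_a p y * (xi - 1)\<^sup>2 + ker_b p y * xi * (xi - 1) + ker_c p y * xi\<^sup>2 =
    (1 - y)\<^sup>2 * walk_conic xi (1 / (1 - y))"
proof -
  define t where "t = 1 - y"
  have t: "t \<noteq> 0" "y = 1 - t" using assms by (auto simp: t_def)
  have p00: "p 0 0 = 1 - (p 1 1 + p 1 0 + p 1 (-1) + p 0 1 + p 0 (-1)
    + p (-1) 1 + p (-1) 0 + p (-1) (-1))" using p_sum by simp
  have p10: "p 1 0 = p (-1) 1 + p (-1) 0 + p (-1) (-1) - p 1 1 - p 1 (-1)"
    using p_drift by simp
  have p01: "p 0 1 = p 1 (-1) + p 0 (-1) + p (-1) (-1) - p 1 1 - p (-1) 1"
    using p_drift by simp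
  have v: "var_y / 2 = p 1 (-1) + p 0 (-1) + p (-1) (-1)"
    "var_x / 2 = p (-1) 1 + p (-1) 0 + p (-1) (-1)"
    using p_drift by (simp_all add: var_x_def var_y_def)
  have "t\<^sup>2 * (A * (xi\<^sup>2 - xi) + C * ((1 / t)\<^sup>2 - 1 / t) + B * xi * (1 / t) + D * xi + E * (1 / t) + F) =
      A * (xi\<^sup>2 - xi) * t\<^sup>2 + C * (1 - t) + B * xi * t + D * xi * t\<^sup>2 + E * t + F * t\<^sup>2"
    for A B C D E F :: complex
    using t(1) by (simp add: power2_eq_square algebra_simps)
  then have "t\<^sup>2 * walk_conic xi (1 / t) = of_real (var_y / 2) * (xi\<^sup>2 - xi) * t\<^sup>2 + of_real (var_x / 2) * (1 - t)
     + of_real covar * xi * t + of_real mom_x * xi * t\<^sup>2 + of_real mom_y * t + of_real (p (-1) (-1)) * t\<^sup>2"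
    unfolding walk_conic_def by blast
  also have "\<dots> = ker_a p y * (xi - 1)\<^sup>2 + ker_b p y * xi * (xi - 1) + ker_c p y * xi\<^sup>2"
    unfolding t(2) ker_expand v covar_def mom_x_def mom_y_def p00 p10 p01
    by (simp add: power2_eq_square) (simp add: algebra_simps)
  finally show ?thesis by (simp add: t_def)
qed

definition v_coord :: "complex \<Rightarrow> complex" where
  "v_coord y = (1 / (1 - y) - of_real eta0) / of_real scale"

definition v_real :: "real \<Rightarrow> real" where
  "v_real y = (1 / (1 - y) - eta0) / scale"

lemma v_coord_of_real: "v_coord (of_real y) = of_real (v_real y)"
  by (simp add: v_coord_def v_real_def)

lemma kernel_normal_form:
  assumes "y \<noteq> 1"
  shows "ker_a p y * (xi - 1)\<^sup>2 + ker_b p y * xi * (xi - 1) + ker_c p y * xi\<^sup>2 =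
    of_real (var_y / 2) * (1 - y)\<^sup>2 * normal_conic (xi - of_real xi0) (v_coord y)"
proof -
  have "of_real eta0 + of_real scale * v_coord y = 1 / (1 - y)"
    using less_imp_neq[OF scale_pos] by (simp add: v_coord_def)
  then show ?thesis
    using kernel_conic[OF assms, of xi] conic_normal_form[of "xi - of_real xi0" "v_coord y"]
    by (simp add: mult_ac)
qed

lemma kernel_xi:
  assumes "x \<noteq> 1" "y \<noteq> 1"
  shows "walk_kernel p x y = of_real (var_y / 2) * (1 - x)\<^sup>2 * (1 - y)\<^sup>2
    * normal_conic (1 / (1 - x) - of_real xi0) (v_coord y)"
proof -
  define xi where "xi = 1 / (1 - x)"
  have xi: "(1 - x) * xi = 1" "(1 - x) * (xi - 1) = x" using assms by (simp_all add: xi_def field_simps)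
  have "walk_kernel p x y = ker_a p y * ((1 - x) * (xi - 1))\<^sup>2
      + ker_b p y * ((1 - x) * (xi - 1)) * ((1 - x) * xi) + ker_c p y * ((1 - x) * xi)\<^sup>2"
    unfolding xi walk_kernel_quadratic by simp
  also have "\<dots> = (1 - x)\<^sup>2 * (ker_a p y * (xi - 1)\<^sup>2 + ker_b p y * xi * (xi - 1) + ker_c p y * xi\<^sup>2)"
    by (simp add: power2_eq_square algebra_simps)
  also have "\<dots> = (1 - x)\<^sup>2 * (of_real (var_y / 2) * (1 - y)\<^sup>2 * normal_conic (xi - of_real xi0) (v_coord y))"
    by (subst kernel_normal_form[OF assms(2)]) (rule refl)
  finally show ?thesis by (simp add: xi_def mult_ac)
qed

lemma kernel_zero_iff:
  assumes "x \<noteq> 1" "y \<noteq> 1"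
  shows "walk_kernel p x y = 0 \<longleftrightarrow> normal_conic (1 / (1 - x) - of_real xi0) (v_coord y) = 0"
  using assms less_imp_neq[OF var_pos(2)] by (simp add: kernel_xi)

text \<open>\<open>v_coord\<close> has a simple pole at 1, so the factor \<open>(1 - y) ^ 4\<close>
  leaves 1 as a double root. Every other root satisfies
  \<open>(v_coord y)\<^sup>2 = 4 * kappa\<close>.\<close>

lemma discr_formula:
  assumes "y \<noteq> 1"
  shows "discr p y = of_real (var_y\<^sup>2 * sin_angle\<^sup>2) * (1 - y) ^ 4 * (of_real (4 * kappa) - (v_coord y)\<^sup>2)"
proof -
  define q v c k where "q = of_real (var_y / 2) * (1 - y)\<^sup>2" and "v = v_coord y"
    and "c = complex_of_real cos_angle" and "k = complex_of_real (4 * kappa * sin_angle\<^sup>2)"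
  define z where "z = complex_of_real xi0"
  have *: "ker_a p y * (xi - 1)\<^sup>2 + ker_b p y * xi * (xi - 1) + ker_c p y * xi\<^sup>2 =
      q * ((xi - z)\<^sup>2 - 2 * c * (xi - z) * v + v\<^sup>2 - k)" for xi
    using kernel_normal_form[OF assms, of xi] by (simp add: q_def v_def c_def k_def z_def normal_conic_def)
  \<comment> \<open>The three coefficients of the quadratic polynomial are recovered from its values
    at \<open>xi = 0\<close>, \<open>1\<close> and \<open>-1\<close>.\<close>
  have a: "ker_a p y = q * (z\<^sup>2 + 2 * c * z * v + v\<^sup>2 - k)"
    using *[of 0] by simp
  have c: "ker_c p y = q * ((1 - z)\<^sup>2 - 2 * c * (1 - z) * v + v\<^sup>2 - k)"
    using *[of 1] by simp
  have "4 * ker_a p y + 2 * ker_b p y + ker_c p y = q * ((-1 - z)\<^sup>2 - 2 * c * (-1 - z) * v + v\<^sup>2 - k)"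
    using *[of "-1"] by (simp add: power2_eq_square mult_ac)
  then have "2 * ker_b p y = q * ((-1 - z)\<^sup>2 - 2 * c * (-1 - z) * v + v\<^sup>2 - k) - 4 * ker_a p y - ker_c p y"
    by (simp add: algebra_simps)
  also have "\<dots> = 2 * (q * (2 * z + 2 * c * v - 2 * (z\<^sup>2 + 2 * c * z * v + v\<^sup>2 - k)))"
    unfolding a c by (simp add: power2_eq_square algebra_simps)
  finally have b: "ker_b p y = q * (2 * z + 2 * c * v - 2 * (z\<^sup>2 + 2 * c * z * v + v\<^sup>2 - k))" by simp
  have "discr p y = 4 * q\<^sup>2 * (k - (1 - c\<^sup>2) * v\<^sup>2)"
    unfolding discr_def a b c by (simp add: power2_eq_square algebra_simps)
  also have "1 - c\<^sup>2 = of_real (sin_angle\<^sup>2)"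
    using arg_cong[OF sin_cos_angle, of complex_of_real] by (simp add: c_def algebra_simps)
  also have "k - of_real (sin_angle\<^sup>2) * v\<^sup>2 = of_real (sin_angle\<^sup>2) * (of_real (4 * kappa) - v\<^sup>2)"
    by (simp add: k_def algebra_simps)
  also have "4 * q\<^sup>2 = of_real (var_y\<^sup>2) * (1 - y) ^ 4"
    by (simp add: q_def power_mult_distrib power_divide power_mult[symmetric])
  finally show ?thesis by (simp add: v_def mult_ac)
qed

lemma discr_real:
  assumes "y \<noteq> 1"
  shows "discr p (of_real y) =
    of_real (var_y\<^sup>2 * sin_angle\<^sup>2 * (1 - y) ^ 4 * (4 * kappa - (v_real y)\<^sup>2))"
  using assms discr_formula[of "of_real y"] by (simp add: v_coord_of_real)

section \<open>Signs of the discriminant on the real line\<close>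

definition a_real :: "real \<Rightarrow> real" where "a_real y = p (-1) 1 + p (-1) 0 * y + p (-1) (-1) * y\<^sup>2"
definition b_real :: "real \<Rightarrow> real" where "b_real y = p 0 1 + p 0 0 * y + p 0 (-1) * y\<^sup>2 - y"
definition c_real :: "real \<Rightarrow> real" where "c_real y = p 1 1 + p 1 0 * y + p 1 (-1) * y\<^sup>2"

lemma ker_of_real:
  "ker_a p (of_real y) = of_real (a_real y)"
  "ker_b p (of_real y) = of_real (b_real y)"
  "ker_c p (of_real y) = of_real (c_real y)"
  by (simp_all add: ker_expand a_real_def b_real_def c_real_def)

lemma discr_real_abc: "discr p (of_real y) = of_real ((b_real y)\<^sup>2 - 4 * a_real y * c_real y)"
  by (simp add: discr_def ker_of_real)

lemma discr_abc_eq: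
  assumes "y \<noteq> 1"
  shows "(b_real y)\<^sup>2 - 4 * a_real y * c_real y =
    var_y\<^sup>2 * sin_angle\<^sup>2 * (1 - y) ^ 4 * (4 * kappa - (v_real y)\<^sup>2)"
  using discr_real[OF assms] unfolding discr_real_abc of_real_eq_iff .

lemma discr_sign_factor: "y \<noteq> 1 \<Longrightarrow> var_y\<^sup>2 * sin_angle\<^sup>2 * (1 - y) ^ 4 > 0"
  using less_imp_neq[OF var_pos(2)] less_imp_neq[OF sin_angle_pos] by simp

text \<open>Let \<open>s\<close> be the probability of a step to the left, which by zero drift is
  that of a step to the right. At \<open>-1\<close> the outer coefficients are at most
  \<open>s\<close> in absolute value and the middle one is at least \<open>2 * s\<close>. The
  equation \<open>eta0 = 1 / 2\<close> says that \<open>v_real (-1) = 0\<close>; the sign obtained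
  here becomes \<open>kappa \<ge> 0\<close>.\<close>

lemma discr_minus_one:
  "(b_real (-1))\<^sup>2 - 4 * a_real (-1) * c_real (-1) \<ge> 0"
  "(b_real (-1))\<^sup>2 - 4 * a_real (-1) * c_real (-1) = 0 \<Longrightarrow> eta0 = 1 / 2"
proof -
  define s where "s = p (-1) 1 + p (-1) 0 + p (-1) (-1)"
  have s: "s = p 1 1 + p 1 0 + p 1 (-1)" using p_drift by (simp add: s_def)
  have s0: "s > 0" unfolding s_def using p_nonneg p_nondeg(5) by argo
  have b: "b_real (-1) = 2 * s + 2 * (p 0 1 + p 0 (-1))"
    using p_sum s by (simp add: b_real_def s_def)
  have ac_eq: "a_real (-1) = p (-1) 1 - p (-1) 0 + p (-1) (-1)" "c_real (-1) = p 1 1 - p 1 0 + p 1 (-1)"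
    by (simp_all add: a_real_def c_real_def)
  have a: "\<bar>a_real (-1)\<bar> \<le> s" unfolding ac_eq s_def using p_nonneg by linarith
  have c: "\<bar>c_real (-1)\<bar> \<le> s" unfolding ac_eq s using p_nonneg by linarith
  have "\<bar>a_real (-1) * c_real (-1)\<bar> \<le> s * s"
    unfolding abs_mult using a c by (intro mult_mono) auto
  then have ac: "a_real (-1) * c_real (-1) \<le> s * s" by simp
  have "(2 * s)\<^sup>2 \<le> (b_real (-1))\<^sup>2"
    unfolding b using s0 p_nonneg by (intro power_mono) auto
  then have b2: "4 * (s * s) \<le> (b_real (-1))\<^sup>2" by (simp add: power2_eq_square)
  show "(b_real (-1))\<^sup>2 - 4 * a_real (-1) * c_real (-1) \<ge> 0" using ac b2 by simp
  assume eq: "(b_real (-1))\<^sup>2 - 4 * a_real (-1) * c_real (-1) = 0"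
  have "(b_real (-1))\<^sup>2 = (2 * s)\<^sup>2" and ac': "a_real (-1) * c_real (-1) = s * s"
    using ac b2 eq by (auto simp: power2_eq_square)
  then have "b_real (-1) = 2 * s"
    using s0 b p_nonneg by (subst (asm) power2_eq_iff_nonneg) auto
  then have "p 0 1 + p 0 (-1) = 0" using b by simp
  then have p01: "p 0 1 = 0" "p 0 (-1) = 0" using p_nonneg(4,6) by linarith+
  \<comment> \<open>Equality in all estimates leaves two sign patterns. With plus signs all moves
    are diagonal and the conic is centred at \<open>eta0 = 1 / 2\<close>; minus signs contradict
    non-degeneracy.\<close>
  have "a_real (-1) = s \<and> c_real (-1) = s \<or> a_real (-1) = - s \<and> c_real (-1) = - s"
  proof -
    have "\<bar>a_real (-1)\<bar> * \<bar>c_real (-1)\<bar> = s * s" using ac' s0 by (simp add: abs_mult[symmetric])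
    moreover have "\<bar>a_real (-1)\<bar> * \<bar>c_real (-1)\<bar> \<le> \<bar>a_real (-1)\<bar> * s"
      "\<bar>a_real (-1)\<bar> * \<bar>c_real (-1)\<bar> \<le> s * \<bar>c_real (-1)\<bar>"
      using a c by (auto intro: mult_left_mono mult_right_mono)
    ultimately have "s * s \<le> \<bar>a_real (-1)\<bar> * s" "s * s \<le> s * \<bar>c_real (-1)\<bar>" by auto
    then have "s \<le> \<bar>a_real (-1)\<bar>" "s \<le> \<bar>c_real (-1)\<bar>" using s0 by simp_all
    then have "\<bar>a_real (-1)\<bar> = s" "\<bar>c_real (-1)\<bar> = s" using a c by linarith+
    moreover have "a_real (-1) * c_real (-1) > 0" using ac' s0 by simp
    ultimately show ?thesis using s0 by (auto simp: abs_if zero_less_mult_iff split: if_splits)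
  qed
  then show "eta0 = 1 / 2"
  proof
    assume "a_real (-1) = s \<and> c_real (-1) = s"
    then have p0: "p (-1) 0 = 0" "p 1 0 = 0"
      unfolding ac_eq using s by (auto simp: s_def)
    have eqs: "p (-1) (-1) = p 1 1" "p (-1) 1 = p 1 (-1)" using p_drift p0 p01 by auto
    have v: "var_x = 2 * (p 1 1 + p 1 (-1))" "var_y = 2 * (p 1 1 + p 1 (-1))"
      "covar = 2 * (p 1 1 - p 1 (-1))" "mom_x = p 1 (-1) - p 1 1" "mom_y = p 1 (-1) - p 1 1"
      by (simp_all add: var_x_def var_y_def covar_def mom_x_def mom_y_def p0 p01 eqs)
    have "var_x * var_y - covar\<^sup>2 \<noteq> 0" using covar_squared_less by simp
    moreover have "(var_x / 2 - mom_y) * var_y - covar * (var_y / 2 - mom_x) =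
        (var_x * var_y - covar\<^sup>2) / 2"
      unfolding v by (simp add: power2_eq_square field_simps)
    ultimately show "eta0 = 1 / 2" unfolding eta0_def by simp
  next
    assume "a_real (-1) = - s \<and> c_real (-1) = - s"
    then have "p (-1) 1 + p (-1) (-1) = 0" "p 1 1 + p 1 (-1) = 0"
      unfolding ac_eq using s by (auto simp: s_def)
    then have "p (-1) 1 = 0" "p 1 1 = 0" using p_nonneg(1,3,7,9) by linarith+
    then show "eta0 = 1 / 2" using p01 p_nondeg(7) by simp
  qed
qed

lemma kappa_nonneg: "kappa \<ge> 0"
  and v_real_minus_one: "(v_real (-1))\<^sup>2 \<le> 4 * kappa"
    "(v_real (-1))\<^sup>2 = 4 * kappa \<Longrightarrow> kappa = 0 \<and> v_real (-1) = 0"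
proof -
  have pos: "var_y\<^sup>2 * sin_angle\<^sup>2 * (1 - (-1)) ^ 4 > 0" by (rule discr_sign_factor) simp
  have "var_y\<^sup>2 * sin_angle\<^sup>2 * (1 - (-1)) ^ 4 * (4 * kappa - (v_real (-1))\<^sup>2) \<ge> 0"
    using discr_minus_one(1) discr_abc_eq[of "-1"] by simp
  then show "(v_real (-1))\<^sup>2 \<le> 4 * kappa" using pos by (simp add: zero_le_mult_iff)
  then show "kappa \<ge> 0" using zero_le_power2[of "v_real (-1)"] by linarith
  assume eq: "(v_real (-1))\<^sup>2 = 4 * kappa"
  then have "eta0 = 1 / 2" using discr_minus_one(2) discr_abc_eq[of "-1"] by simp
  then have "v_real (-1) = 0" by (simp add: v_real_def)
  then show "kappa = 0 \<and> v_real (-1) = 0" using eq by simp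
qed

subsection \<open>The gluing curve as a branch of a hyperbola\<close>

definition focus :: real where "focus = 2 * sqrt kappa"

lemma focus_nonneg: "focus \<ge> 0"
  by (simp add: focus_def kappa_nonneg)

lemma focus_squared: "focus\<^sup>2 = 4 * kappa"
  by (simp add: focus_def power_mult_distrib kappa_nonneg)

definition eta_one :: real where "eta_one = eta0 + scale * focus"

lemma v_real_mono: "y < y' \<Longrightarrow> y' < 1 \<Longrightarrow> v_real y < v_real y'"
  unfolding v_real_def by (intro divide_strict_right_mono diff_strict_right_mono) (auto simp: field_simps)

lemma v_real_minus_one_bounds: "\<bar>v_real (-1)\<bar> \<le> focus"
  using v_real_minus_one(1) focus_squared focus_nonneg by (metis abs_le_square_iff abs_of_nonneg)

lemma eta_one_ge: "eta_one \<ge> 1 / 2"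
proof -
  have "v_real (-1) \<le> focus" using v_real_minus_one_bounds by simp
  then show ?thesis by (simp add: v_real_def eta_one_def pos_divide_le_eq algebra_simps)
qed

lemma v_real_eq:
  assumes "eta0 + scale * v \<noteq> 0"
  shows "v_real (1 - 1 / (eta0 + scale * v)) = v"
  using assms less_imp_neq[OF scale_pos] by (simp add: v_real_def)

text \<open>\<open>v_real\<close> increases on \<open>y < 1\<close>, and the discriminant vanishes
  there exactly where \<open>v_real y\<close> is \<open>focus\<close> or \<open>- focus\<close>. On
  \<open>[-1, 1)\<close> the second value would force \<open>v_real (-1) = - focus\<close>, which
  \<open>v_real_minus_one\<close> allows only if \<open>focus = 0\<close>.\<close>

lemma y_one_eq: "y_one p = 1 - 1 / eta_one" (is "_ = ?y")
proof -
  have v: "v_real ?y = focus"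
    unfolding eta_one_def by (rule v_real_eq) (use eta_one_ge in \<open>simp add: eta_one_def\<close>)
  have b: "-1 \<le> ?y" "?y < 1" using eta_one_ge by (simp_all add: field_simps)
  have zero_iff: "discr p (of_real y) = 0 \<longleftrightarrow> v_real y = focus \<or> v_real y = - focus" if "y < 1" for y
  proof -
    have "discr p (of_real y) = 0 \<longleftrightarrow> (v_real y)\<^sup>2 = focus\<^sup>2"
      using that less_imp_neq[OF var_pos(2)] less_imp_neq[OF sin_angle_pos]
      unfolding discr_real[OF less_imp_neq[OF that]] of_real_eq_0_iff by (auto simp: focus_squared)
    then show ?thesis by (simp add: power2_eq_iff)
  qed
  show ?thesis
    unfolding y_one_def
  proof (rule the_equality)
    show "-1 \<le> ?y \<and> ?y < 1 \<and> discr p (of_real ?y) = 0"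
      using b v zero_iff[OF b(2)] by blast
  next
    fix y assume y: "-1 \<le> y \<and> y < 1 \<and> discr p (of_real y) = 0"
    then have "v_real y = focus \<or> v_real y = - focus" using zero_iff by blast
    moreover have "focus = 0" if "v_real y = - focus"
    proof -
      have "v_real (-1) \<le> v_real y" using v_real_mono[of "-1" y] y by (cases "y = -1") auto
      then have "v_real (-1) = - focus" using that v_real_minus_one_bounds by simp
      then have "(v_real (-1))\<^sup>2 = 4 * kappa" by (simp add: focus_squared)
      then show ?thesis using v_real_minus_one(2) by (simp add: focus_def)
    qed
    ultimately have "v_real y = v_real ?y" using v by auto
    then show "y = ?y" using v_real_mono[of y ?y] v_real_mono[of ?y y] y b
      by (metis less_irrefl linorder_neqE_linordered_idom)
  qed
qed

lemma y_one_less: "y_one p < 1"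
  using eta_one_ge by (simp add: y_one_eq field_simps)

lemma v_real_y_one: "v_real (y_one p) = focus"
  unfolding y_one_eq eta_one_def
  by (rule v_real_eq) (use eta_one_ge in \<open>simp add: eta_one_def\<close>)

lemma focus_le_v_real_iff: "y < 1 \<Longrightarrow> focus \<le> v_real y \<longleftrightarrow> y_one p \<le> y"
  using v_real_mono[of y "y_one p"] v_real_mono[of "y_one p" y] y_one_less v_real_y_one
  by (cases y "y_one p" rule: linorder_cases) auto

text \<open>For \<open>y \<ge> 0\<close>, monotonicity from \<open>-1\<close> on makes
  \<open>focus + v_real y\<close> positive, and the sign is that of
  \<open>focus - v_real y\<close>.\<close>

lemma discr_nonneg_iff:
  assumes "0 \<le> y" "y < 1"
  shows "(b_real y)\<^sup>2 - 4 * a_real y * c_real y > 0 \<longleftrightarrow> y < y_one p"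
    and "(b_real y)\<^sup>2 - 4 * a_real y * c_real y = 0 \<longleftrightarrow> y = y_one p"
proof -
  have v: "v_real y > - focus"
    using v_real_mono[of "-1" y] v_real_minus_one_bounds assms by simp
  define P where "P = var_y\<^sup>2 * sin_angle\<^sup>2 * (1 - y) ^ 4"
  have pos: "P > 0" unfolding P_def using discr_sign_factor[of y] assms by simp
  have eq: "(b_real y)\<^sup>2 - 4 * a_real y * c_real y =
      P * ((focus - v_real y) * (focus + v_real y))"
    using discr_abc_eq[of y] assms focus_squared unfolding P_def[symmetric]
    by (simp add: power2_eq_square algebra_simps)
  have "(b_real y)\<^sup>2 - 4 * a_real y * c_real y > 0 \<longleftrightarrow> (focus - v_real y) * (focus + v_real y) > 0"
    unfolding eq using pos by (simp add: zero_less_mult_iff)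
  also have "\<dots> \<longleftrightarrow> v_real y < focus" using v by (auto simp: zero_less_mult_iff)
  also have "\<dots> \<longleftrightarrow> y < y_one p" using focus_le_v_real_iff[of y] assms by auto
  finally show "(b_real y)\<^sup>2 - 4 * a_real y * c_real y > 0 \<longleftrightarrow> y < y_one p" .
  have "(b_real y)\<^sup>2 - 4 * a_real y * c_real y = 0 \<longleftrightarrow> (focus - v_real y) * (focus + v_real y) = 0"
    unfolding eq using pos by simp
  also have "\<dots> \<longleftrightarrow> v_real y = focus" using v by auto
  also have "\<dots> \<longleftrightarrow> y = y_one p"
    using v_real_mono[of y "y_one p"] v_real_mono[of "y_one p" y] y_one_less v_real_y_one assms
    by (cases y "y_one p" rule: linorder_cases) auto
  finally show "(b_real y)\<^sup>2 - 4 * a_real y * c_real y = 0 \<longleftrightarrow> y = y_one p" .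
qed

lemma discr_nonpos:
  assumes "y_one p \<le> y" "y < 1"
  shows "(b_real y)\<^sup>2 - 4 * a_real y * c_real y \<le> 0"
proof -
  have "focus \<le> v_real y" using focus_le_v_real_iff assms by simp
  then have "focus\<^sup>2 \<le> (v_real y)\<^sup>2" using focus_nonneg by (intro power_mono)
  then show ?thesis
    using discr_sign_factor[of y] assms discr_abc_eq[of y]
    by (simp add: focus_squared mult_le_0_iff)
qed

lemma ac_pos: "0 < y \<Longrightarrow> a_real y > 0" "0 < y \<Longrightarrow> c_real y > 0"
  and ac_nonneg: "0 \<le> y \<Longrightarrow> a_real y \<ge> 0" "0 \<le> y \<Longrightarrow> c_real y \<ge> 0"
  and b_pos: "y < 0 \<Longrightarrow> b_real y > 0"
proof -
  have pos3: "s + t * y + u * y\<^sup>2 > 0" if "s \<ge> 0" "t \<ge> 0" "u \<ge> 0" "\<not> (s = 0 \<and> t = 0 \<and> u = 0)" "0 < y"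
    for s t u y :: real
  proof -
    have "t * y \<ge> 0" "u * y\<^sup>2 \<ge> 0" using that by simp_all
    moreover have "t > 0 \<Longrightarrow> t * y > 0" "u > 0 \<Longrightarrow> u * y\<^sup>2 > 0" using that by simp_all
    ultimately show ?thesis using that(1-4) by (smt (verit))
  qed
  show "0 < y \<Longrightarrow> a_real y > 0" unfolding a_real_def using p_nondeg(5) by (intro pos3) auto
  show "0 < y \<Longrightarrow> c_real y > 0" unfolding c_real_def using p_nondeg(1) by (intro pos3) auto
  show "0 \<le> y \<Longrightarrow> a_real y \<ge> 0" "0 \<le> y \<Longrightarrow> c_real y \<ge> 0" unfolding a_real_def c_real_def by simp_all
  assume "y < 0"
  then have "(p 0 0 - 1) * y > 0" using p_00_less_1 by (intro mult_neg_neg) auto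
  moreover have "p 0 1 \<ge> 0" "p 0 (-1) * y\<^sup>2 \<ge> 0" by simp_all
  moreover have "b_real y = p 0 1 + (p 0 0 - 1) * y + p 0 (-1) * y\<^sup>2"
    by (simp add: b_real_def algebra_simps)
  ultimately show "b_real y > 0" by linarith
qed

lemma X_branches:
  assumes "ker_a p y \<noteq> 0"
  shows "walk_kernel p x y = 0 \<longleftrightarrow> x = X_plus p y \<or> x = X_minus p y"
proof -
  define a b c s where "a = ker_a p y" and "b = ker_b p y" and "c = ker_c p y" and "s = csqrt (discr p y)"
  have s: "s * s = b * b - 4 * a * c"
    using power2_csqrt[of "discr p y"] by (simp add: s_def a_def b_def c_def discr_def power2_eq_square)
  have a: "a \<noteq> 0" using assms by (simp add: a_def)
  have "walk_kernel p x y = 0 \<longleftrightarrow> 4 * a * (a * x\<^sup>2 + b * x + c) = 0"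
    using a by (simp add: walk_kernel_quadratic a_def b_def c_def)
  also have "4 * a * (a * x\<^sup>2 + b * x + c) = (2 * a * x + b) * (2 * a * x + b) - s * s"
    unfolding s by (simp add: power2_eq_square algebra_simps)
  also have "\<dots> = (2 * a * x - (- b + s)) * (2 * a * x - (- b - s))" by (simp add: algebra_simps)
  also have "\<dots> = 0 \<longleftrightarrow> x = (- b + s) / (2 * a) \<or> x = (- b - s) / (2 * a)"
    using a by (auto simp: eq_divide_eq mult_ac)
  finally show ?thesis by (simp add: X_plus_def X_minus_def a_def b_def s_def)
qed

lemma kernel_at_one: "walk_kernel p x 1 = of_real (var_x / 2) * (1 - x)\<^sup>2"
  "walk_kernel p 1 y = of_real (var_y / 2) * (1 - y)\<^sup>2"
proof -
  have k: "ker_a p 1 = of_real (p (-1) 1 + p (-1) 0 + p (-1) (-1))"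
    "ker_b p 1 = of_real (p 0 1 + p 0 0 + p 0 (-1) - 1)"
    "ker_c p 1 = of_real (p 1 1 + p 1 0 + p 1 (-1))" by (simp_all add: ker_expand)
  have k': "p (-1) 1 + p (-1) 0 + p (-1) (-1) = var_x / 2" "p 1 1 + p 1 0 + p 1 (-1) = var_x / 2"
    "p 0 1 + p 0 0 + p 0 (-1) - 1 = - var_x"
    using p_drift p_sum by (simp_all add: var_x_def)
  show "walk_kernel p x 1 = of_real (var_x / 2) * (1 - x)\<^sup>2"
    unfolding walk_kernel_quadratic k k' by (simp add: power2_eq_square field_simps)
  have "p (-1) (-1) + p 0 (-1) + p 1 (-1) = var_y / 2" "p (-1) 1 + p 0 1 + p 1 1 = var_y / 2"
    "p (-1) 0 + (p 0 0 - 1) + p 1 0 = - var_y"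
    using p_drift p_sum by (simp_all add: var_y_def)
  note * = this[THEN arg_cong[where f = complex_of_real]]
  have "walk_kernel p 1 y = of_real (p (-1) (-1) + p 0 (-1) + p 1 (-1)) * y\<^sup>2
      + of_real (p (-1) 0 + (p 0 0 - 1) + p 1 0) * y + of_real (p (-1) 1 + p 0 1 + p 1 1)"
    by (simp add: walk_kernel_quadratic ker_expand algebra_simps)
  then show "walk_kernel p 1 y = of_real (var_y / 2) * (1 - y)\<^sup>2"
    unfolding * by (simp add: power2_eq_square field_simps)
qed

text \<open>The sum of the distances to the foci times their difference is
  \<open>4 * focus * (Re xi - xi0)\<close>. For \<open>focus > 0\<close>, the sign of
  \<open>side\<close> is therefore that of the difference minus
  \<open>2 * focus * cos_angle\<close>, as usual for a hyperbola. The form with the sum stays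
  meaningful for \<open>focus = 0\<close>, when the branch degenerates into two rays.\<close>

definition side :: "complex \<Rightarrow> real" where
  "side xi = 2 * (Re xi - xi0) - cos_angle *
     (norm (xi - of_real xi0 + of_real focus) + norm (xi - of_real xi0 - of_real focus))"

text \<open>The level set \<open>side = 0\<close> is a branch of a hyperbola with foci \<open>xi0 \<plusminus> focus\<close>; the parameter
  \<open>v\<close> is half the sum of the distances to the foci.\<close>

lemma side_eq_0_iff:
  "side xi = 0 \<longleftrightarrow> (\<exists>v\<ge>focus. normal_conic (xi - of_real xi0) (of_real v) = 0)"
proof -
  define u where "u = xi - of_real xi0"
  define a b where "a = Re u" and "b = Im u"
  define m c s where "m = focus" and "c = cos_angle" and "s = sin_angle"
  have m: "m \<ge> 0" and cs: "s\<^sup>2 + c\<^sup>2 = 1" and c1: "\<bar>c\<bar> < 1"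
    using focus_nonneg sin_cos_angle abs_cos_angle_less by (auto simp: m_def c_def s_def)
  have cs': "1 - c\<^sup>2 = s\<^sup>2" using cs by simp
  have side: "side xi = 2 * a - c * (norm (u + of_real m) + norm (u - of_real m))"
    by (simp add: side_def u_def a_def m_def c_def)
  have norms: "(norm (u + of_real m))\<^sup>2 = a\<^sup>2 + 2 * a * m + m\<^sup>2 + b\<^sup>2"
    "(norm (u - of_real m))\<^sup>2 = a\<^sup>2 - 2 * a * m + m\<^sup>2 + b\<^sup>2"
    unfolding cmod_power2 by (simp_all add: a_def b_def power2_eq_square algebra_simps)
  have conic: "normal_conic u (of_real v) = 0 \<longleftrightarrow>
      a\<^sup>2 - b\<^sup>2 - 2 * c * a * v + v\<^sup>2 - m\<^sup>2 * s\<^sup>2 = 0 \<and> b * (a - c * v) = 0" for v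
    by (auto simp: normal_conic_def complex_eq_iff a_def b_def c_def s_def m_def focus_squared
        Re_power2 Im_power2 algebra_simps)
  have conic': "normal_conic u (of_real v) = 0 \<longleftrightarrow> a = c * v \<and> b\<^sup>2 = s\<^sup>2 * (v\<^sup>2 - m\<^sup>2)" if "m \<le> v" for v
  proof
    assume "a = c * v \<and> b\<^sup>2 = s\<^sup>2 * (v\<^sup>2 - m\<^sup>2)"
    moreover have "(c * v)\<^sup>2 - s\<^sup>2 * (v\<^sup>2 - m\<^sup>2) - 2 * c * (c * v) * v + v\<^sup>2 - m\<^sup>2 * s\<^sup>2
        = (1 - (s\<^sup>2 + c\<^sup>2)) * v\<^sup>2" by (simp add: power2_eq_square algebra_simps)
    ultimately show "normal_conic u (of_real v) = 0" unfolding conic cs by auto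
  next
    assume "normal_conic u (of_real v) = 0"
    then have 1: "a\<^sup>2 - b\<^sup>2 - 2 * c * a * v + v\<^sup>2 - m\<^sup>2 * s\<^sup>2 = 0" and 2: "b * (a - c * v) = 0"
      unfolding conic by auto
    have 3: "(a - c * v)\<^sup>2 + s\<^sup>2 * (v\<^sup>2 - m\<^sup>2) = b\<^sup>2"
    proof -
      have "(a - c * v)\<^sup>2 + s\<^sup>2 * (v\<^sup>2 - m\<^sup>2) - b\<^sup>2 =
          (a\<^sup>2 - b\<^sup>2 - 2 * c * a * v + v\<^sup>2 - m\<^sup>2 * s\<^sup>2) + (s\<^sup>2 + c\<^sup>2 - 1) * v\<^sup>2"
        by (simp add: power2_eq_square algebra_simps)
      then show ?thesis using 1 cs by simp
    qed
    have vm: "m\<^sup>2 \<le> v\<^sup>2" using that m by (intro power_mono)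
    \<comment> \<open>If \<open>b = 0\<close>, the imaginary part of the equation is void. Then
      \<open>3\<close> is a vanishing sum of two terms that are nonnegative because \<open>v\<close>
      is at least \<open>focus\<close>.\<close>
    have "a = c * v"
    proof (cases "b = 0")
      case True
      have "s\<^sup>2 * (v\<^sup>2 - m\<^sup>2) \<ge> 0" using vm by simp
      moreover have "(a - c * v)\<^sup>2 + s\<^sup>2 * (v\<^sup>2 - m\<^sup>2) = 0" using 3 True by simp
      ultimately have "(a - c * v)\<^sup>2 = 0" using zero_le_power2[of "a - c * v"] by linarith
      then show ?thesis by simp
    qed (use 2 in simp)
    then show "a = c * v \<and> b\<^sup>2 = s\<^sup>2 * (v\<^sup>2 - m\<^sup>2)" using 3 by simp
  qed
  show ?thesis
  proof
    assume "side xi = 0"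
    define v where "v = (norm (u + of_real m) + norm (u - of_real m)) / 2"
    have a: "a = c * v" using \<open>side xi = 0\<close> by (simp add: side v_def)
    have "norm (of_real (2 * m) :: complex) \<le> norm (u + of_real m) + norm (u - of_real m)"
      using norm_triangle_ineq4[of "u + of_real m" "u - of_real m"] by simp
    then have v: "m \<le> v" using m by (simp add: v_def)
    \<comment> \<open>The sum of the two distances is \<open>2 * v\<close> and the difference of
      their squares is \<open>4 * a * m\<close>; together they give each distance.\<close>
    have "norm (u + of_real m) = v + m * c"
    proof (cases "v = 0")
      case True
      then have "norm (u + of_real m) + norm (u - of_real m) = 0" by (simp add: v_def)
      then have "norm (u + of_real m) = 0" by (subst (asm) add_nonneg_eq_0_iff) auto
      moreover have "m = 0" using True v m by simp
      ultimately show ?thesis using True by simp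
    next
      case False
      have "v * (norm (u + of_real m) - norm (u - of_real m)) * 2 =
          (norm (u + of_real m))\<^sup>2 - (norm (u - of_real m))\<^sup>2"
        by (simp add: v_def power2_eq_square field_simps)
      also have "\<dots> = v * (4 * (c * m))" unfolding norms a by simp
      finally have "norm (u + of_real m) - norm (u - of_real m) = 2 * (c * m)"
        using False by simp
      then show ?thesis by (simp add: v_def field_simps)
    qed
    then have "(v + m * c)\<^sup>2 = a\<^sup>2 + 2 * a * m + m\<^sup>2 + b\<^sup>2" using norms(1) by simp
    then have "b\<^sup>2 = (1 - c\<^sup>2) * (v\<^sup>2 - m\<^sup>2)"
      unfolding a by (simp add: power2_eq_square algebra_simps)
    then have "b\<^sup>2 = s\<^sup>2 * (v\<^sup>2 - m\<^sup>2)" unfolding cs' .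
    with a v show "\<exists>v\<ge>focus. normal_conic (xi - of_real xi0) (of_real v) = 0"
      using conic'[OF v] unfolding u_def m_def by blast
  next
    assume "\<exists>v\<ge>focus. normal_conic (xi - of_real xi0) (of_real v) = 0"
    then obtain v where v: "m \<le> v" "a = c * v" "b\<^sup>2 = s\<^sup>2 * (v\<^sup>2 - m\<^sup>2)"
      using conic' unfolding u_def m_def by blast
    have cm: "\<bar>m * c\<bar> \<le> v"
      using c1 m v by (simp add: abs_mult) (metis abs_ge_zero less_imp_le mult_left_le order_trans)
    have b2: "b\<^sup>2 = (1 - c\<^sup>2) * (v\<^sup>2 - m\<^sup>2)" using v(3) unfolding cs' .
    have "(norm (u + of_real m))\<^sup>2 = (v + m * c)\<^sup>2" "(norm (u - of_real m))\<^sup>2 = (v - m * c)\<^sup>2"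
      unfolding norms b2 v(2) by (simp_all add: power2_eq_square algebra_simps)
    then have "norm (u + of_real m) = v + m * c" "norm (u - of_real m) = v - m * c"
      using cm by (simp_all add: power2_eq_iff_nonneg)
    then show "side xi = 0" unfolding side v(2) by (simp add: algebra_simps)
  qed
qed

text \<open>If the leading coefficient vanished, the nonpositive discriminant would annihilate the
  middle one, and the given root the last one. The signs of the coefficients then force
  \<open>y = 0\<close>, against non-degeneracy.\<close>

lemma ker_a_nonzero:
  assumes "y_one p \<le> y" "y < 1" "walk_kernel p x (of_real y) = 0"
  shows "ker_a p (of_real y) \<noteq> 0"
proof
  assume "ker_a p (of_real y) = 0"
  then have a: "a_real y = 0" by (simp add: ker_of_real)
  have b: "b_real y = 0" using discr_nonpos[OF assms(1,2)] a by simp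
  have c: "c_real y = 0" using assms(3) a b by (simp add: walk_kernel_quadratic ker_of_real)
  have "y = 0" using ac_pos(1)[of y] b_pos[of y] a b by (cases y "0::real" rule: linorder_cases) auto
  then show False using a b c p_nondeg(7) by (simp add: a_real_def b_real_def c_real_def)
qed

text \<open>The parameters \<open>y\<close> in \<open>[y_one p, 1)\<close> correspond to the values
  \<open>v \<ge> focus\<close>. The parameter \<open>y = 1\<close> contributes only the point 1,
  where \<open>1 / (1 - x)\<close> is infinite.\<close>

lemma gluing_curve_eq: "gluing_curve p = {1} \<union> {x. x \<noteq> 1 \<and> side (1 / (1 - x)) = 0}"
proof (intro equalityI subsetI)
  fix x assume "x \<in> gluing_curve p"
  then obtain y where y: "y_one p \<le> y" "y \<le> 1" "ker_a p (of_real y) \<noteq> 0"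
    "x = X_plus p (of_real y) \<or> x = X_minus p (of_real y)"
    by (auto simp: gluing_curve_def)
  have K: "walk_kernel p x (of_real y) = 0" using X_branches y by blast
  show "x \<in> {1} \<union> {x. x \<noteq> 1 \<and> side (1 / (1 - x)) = 0}"
  proof (cases "x = 1")
    case False
    have "y \<noteq> 1" using K False kernel_at_one(1)[of x] less_imp_neq[OF var_pos(1)] by auto
    then have "normal_conic (1 / (1 - x) - of_real xi0) (of_real (v_real y)) = 0"
      using K kernel_zero_iff[OF False, of "of_real y"] by (simp add: v_coord_of_real)
    moreover have "focus \<le> v_real y" using focus_le_v_real_iff[of y] y \<open>y \<noteq> 1\<close> by simp
    ultimately show ?thesis using False side_eq_0_iff by blast
  qed simp
next
  fix x assume x: "x \<in> {1} \<union> {x. x \<noteq> 1 \<and> side (1 / (1 - x)) = 0}"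
  show "x \<in> gluing_curve p"
  proof (cases "x = 1")
    case True
    have "walk_kernel p x 1 = 0" unfolding True kernel_at_one(1) by simp
    moreover have a: "ker_a p (of_real 1) \<noteq> 0"
      unfolding ker_of_real using ac_pos(1)[of 1] by simp
    ultimately have "x = X_plus p (of_real 1) \<or> x = X_minus p (of_real 1)"
      using X_branches[OF a, of x] by simp
    with a show ?thesis
      unfolding gluing_curve_def UN_iff using y_one_less by (intro bexI[of _ 1]) auto
  next
    case False
    then obtain v where v: "v \<ge> focus" "normal_conic (1 / (1 - x) - of_real xi0) (of_real v) = 0"
      using x side_eq_0_iff by blast
    define eta where "eta = eta0 + scale * v"
    have eta: "eta \<ge> eta_one" using v by (simp add: eta_def eta_one_def less_imp_le)
    then have eta0: "eta > 0" using eta_one_ge by simp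
    define y where "y = 1 - 1 / eta"
    have y: "y < 1" using eta0 by (simp add: y_def)
    have vy: "v_real y = v" unfolding y_def eta_def
      by (rule v_real_eq) (use eta0 in \<open>simp add: eta_def\<close>)
    then have y1: "y_one p \<le> y" using focus_le_v_real_iff[OF y] v by simp
    have K: "walk_kernel p x (of_real y) = 0"
      using kernel_zero_iff[OF False, of "of_real y"] y v(2) by (simp add: v_coord_of_real vy)
    have "x = X_plus p (of_real y) \<or> x = X_minus p (of_real y)"
      using X_branches[OF ker_a_nonzero[OF y1 y K]] K by blast
    then show ?thesis
      unfolding gluing_curve_def UN_iff using y y1 ker_a_nonzero[OF y1 y K]
      by (intro bexI[of _ y]) auto
  qed
qed

subsection \<open>The region bounded by the gluing curve\<close>

lemma continuous_side: "continuous_on UNIV side"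
  unfolding side_def by (intro continuous_intros)

lemma side_lipschitz: "\<bar>side z - side z'\<bar> \<le> 4 * norm (z - z')"
proof -
  define c where "c = cos_angle"
  have c: "\<bar>c\<bar> < 1" using abs_cos_angle_less by (simp add: c_def)
  define N where "N z = norm (z - of_real xi0 + of_real focus) + norm (z - of_real xi0 - of_real focus)"
    for z :: complex
  have "\<bar>norm (z - of_real xi0 + of_real focus) - norm (z' - of_real xi0 + of_real focus)\<bar> \<le> norm (z - z')"
    "\<bar>norm (z - of_real xi0 - of_real focus) - norm (z' - of_real xi0 - of_real focus)\<bar> \<le> norm (z - z')"
    by (rule order_trans[OF norm_triangle_ineq3], simp)+
  then have "\<bar>N z - N z'\<bar> \<le> 2 * norm (z - z')" unfolding N_def by linarith
  then have "\<bar>c * (N z - N z')\<bar> \<le> 1 * (2 * norm (z - z'))"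
    unfolding abs_mult using c by (intro mult_mono) auto
  moreover have "\<bar>Re z - Re z'\<bar> \<le> norm (z - z')" using abs_Re_le_cmod[of "z - z'"] by simp
  moreover have "side z - side z' = 2 * (Re z - Re z') - c * (N z - N z')"
    by (simp add: side_def c_def N_def algebra_simps)
  ultimately show ?thesis by (smt (verit))
qed

text \<open>Each of the two distances changes by at most \<open>t\<close>, and
  \<open>\<bar>cos_angle\<bar> < 1\<close>. This growth along horizontal rays replaces geometric
  arguments about the hyperbola: it gives the unique real zero of \<open>side\<close> and the
  connectedness of its positive set.\<close>

lemma side_add_real:
  assumes "t \<ge> 0"
  shows "side (z + of_real t) \<ge> side z + 2 * (1 - \<bar>cos_angle\<bar>) * t"
proof -
  define N where "N z = norm (z - of_real xi0 + of_real focus) + norm (z - of_real xi0 - of_real focus)"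
    for z :: complex
  have "\<bar>norm (z + of_real t - of_real xi0 + of_real focus) - norm (z - of_real xi0 + of_real focus)\<bar>
      \<le> norm (complex_of_real t)"
    "\<bar>norm (z + of_real t - of_real xi0 - of_real focus) - norm (z - of_real xi0 - of_real focus)\<bar>
      \<le> norm (complex_of_real t)"
    by (rule order_trans[OF norm_triangle_ineq3], simp)+
  then have "\<bar>N (z + of_real t) - N z\<bar> \<le> 2 * t" using assms unfolding N_def by simp
  then have "\<bar>cos_angle * (N (z + of_real t) - N z)\<bar> \<le> \<bar>cos_angle\<bar> * (2 * t)"
    unfolding abs_mult by (intro mult_left_mono) auto
  moreover have "side (z + of_real t) - side z = 2 * t - cos_angle * (N (z + of_real t) - N z)"
    by (simp add: side_def N_def algebra_simps)
  moreover have "2 * (1 - \<bar>cos_angle\<bar>) * t = 2 * t - \<bar>cos_angle\<bar> * (2 * t)" by (simp add: algebra_simps)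
  ultimately show ?thesis by linarith
qed

text \<open>The vertex of the branch, reached for \<open>v = focus\<close>; by
  \<open>side_real\<close> it is the only real point with \<open>side = 0\<close>.\<close>

definition xi_star :: real where "xi_star = xi0 + cos_angle * focus"

lemma normal_conic_focus: "normal_conic u (of_real focus) = (u - of_real (cos_angle * focus))\<^sup>2"
proof -
  have s: "sin_angle\<^sup>2 = 1 - cos_angle\<^sup>2" using sin_cos_angle by simp
  have "4 * kappa * sin_angle\<^sup>2 = focus\<^sup>2 - cos_angle\<^sup>2 * focus\<^sup>2"
    unfolding focus_squared s by (simp add: algebra_simps)
  then show ?thesis
    unfolding normal_conic_def by (simp only:) (simp add: power2_eq_square algebra_simps)
qed

lemma side_xi_star: "side (of_real xi_star) = 0"
  unfolding side_eq_0_iff by (intro exI[of _ focus]) (simp add: normal_conic_focus xi_star_def)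

lemma side_real:
  "side (of_real r) > 0 \<longleftrightarrow> r > xi_star" "side (of_real r) = 0 \<longleftrightarrow> r = xi_star"
proof -
  have mono: "side (of_real r) < side (of_real r')" if "r < r'" for r r'
  proof -
    have "2 * (1 - \<bar>cos_angle\<bar>) * (r' - r) > 0" using that abs_cos_angle_less by simp
    then show ?thesis using side_add_real[of "r' - r" "of_real r"] that by simp
  qed
  show "side (of_real r) > 0 \<longleftrightarrow> r > xi_star"
    using mono[of r xi_star] mono[of xi_star r] side_xi_star
    by (cases r xi_star rule: linorder_cases) auto
  show "side (of_real r) = 0 \<longleftrightarrow> r = xi_star"
    using mono[of r xi_star] mono[of xi_star r] side_xi_star
    by (cases r xi_star rule: linorder_cases) auto
qed

text \<open>The discriminant vanishes at \<open>y_one p\<close>, so the quadratic polynomial in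
  \<open>xi\<close> is \<open>q\<close> times the square of \<open>xi - xi_star\<close>.\<close>

lemma kernel_at_y_one:
  obtains q where "q > 0" "a_real (y_one p) = q * xi_star\<^sup>2" "c_real (y_one p) = q * (1 - xi_star)\<^sup>2"
    "b_real (y_one p) = 2 * q * (xi_star * (1 - xi_star))"
proof -
  define q where "q = var_y / 2 * (1 - y_one p)\<^sup>2"
  have q: "q > 0" using y_one_less by (simp add: q_def)
  have *: "a_real (y_one p) * (r - 1)\<^sup>2 + b_real (y_one p) * r * (r - 1) + c_real (y_one p) * r\<^sup>2 =
      q * (r - xi_star)\<^sup>2" for r
  proof -
    have "(complex_of_real (y_one p)) \<noteq> 1" using y_one_less by simp
    from kernel_normal_form[OF this, of "of_real r"]
    have "complex_of_real (a_real (y_one p) * (r - 1)\<^sup>2 + b_real (y_one p) * r * (r - 1) + c_real (y_one p) * r\<^sup>2)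
        = of_real (q * (r - xi0 - cos_angle * focus)\<^sup>2)"
      unfolding ker_of_real v_coord_of_real v_real_y_one normal_conic_focus q_def by simp
    then show ?thesis unfolding of_real_eq_iff xi_star_def by (simp add: diff_diff_eq)
  qed
  have a: "a_real (y_one p) = q * xi_star\<^sup>2" using *[of 0] by simp
  have c: "c_real (y_one p) = q * (1 - xi_star)\<^sup>2" using *[of 1] by simp
  have "4 * a_real (y_one p) + 2 * b_real (y_one p) + c_real (y_one p) = q * (-1 - xi_star)\<^sup>2"
    using *[of "-1"] by (simp add: power2_eq_square)
  then have "b_real (y_one p) = 2 * q * (xi_star * (1 - xi_star))"
    unfolding a c by (simp add: power2_eq_square algebra_simps)
  with q a c show ?thesis using that by blast
qed

text \<open>A negative value forces \<open>y_one p > 0\<close> and, by the intermediate value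
  theorem, a zero of \<open>b_real\<close> before \<open>y_one p\<close>. There the discriminant
  would be \<open>- 4 * a_real y * c_real y\<close>, which is not positive.\<close>

lemma b_y_one_nonneg: "b_real (y_one p) \<ge> 0"
proof (rule ccontr)
  assume neg: "\<not> b_real (y_one p) \<ge> 0"
  have b0: "b_real 0 \<ge> 0" by (simp add: b_real_def)
  have "y_one p > 0"
    using neg b0 b_pos[of "y_one p"] by (cases "y_one p" "0::real" rule: linorder_cases) auto
  moreover have "continuous_on {0..y_one p} b_real" unfolding b_real_def by (intro continuous_intros)
  ultimately obtain y where y: "0 \<le> y" "y \<le> y_one p" "b_real y = 0"
    using IVT2'[of b_real "y_one p" 0 0] neg b0 by auto
  then have "y < y_one p" using neg by (cases "y = y_one p") auto
  then have "(b_real y)\<^sup>2 - 4 * a_real y * c_real y > 0"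
    using discr_nonneg_iff(1)[of y] y y_one_less by simp
  moreover have "a_real y * c_real y \<ge> 0" using ac_nonneg[of y] y by simp
  ultimately show False using y(3) by simp
qed

text \<open>By \<open>kernel_at_y_one\<close>, \<open>xi_star * (1 - xi_star)\<close> has the sign
  of \<open>b_real (y_one p)\<close>. In the plane of \<open>x\<close> the vertex is thus on the
  nonpositive half-axis, at 0 for \<open>xi_star = 1\<close> and at infinity for
  \<open>xi_star = 0\<close>.\<close>

lemma xi_star_bounds: "0 \<le> xi_star" "xi_star \<le> 1"
proof -
  obtain q where "q > 0" "b_real (y_one p) = 2 * q * (xi_star * (1 - xi_star))"
    by (rule kernel_at_y_one)
  then have "0 \<le> xi_star * (1 - xi_star)"
    using b_y_one_nonneg by (simp add: zero_le_mult_iff)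
  then show "0 \<le> xi_star" "xi_star \<le> 1" by (auto simp: zero_le_mult_iff)
qed

lemma xi_star_eq_1_iff: "xi_star = 1 \<longleftrightarrow> p 1 1 = 0 \<and> p 0 1 = 0"
proof -
  obtain q where q: "q > 0" "c_real (y_one p) = q * (1 - xi_star)\<^sup>2"
    "b_real (y_one p) = 2 * q * (xi_star * (1 - xi_star))"
    by (rule kernel_at_y_one)
  show ?thesis
  proof
    assume "xi_star = 1"
    then have "c_real (y_one p) = 0" "b_real (y_one p) = 0" using q by simp_all
    moreover from this have "y_one p = 0"
      using ac_pos(2)[of "y_one p"] b_pos[of "y_one p"]
      by (cases "y_one p" "0::real" rule: linorder_cases) auto
    ultimately show "p 1 1 = 0 \<and> p 0 1 = 0" by (simp add: b_real_def c_real_def)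
  next
    assume z: "p 1 1 = 0 \<and> p 0 1 = 0"
    then have "0 = y_one p" using discr_nonneg_iff(2)[of 0] by (simp add: b_real_def c_real_def)
    then have "c_real (y_one p) = 0" using z by (simp add: c_real_def)
    then show "xi_star = 1" using q by simp
  qed
qed

text \<open>An explicit stand-in for the gluing domain. Only the inclusion
  \<open>region_subset_gluing_domain\<close> is established; the points over nonreal
  \<open>y\<close> constructed below are all in \<open>region\<close>.\<close>

definition region :: "complex set" where
  "region = {x. x \<noteq> 1 \<and> side (1 / (1 - x)) > 0}"

lemma continuous_side_x: "continuous_on (- {1}) (\<lambda>x. side (1 / (1 - x)))"
  by (rule continuous_on_compose2[OF continuous_side]) (auto intro!: continuous_intros)

lemma open_side_preimage: "open A \<Longrightarrow> open {x. x \<noteq> 1 \<and> side (1 / (1 - x)) \<in> A}"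
proof -
  assume "open A"
  then have "open (- {1} \<inter> (\<lambda>x. side (1 / (1 - x))) -` A)"
    by (intro continuous_open_preimage continuous_side_x) auto
  moreover have "- {1} \<inter> (\<lambda>x. side (1 / (1 - x))) -` A = {x. x \<noteq> 1 \<and> side (1 / (1 - x)) \<in> A}" by auto
  ultimately show ?thesis by simp
qed

lemma open_region: "open region"
  using open_side_preimage[of "{0<..}"] by (simp add: region_def)

lemma closed_gluing_curve: "closed (gluing_curve p)"
proof -
  have "- gluing_curve p = {x. x \<noteq> 1 \<and> side (1 / (1 - x)) \<in> - {0}}"
    by (auto simp: gluing_curve_eq)
  then have "open (- gluing_curve p)" using open_side_preimage[of "- {0}"] by auto
  then show ?thesis by (simp add: closed_def)
qed

lemma open_gluing_domain: "open (gluing_domain p)"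
  using closed_gluing_curve by (auto simp: gluing_domain_def intro: open_inside open_connected_component)

text \<open>Two points are joined by moving both far to the right, where the segment between them is
  harmless.\<close>

lemma connected_side_pos: "connected {z. side z > 0}"
  unfolding connected_iff_connected_component
proof (intro ballI)
  fix z z' assume z: "z \<in> {z. side z > 0}" "z' \<in> {z. side z > 0}"
  define e where "e = 2 * (1 - \<bar>cos_angle\<bar>)"
  have e: "e > 0" using abs_cos_angle_less by (simp add: e_def)
  \<comment> \<open>The gain \<open>e * t\<close> from the shift balances the loss of at most
    \<open>4 * norm (z - z')\<close> along the segment (\<open>side_lipschitz\<close>).\<close>
  define t where "t = 4 * norm (z - z') / e"
  have t: "t \<ge> 0" "e * t = 4 * norm (z - z')" using e by (simp_all add: t_def)
  have ray: "closed_segment x (x + of_real t) \<subseteq> {z. side z > 0}" if "side x > 0" for x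
  proof
    fix y assume "y \<in> closed_segment x (x + of_real t)"
    then obtain u where u: "0 \<le> u" "y = (1 - u) *\<^sub>R x + u *\<^sub>R (x + of_real t)"
      unfolding in_segment by blast
    then have "y = x + of_real (u * t)" by (simp add: algebra_simps scaleR_conv_of_real)
    moreover have "e * (u * t) \<ge> 0" using e u t by simp
    ultimately show "y \<in> {z. side z > 0}" using side_add_real[of "u * t" x] that u t by (simp add: e_def)
  qed
  have across: "closed_segment (z + of_real t) (z' + of_real t) \<subseteq> {z. side z > 0}"
  proof
    fix y assume "y \<in> closed_segment (z + of_real t) (z' + of_real t)"
    then obtain u where u: "0 \<le> u" "u \<le> 1" "y = (1 - u) *\<^sub>R (z + of_real t) + u *\<^sub>R (z' + of_real t)"
      unfolding in_segment by blast
    define x where "x = z + of_real u * (z' - z)"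
    have y: "y = x + of_real t" using u(3) by (simp add: x_def algebra_simps scaleR_conv_of_real)
    have "norm (x - z) \<le> norm (z - z')"
      using u by (simp add: x_def norm_mult norm_minus_commute mult_left_le_one_le)
    then have "side x \<ge> side z - e * t" using side_lipschitz[of x z] t by simp
    then show "y \<in> {z. side z > 0}" using side_add_real[of t x] t z unfolding y e_def by simp
  qed
  have seg: "connected_component {z. side z > 0} a b" if "closed_segment a b \<subseteq> {z. side z > 0}" for a b
    using that connected_segment[of a b] by (auto simp: connected_component_def)
  have "connected_component {z. side z > 0} z (z + of_real t)"
    "connected_component {z. side z > 0} z' (z' + of_real t)"
    "connected_component {z. side z > 0} (z + of_real t) (z' + of_real t)"
    using z by (auto intro!: seg ray across)
  then show "connected_component {z. side z > 0} z z'"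
    by (meson connected_component_sym connected_component_trans)
qed

lemma side_0_nonpos: "side 0 \<le> 0"
  using side_real(1)[of 0] xi_star_bounds by simp

lemma region_eq_image: "region = (\<lambda>z. 1 - 1 / z) ` {z. side z > 0}"
proof (intro equalityI subsetI)
  fix x assume "x \<in> region"
  then show "x \<in> (\<lambda>z. 1 - 1 / z) ` {z. side z > 0}"
    by (intro image_eqI[of _ _ "1 / (1 - x)"]) (auto simp: region_def)
next
  fix x assume "x \<in> (\<lambda>z. 1 - 1 / z) ` {z. side z > 0}"
  then obtain z where z: "side z > 0" "x = 1 - 1 / z" by blast
  have "z \<noteq> 0" using z(1) side_0_nonpos by auto
  then show "x \<in> region" using z by (simp add: region_def)
qed

lemma connected_region: "connected region"
  unfolding region_eq_image
  by (rule connected_continuous_image[OF _ connected_side_pos])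
     (use side_0_nonpos in \<open>auto intro!: continuous_intros\<close>)

lemma region_disjoint_curve: "region \<inter> gluing_curve p = {}"
  by (auto simp: region_def gluing_curve_eq)

lemma unit_interval_in_region: "0 < r \<Longrightarrow> r < 1 \<Longrightarrow> complex_of_real r \<in> region"
proof -
  assume r: "0 < r" "r < 1"
  then have "1 / (1 - r) > 1" by simp
  then have "1 / (1 - r) > xi_star" using xi_star_bounds(2) by linarith
  then have "side (of_real (1 / (1 - r))) > 0" using side_real(1) by blast
  then show ?thesis using r by (simp add: region_def)
qed

lemma zero_in_region: "p 1 1 \<noteq> 0 \<or> p 0 1 \<noteq> 0 \<Longrightarrow> 0 \<in> region"
  using side_real(1)[of 1] xi_star_bounds xi_star_eq_1_iff by (auto simp: region_def)

text \<open>\<open>xi_star > 0\<close> makes \<open>side\<close> negative near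
  \<open>xi = 0\<close>, that is, for \<open>x\<close> near infinity.\<close>

lemma bounded_side_nonneg:
  assumes "xi_star > 0"
  shows "bounded {x. x \<noteq> 1 \<and> side (1 / (1 - x)) \<ge> 0}"
proof -
  have "side 0 < 0" using side_real[of 0] assms by (auto simp: not_less_iff_gr_or_eq)
  moreover have "isCont side 0" using continuous_side by (simp add: continuous_on_eq_continuous_at)
  ultimately have "\<forall>\<^sub>F z in nhds 0. side z < 0"
    by (intro order_tendstoD(2)[of side "side 0"]) (simp_all add: isCont_def tendsto_nhds_iff)
  then obtain e where e: "e > 0" "\<And>z. norm z < e \<Longrightarrow> side z < 0"
    unfolding eventually_nhds_metric by (auto simp: dist_norm)
  show ?thesis
  proof (rule boundedI)
    fix x assume "x \<in> {x. x \<noteq> 1 \<and> side (1 / (1 - x)) \<ge> 0}"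
    then have "x \<noteq> 1" "\<not> norm (1 / (1 - x)) < e" using e(2)[of "1 / (1 - x)"] by auto
    then have "norm (1 - x) \<le> 1 / e" using e(1) by (simp add: norm_divide field_simps)
    then show "norm x \<le> 1 + 1 / e" using norm_triangle_ineq2[of x 1] by (simp add: norm_minus_commute)
  qed
qed

lemma unbounded_gluing_curve:
  assumes "xi_star = 0"
  shows "\<not> bounded (gluing_curve p)"
proof
  assume "bounded (gluing_curve p)"
  then obtain B where B: "\<And>x. x \<in> gluing_curve p \<Longrightarrow> norm x \<le> B" by (auto simp: bounded_iff)
  \<comment> \<open>The point of the branch with parameter \<open>v = focus + t\<close>, in the
    upper half-plane for \<open>t > 0\<close>. It tends to the vertex 0, so
    \<open>1 - 1 / z t\<close> is unbounded on the curve.\<close>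
  define z where "z t = complex_of_real (xi0 + cos_angle * (focus + t))
    + \<i> * of_real (sin_angle * sqrt ((focus + t)\<^sup>2 - focus\<^sup>2))" for t
  have "isCont z 0" unfolding z_def by (intro continuous_intros)
  moreover have "z 0 = 0" using assms by (simp add: z_def xi_star_def)
  ultimately have "\<forall>\<^sub>F t in at_right 0. norm (z t) < 1 / (\<bar>B\<bar> + 2)"
    by (intro order_tendstoD(2)[of _ "0"] tendsto_norm_zero)
       (auto simp: isCont_def intro: filterlim_mono[OF _ order_refl at_le])
  moreover have "\<forall>\<^sub>F t::real in at_right 0. t > 0" by (simp add: eventually_at_right_less)
  ultimately have "\<forall>\<^sub>F t in at_right 0. norm (z t) < 1 / (\<bar>B\<bar> + 2) \<and> t > 0"
    by (rule eventually_conj)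
  then obtain t where t: "norm (z t) < 1 / (\<bar>B\<bar> + 2)" "t > 0"
    using eventually_happens[of _ "at_right (0::real)"] by auto
  have sq: "(focus + t)\<^sup>2 - focus\<^sup>2 > 0" using t focus_nonneg by (simp add: power2_eq_square algebra_simps add_pos_nonneg)
  then have "Im (z t) > 0" by (simp add: z_def)
  then have z0: "z t \<noteq> 0" by auto
  have "normal_conic (z t - of_real xi0) (of_real (focus + t)) = 0"
  proof -
    define v r where "v = focus + t" and "r = sqrt ((focus + t)\<^sup>2 - focus\<^sup>2)"
    have r: "r\<^sup>2 = v\<^sup>2 - 4 * kappa" using sq by (simp add: r_def v_def focus_squared)
    have s: "sin_angle\<^sup>2 = 1 - cos_angle\<^sup>2" using sin_cos_angle by simp
    have "z t - of_real xi0 = of_real (cos_angle * v) + \<i> * of_real (sin_angle * r)"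
      by (simp add: z_def v_def r_def)
    moreover have "(of_real (cos_angle * v) + \<i> * of_real (sin_angle * r))\<^sup>2
        - 2 * of_real cos_angle * (of_real (cos_angle * v) + \<i> * of_real (sin_angle * r)) * of_real v
        + (of_real v)\<^sup>2 = complex_of_real (v\<^sup>2 - cos_angle\<^sup>2 * v\<^sup>2 - sin_angle\<^sup>2 * r\<^sup>2)"
      by (simp add: power2_eq_square algebra_simps)
    ultimately have "normal_conic (z t - of_real xi0) (of_real v) =
        of_real (v\<^sup>2 - cos_angle\<^sup>2 * v\<^sup>2 - sin_angle\<^sup>2 * r\<^sup>2 - 4 * kappa * sin_angle\<^sup>2)"
      unfolding normal_conic_def by simp
    also have "v\<^sup>2 - cos_angle\<^sup>2 * v\<^sup>2 - sin_angle\<^sup>2 * r\<^sup>2 - 4 * kappa * sin_angle\<^sup>2 = 0"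
      unfolding r s by (simp add: algebra_simps)
    finally show ?thesis by (simp add: v_def)
  qed
  then have "side (z t) = 0" unfolding side_eq_0_iff using t by (intro exI[of _ "focus + t"]) auto
  then have "1 - 1 / z t \<in> gluing_curve p" using z0 by (simp add: gluing_curve_eq)
  then have "norm (1 - 1 / z t) \<le> B" by (rule B)
  moreover have "norm (1 / z t) \<le> norm (1 - 1 / z t) + 1"
    using norm_triangle_ineq2[of "1 / z t" 1] by (simp add: norm_minus_commute)
  moreover have "\<bar>B\<bar> + 2 < norm (1 / z t)"
    using t z0 by (simp add: norm_divide field_simps)
  ultimately show False by linarith
qed

text \<open>If \<open>xi_star = 0\<close>, the connected set \<open>region\<close> contains 0 and
  avoids the curve. Otherwise \<open>region\<close> is bounded, and a component of the complement of
  the curve that meets \<open>region\<close> cannot leave it: the complement is the disjoint union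
  of the open sets where \<open>side\<close> is positive and negative.\<close>

lemma region_subset_gluing_domain: "region \<subseteq> gluing_domain p"
proof (cases "xi_star = 0")
  case True
  have "p 1 1 \<noteq> 0 \<or> p 0 1 \<noteq> 0" using True xi_star_eq_1_iff by auto
  then have "0 \<in> region" by (rule zero_in_region)
  then have "region \<subseteq> connected_component_set (- gluing_curve p) 0"
    by (rule connected_component_maximal[OF _ connected_region]) (use region_disjoint_curve in auto)
  then show ?thesis using unbounded_gluing_curve[OF True] by (simp add: gluing_domain_def)
next
  case False
  then have bdd: "bounded {x. x \<noteq> 1 \<and> side (1 / (1 - x)) \<ge> 0}"
    using bounded_side_nonneg xi_star_bounds by simp
  have bregion: "bounded region"
    by (rule bounded_subset[OF bdd]) (auto simp: region_def)
  have "bounded (gluing_curve p)"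
    unfolding gluing_curve_eq
    by (rule bounded_subset[OF bounded_insert[THEN iffD2, OF bdd, of 1]]) auto
  moreover have "region \<subseteq> inside (gluing_curve p)"
  proof
    fix x assume x: "x \<in> region"
    let ?C = "connected_component_set (- gluing_curve p) x"
    let ?N = "{x. x \<noteq> 1 \<and> side (1 / (1 - x)) \<in> {..<0}}"
    have "?C \<subseteq> - gluing_curve p" by (rule connected_component_subset)
    then have "?C \<subseteq> region \<union> ?N" by (auto simp: region_def gluing_curve_eq)
    moreover have "region \<inter> ?N \<inter> ?C = {}" by (auto simp: region_def)
    moreover have "open ?N" by (rule open_side_preimage) auto
    ultimately have "region \<inter> ?C = {} \<or> ?N \<inter> ?C = {}"
      using connectedD[OF connected_connected_component open_region] by blast
    moreover have "x \<in> ?C" using x region_disjoint_curve by auto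
    ultimately have "?C \<subseteq> region" using x \<open>?C \<subseteq> region \<union> ?N\<close> by blast
    then have "bounded ?C" using bregion bounded_subset by blast
    then show "x \<in> inside (gluing_curve p)"
      using x region_disjoint_curve by (auto simp: inside_def)
  qed
  ultimately show ?thesis by (simp add: gluing_domain_def)
qed

lemma region_subset_closure: "region \<subseteq> closure (gluing_domain p) - {1}"
  using subset_trans[OF region_subset_gluing_domain closure_subset] by (auto simp: region_def)

lemma zero_islimpt_gluing_domain: "0 islimpt gluing_domain p"
proof -
  have "complex_of_real ` {0<..<1} \<subseteq> gluing_domain p"
    using unit_interval_in_region region_subset_gluing_domain by auto
  then show ?thesis using of_real_interval_islimpt[of 1] islimpt_subset by auto
qed

lemma zero_in_closure: "0 \<in> closure (gluing_domain p)"
  using zero_islimpt_gluing_domain by (simp add: closure_def)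

end

subsection \<open>Parametrisation of the kernel curve\<close>

text \<open>Extended by 0 across the diameter, \<open>f\<close> stays continuous and hence becomes
  holomorphic on the whole ball. It vanishes on the other half-ball, so it vanishes everywhere. The
  sign of \<open>e\<close> selects the half-ball.\<close>

lemma holomorphic_zero_from_boundary:
  fixes f :: "complex \<Rightarrow> complex" and e r :: real
  assumes "e \<noteq> 0" "Im c = 0"
    and cont: "continuous_on {z \<in> ball c r. e * Im z \<le> 0} f"
    and hol: "f holomorphic_on {z \<in> ball c r. e * Im z < 0}"
    and zero: "\<And>z. z \<in> ball c r \<Longrightarrow> Im z = 0 \<Longrightarrow> f z = 0"
    and z: "z \<in> ball c r" "e * Im z < 0"
  shows "f z = 0"
proof -
  define d where "d = e *\<^sub>R \<i>"
  have d: "d \<bullet> z = e * Im z" for z by (simp add: d_def)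
  define g where "g z = (if e * Im z \<le> 0 then f z else 0)" for z
  have r: "r > 0" using z(1) by (metis mem_ball zero_le_dist le_less_trans)
  have "continuous_on ({z \<in> ball c r. e * Im z \<le> 0} \<union> {z \<in> ball c r. e * Im z \<ge> 0}) g"
    unfolding g_def
  proof (rule continuous_on_cases_local)
    show "closedin (top_of_set ({z \<in> ball c r. e * Im z \<le> 0} \<union> {z \<in> ball c r. 0 \<le> e * Im z}))
        {z \<in> ball c r. e * Im z \<le> 0}"
      unfolding closedin_closed
      by (rule exI[of _ "{z. e * Im z \<le> 0}"]) (auto intro!: closed_Collect_le continuous_intros)
    show "closedin (top_of_set ({z \<in> ball c r. e * Im z \<le> 0} \<union> {z \<in> ball c r. 0 \<le> e * Im z}))
        {z \<in> ball c r. 0 \<le> e * Im z}"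
      unfolding closedin_closed
      by (rule exI[of _ "{z. 0 \<le> e * Im z}"]) (auto intro!: closed_Collect_le continuous_intros)
  qed (use cont zero \<open>e \<noteq> 0\<close> in \<open>auto simp: mult_le_0_iff zero_le_mult_iff\<close>)
  moreover have "{z \<in> ball c r. e * Im z \<le> 0} \<union> {z \<in> ball c r. e * Im z \<ge> 0} = ball c r" by auto
  ultimately have contg: "continuous_on (ball c r) g" by simp
  have "g holomorphic_on ball c r"
  proof (rule holomorphic_on_paste_across_line[of _ d _ 0])
    have "f holomorphic_on ball c r \<inter> {z. d \<bullet> z < 0}"
      by (rule holomorphic_on_subset[OF hol]) (auto simp: d)
    then show "g holomorphic_on ball c r \<inter> {z. d \<bullet> z < 0}"
      by (rule holomorphic_transform) (auto simp: g_def d)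
    show "g holomorphic_on ball c r \<inter> {z. 0 < d \<bullet> z}"
      by (rule holomorphic_transform[of "\<lambda>_. 0"]) (auto simp: g_def d)
    show "d \<noteq> 0" using \<open>e \<noteq> 0\<close> by (simp add: d_def)
  qed (use contg in auto)
  moreover define U where "U = ball c r \<inter> {z. 0 < d \<bullet> z}"
  define z1 where "z1 = c + of_real (sgn e * r / 2) * \<i>"
  have "open U" unfolding U_def by (intro open_Int open_halfspace_gt) auto
  moreover have "z1 \<in> U"
    using r \<open>e \<noteq> 0\<close> \<open>Im c = 0\<close>
    by (auto simp: U_def z1_def d dist_norm norm_mult abs_mult abs_sgn_eq sgn_if mult_less_0_iff)
  ultimately have "g z = 0"
    using z by (intro analytic_continuation[of g "ball c r" U z1 z] interior_limit_point)
      (auto simp: interior_open, auto simp: U_def g_def d)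
  then show ?thesis using z by (simp add: g_def)
qed

text \<open>By the open mapping theorem, a coincidence of values at two distinct points persists for
  pairs in disjoint neighbourhoods of them. The real axis has empty interior, so first one point of
  the pair and then the other can be taken nonreal.\<close>

lemma inj_on_if_inj_on_nonreal:
  fixes f :: "complex \<Rightarrow> complex"
  assumes hol: "f holomorphic_on ball 0 r"
    and inj: "inj_on f {z \<in> ball 0 r. Im z \<noteq> 0}"
  shows "inj_on f (ball 0 r)"
proof (rule inj_onI, rule ccontr)
  fix a b assume ab: "a \<in> ball 0 r" "b \<in> ball 0 r" "f a = f b" "a \<noteq> b"
  have r: "r > 0" using ab(1) by (metis mem_ball zero_le_dist le_less_trans)
  have nonreal: "\<exists>z\<in>V. Im z \<noteq> 0" if "open V" "V \<noteq> {}" for V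
  proof -
    obtain z where "z \<in> V" using \<open>V \<noteq> {}\<close> by blast
    then obtain e where "e > 0" "ball z e \<subseteq> V" using \<open>open V\<close> open_contains_ball by blast
    moreover have "z \<in> ball z e" "z + of_real (e / 2) * \<i> \<in> ball z e"
      using \<open>e > 0\<close> by (auto simp: dist_norm norm_mult)
    moreover have "Im z \<noteq> 0 \<or> Im (z + of_real (e / 2) * \<i>) \<noteq> 0" using \<open>e > 0\<close> by auto
    ultimately show ?thesis by blast
  qed
  have "\<not> f constant_on ball 0 r"
  proof
    assume "f constant_on ball 0 r"
    then obtain k where k: "\<And>z. z \<in> ball 0 r \<Longrightarrow> f z = k" by (auto simp: constant_on_def)
    have "of_real (r / 2) * \<i> \<in> {z \<in> ball 0 r. Im z \<noteq> 0}" "of_real (r / 3) * \<i> \<in> {z \<in> ball 0 r. Im z \<noteq> 0}"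
      using r by (auto simp: norm_mult)
    moreover from this have "f (of_real (r / 2) * \<i>) = f (of_real (r / 3) * \<i>)" using k by auto
    ultimately have "complex_of_real (r / 2) * \<i> = of_real (r / 3) * \<i>"
      using inj_onD[OF inj] by blast
    then show False using r by (auto simp: complex_eq_iff)
  qed
  then have omap: "open (f ` V)" if "open V" "V \<subseteq> ball 0 r" for V
    using that hol by (intro open_mapping_thm[of f "ball 0 r"]) auto
  have cont: "continuous_on (ball 0 r) f" using hol holomorphic_on_imp_continuous_on by blast
  obtain A B where AB: "open A" "open B" "a \<in> A" "b \<in> B" "A \<inter> B = {}"
    using hausdorff[OF ab(4)] by blast
  define A' where "A' = A \<inter> ball 0 r"
  define B' where "B' = B \<inter> ball 0 r"
  have A': "open A'" "a \<in> A'" "A' \<subseteq> ball 0 r" and B': "open B'" "b \<in> B'" "B' \<subseteq> ball 0 r"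
    using AB ab by (auto simp: A'_def B'_def)
  define A1 where "A1 = A' \<inter> f -` (f ` B')"
  have A1: "open A1" unfolding A1_def
    by (rule continuous_open_preimage[OF continuous_on_subset[OF cont A'(3)] A'(1) omap[OF B'(1,3)]])
  have "a \<in> A1" using A' B' ab by (auto simp: A1_def)
  define A2 where "A2 = A1 \<inter> {z. Im z \<noteq> 0}"
  have "open {z::complex. Im z \<noteq> 0}" by (intro open_Collect_neq continuous_intros)
  then have A2: "open A2" "A2 \<subseteq> ball 0 r" using A1 A' by (auto simp: A2_def A1_def)
  obtain z where z: "z \<in> A2" using nonreal[OF A1] \<open>a \<in> A1\<close> by (auto simp: A2_def)
  define B1 where "B1 = B' \<inter> f -` (f ` A2)"
  have B1: "open B1" unfolding B1_def
    by (rule continuous_open_preimage[OF continuous_on_subset[OF cont B'(3)] B'(1) omap[OF A2]])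
  have "f z \<in> f ` B'" using z by (auto simp: A2_def A1_def)
  then obtain b' where "b' \<in> B'" "f b' = f z" by auto
  then have "b' \<in> B1" using z by (simp add: B1_def)
  then have "B1 \<noteq> {}" by blast
  then obtain y where y: "y \<in> B1" "Im y \<noteq> 0" using nonreal[OF B1] by blast
  then obtain x where x: "x \<in> A2" "f y = f x" by (auto simp: B1_def)
  have xA: "x \<in> A'" "Im x \<noteq> 0" and yB: "y \<in> B'" using x(1) y(1) by (simp_all add: A2_def A1_def B1_def)
  have "x \<in> {z \<in> ball 0 r. Im z \<noteq> 0}" "y \<in> {z \<in> ball 0 r. Im z \<noteq> 0}"
    using xA yB y(2) A'(3) B'(3) by blast+
  then have "x = y" using inj_onD[OF inj x(2)[symmetric]] by blast
  then show False using xA yB AB(5) by (auto simp: A'_def B'_def)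
qed

context zero_drift_walk
begin

text \<open>The sign \<open>e = \<plusminus>1\<close> selects one of the two points of the kernel curve over the same \<open>y\<close>. The
  parameter is rotated so that \<open>y\<close> is real on the real axis; \<open>x_of e s\<close> then lies in the gluing domain
  if \<open>e * Im s < 0\<close>.\<close>

definition rho :: "real \<Rightarrow> complex" where "rho e = Complex cos_angle (e * sin_angle)"

definition xi_of :: "complex \<Rightarrow> complex" where "xi_of s = of_real xi0 + s + of_real kappa / s"

definition eta_of :: "complex \<Rightarrow> complex" where
  "eta_of s = of_real eta0 + of_real scale * (s + of_real kappa / s)"

definition x_of :: "real \<Rightarrow> complex \<Rightarrow> complex" where "x_of e s = 1 - 1 / xi_of (s * rho e)"

definition y_of :: "complex \<Rightarrow> complex" where "y_of s = 1 - 1 / eta_of s"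

lemma rho_mult: "e\<^sup>2 = 1 \<Longrightarrow> rho e * rho (- e) = 1"
proof -
  assume "e\<^sup>2 = 1"
  then have "(e * sin_angle)\<^sup>2 + cos_angle\<^sup>2 = 1" using sin_cos_angle by (simp add: power_mult_distrib)
  then have "cos_angle * cos_angle + e * sin_angle * (e * sin_angle) = 1"
    unfolding power2_eq_square by linarith
  then show ?thesis by (simp add: rho_def complex_eq_iff)
qed

lemma norm_rho: "e\<^sup>2 = 1 \<Longrightarrow> norm (rho e) = 1"
  using sin_cos_angle by (simp add: rho_def cmod_def power_mult_distrib add.commute)

lemma rho_nonzero: "e\<^sup>2 = 1 \<Longrightarrow> rho e \<noteq> 0"
  using norm_rho by fastforce

text \<open>The quadratic part is \<open>(u - rho e * v) * (u - rho (- e) * v)\<close>, and on the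
  parametrised curve its factors are multiples of \<open>kappa / s\<close> and of \<open>s\<close>,
  so the product does not depend on \<open>s\<close>.\<close>

lemma normal_conic_param:
  assumes "s \<noteq> 0" "e\<^sup>2 = 1"
  shows "normal_conic (s * rho e + of_real kappa / (s * rho e)) (s + of_real kappa / s) = 0"
proof -
  define t where "t = of_real kappa / s"
  have st: "s * t = of_real kappa" using assms(1) by (simp add: t_def)
  have inv: "1 / rho e = rho (- e)" using rho_mult[OF assms(2)] rho_nonzero[OF assms(2)]
    by (simp add: field_simps)
  have "of_real kappa / (s * rho e) = t * (1 / rho e)" by (simp add: t_def)
  then have u: "s * rho e + of_real kappa / (s * rho e) = s * rho e + t * rho (- e)"
    unfolding inv by simp
  have sum: "2 * complex_of_real cos_angle = rho e + rho (- e)"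
    by (simp add: rho_def complex_eq_iff)
  have diff: "(rho e - rho (- e))\<^sup>2 = - of_real (4 * sin_angle\<^sup>2)"
    using assms(2) by (simp add: rho_def complex_eq_iff power2_eq_square)
  have "normal_conic (s * rho e + t * rho (- e)) (s + t)
      = (s * rho e + t * rho (- e))\<^sup>2 - (rho e + rho (- e)) * (s * rho e + t * rho (- e)) * (s + t)
        + (rho e * rho (- e)) * (s + t)\<^sup>2 - of_real (4 * kappa * sin_angle\<^sup>2)"
    unfolding normal_conic_def sum rho_mult[OF assms(2)] by simp
  also have "\<dots> = - (s * t) * (rho e - rho (- e))\<^sup>2 - of_real (4 * kappa * sin_angle\<^sup>2)"
    by (simp add: power2_eq_square algebra_simps)
  also have "\<dots> = 0" unfolding st diff by simp
  finally show ?thesis unfolding u t_def .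
qed

text \<open>With \<open>k = sqrt kappa\<close>, adding or subtracting \<open>focus = 2 * k\<close>
  turns \<open>s + kappa / s\<close> into the perfect squares \<open>(s + k)\<^sup>2 / s\<close> and
  \<open>(s - k)\<^sup>2 / s\<close>. The parallelogram law then evaluates the sum of the
  distances.\<close>

lemma side_param:
  assumes "s \<noteq> 0"
  shows "side (xi_of s) = 2 * (1 + kappa / (norm s)\<^sup>2) * (Re s - cos_angle * norm s)"
proof -
  define k where "k = sqrt kappa"
  have k: "kappa = k\<^sup>2" "focus = 2 * k" by (simp_all add: k_def focus_def kappa_nonneg)
  have plus: "xi_of s - of_real xi0 + of_real focus = (s + of_real k)\<^sup>2 / s"
    and minus: "xi_of s - of_real xi0 - of_real focus = (s - of_real k)\<^sup>2 / s"
    using assms by (simp_all add: xi_of_def k field_simps power2_eq_square)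
  have "(norm (s + of_real k))\<^sup>2 + (norm (s - of_real k))\<^sup>2 = 2 * (norm s)\<^sup>2 + 2 * kappa"
    unfolding k cmod_power2 by (simp add: power2_eq_square algebra_simps)
  then have "norm (xi_of s - of_real xi0 + of_real focus) + norm (xi_of s - of_real xi0 - of_real focus)
      = (2 * (norm s)\<^sup>2 + 2 * kappa) / norm s"
    unfolding plus minus by (simp add: norm_divide norm_power add_divide_distrib[symmetric])
  moreover have "Re (xi_of s) - xi0 = Re s * (1 + kappa / (norm s)\<^sup>2)"
    by (simp add: xi_of_def Re_divide cmod_power2 algebra_simps)
  ultimately have "side (xi_of s) = 2 * (Re s * (1 + kappa / (norm s)\<^sup>2))
      - cos_angle * ((2 * (norm s)\<^sup>2 + 2 * kappa) / norm s)"
    unfolding side_def by simp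
  also have "(2 * (norm s)\<^sup>2 + 2 * kappa) / norm s = 2 * (1 + kappa / (norm s)\<^sup>2) * norm s"
    using assms by (simp add: field_simps power2_eq_square)
  finally have "side (xi_of s) = 2 * (Re s * (1 + kappa / (norm s)\<^sup>2))
      - cos_angle * (2 * (1 + kappa / (norm s)\<^sup>2) * norm s)" .
  moreover have "2 * (Re s * q) - cos_angle * (2 * q * norm s) = 2 * q * (Re s - cos_angle * norm s)"
    for q by (simp add: algebra_simps)
  ultimately show ?thesis by (simp only:)
qed

text \<open>A cone around the positive half-axis. It is so narrow that multiplication by
  \<open>rho e\<close> sends its points with \<open>e * Im s < 0\<close> to points \<open>z\<close>
  with \<open>side (xi_of z) > 0\<close> and \<open>e * Im z > 0\<close>.\<close>

definition sector :: "complex set" where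
  "sector = {s. Re s > 0 \<and> \<bar>Im s\<bar> < sin_angle * Re s}"

lemma sector_rotate:
  assumes "s \<in> sector" "e\<^sup>2 = 1" "e * Im s < 0"
  shows "Re (s * rho e) > cos_angle * norm (s * rho e)" "e * Im (s * rho e) > 0"
proof -
  define t where "t = - (e * Im s)"
  have e: "\<bar>e\<bar> = 1" using assms(2) by (simp add: power2_eq_1_iff abs_if split: if_splits) auto
  have t: "t > 0" "t = \<bar>Im s\<bar>" "t < sin_angle * Re s" "Re s > 0"
    using assms e by (auto simp: t_def sector_def abs_mult abs_if split: if_splits)
  have t2: "t\<^sup>2 = (Im s)\<^sup>2" using t(2) by simp
  have "t * t < t * (2 * (sin_angle * Re s))" using t by (intro mult_strict_left_mono) auto
  then have "(norm s)\<^sup>2 < (Re s + sin_angle * t)\<^sup>2"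
    unfolding cmod_power2 t2[symmetric] using zero_le_power2[of "sin_angle * t"]
    by (simp add: power2_eq_square algebra_simps)
  then have lt: "norm s < Re s + sin_angle * t"
    by (rule power2_less_imp_less) (intro add_nonneg_nonneg mult_nonneg_nonneg, use t(1,4) less_imp_le[OF sin_angle_pos] in simp_all)
  have "cos_angle * (norm s - Re s) \<le> 1 * (norm s - Re s)"
    using abs_cos_angle_less complex_Re_le_cmod[of s] by (intro mult_right_mono) auto
  then have "cos_angle * norm s < Re s * cos_angle + sin_angle * t" using lt by (simp add: algebra_simps)
  moreover have "Re (s * rho e) = Re s * cos_angle + sin_angle * t"
    by (simp add: rho_def t_def)
  moreover have "norm (s * rho e) = norm s" using norm_rho[OF assms(2)] by (simp add: norm_mult)
  ultimately show "Re (s * rho e) > cos_angle * norm (s * rho e)" by simp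
  have "e * Im (s * rho e) = e\<^sup>2 * sin_angle * Re s - t * cos_angle"
    by (simp add: rho_def t_def power2_eq_square algebra_simps)
  moreover have "t * cos_angle \<le> t * 1" using abs_cos_angle_less t(1) by (intro mult_left_mono) auto
  ultimately show "e * Im (s * rho e) > 0" using t(3) assms(2) by simp
qed

lemma x_of_in_region:
  assumes "s \<in> sector" "e\<^sup>2 = 1" "e * Im s < 0"
  shows "x_of e s \<in> region" "xi_of (s * rho e) \<noteq> 0"
proof -
  have "s \<noteq> 0" using assms by (auto simp: sector_def)
  then have "s * rho e \<noteq> 0" using rho_nonzero assms by simp
  moreover have "1 + kappa / (norm (s * rho e))\<^sup>2 > 0" using kappa_nonneg by (simp add: add_pos_nonneg)
  ultimately have "side (xi_of (s * rho e)) > 0"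
    using sector_rotate(1)[OF assms] by (simp add: side_param)
  then show "x_of e s \<in> region" "xi_of (s * rho e) \<noteq> 0"
    using side_0_nonpos by (auto simp: region_eq_image x_of_def)
qed

lemma kernel_param:
  assumes "s \<noteq> 0" "e\<^sup>2 = 1" "xi_of (s * rho e) \<noteq> 0" "eta_of s \<noteq> 0"
  shows "walk_kernel p (x_of e s) (y_of s) = 0"
proof -
  have "v_coord (y_of s) = s + of_real kappa / s"
    using assms(4) less_imp_neq[OF scale_pos] by (simp add: v_coord_def y_of_def eta_of_def)
  moreover have "1 / (1 - x_of e s) - of_real xi0 = s * rho e + of_real kappa / (s * rho e)"
    using assms(3) by (simp add: x_of_def xi_of_def)
  moreover have "x_of e s \<noteq> 1" "y_of s \<noteq> 1" using assms by (simp_all add: x_of_def y_of_def)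
  ultimately show ?thesis using normal_conic_param[OF assms(1,2)] by (simp add: kernel_zero_iff)
qed

text \<open>\<open>xi_of z = xi_of z'\<close> means \<open>z = z'\<close> or
  \<open>z * z' = kappa\<close>. In the first case the half-planes give \<open>e = e'\<close>, hence
  \<open>s = s'\<close>. In the second they give \<open>e' = - e\<close>, so the rotations cancel in
  \<open>s * s' = kappa\<close>, and \<open>eta_of\<close> is invariant under
  \<open>s \<mapsto> kappa / s\<close>.\<close>

lemma x_of_inj:
  assumes "s \<in> sector" "e\<^sup>2 = 1" "e * Im s < 0" "s' \<in> sector" "e'\<^sup>2 = 1" "e' * Im s' < 0"
    and "x_of e s = x_of e' s'"
  shows "y_of s = y_of s'"
proof -
  define z z' where "z = s * rho e" and "z' = s' * rho e'"
  have nz: "s \<noteq> 0" "s' \<noteq> 0" using assms by (auto simp: sector_def)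
  then have nz': "z \<noteq> 0" "z' \<noteq> 0" using rho_nonzero assms by (auto simp: z_def z'_def)
  have pos: "e * Im z > 0" "e' * Im z' > 0"
    using sector_rotate(2) assms by (auto simp: z_def z'_def)
  have "xi_of z = xi_of z'"
    using assms(7) x_of_in_region(2)[OF assms(1-3)] x_of_in_region(2)[OF assms(4-6)]
    by (simp add: x_of_def z_def z'_def)
  then have "(z - z') * (z * z' - of_real kappa) = 0"
    using nz' by (simp add: xi_of_def field_simps)
  then consider "z = z'" | "z * z' = of_real kappa" by auto
  then show ?thesis
  proof cases
    case 1
    have "e = e'"
    proof (rule ccontr)
      assume "e \<noteq> e'"
      then have "e' = - e" using assms(2,5) by (auto simp: power2_eq_1_iff)
      then show False using pos 1 by simp
    qed
    then have "s = s'" using 1 rho_nonzero[OF assms(2)] by (simp add: z_def z'_def)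
    then show ?thesis by simp
  next
    case 2
    have "e' = - e"
    proof (rule ccontr)
      assume "e' \<noteq> - e"
      then have e: "e' = e" using assms(2,5) by (auto simp: power2_eq_1_iff)
      have "z' = of_real kappa / z" using 2 nz' by (simp add: field_simps)
      then have "Im z' = - kappa * Im z / (norm z)\<^sup>2" by (simp add: Im_divide cmod_power2)
      then have "e * Im z' = - (kappa * (e * Im z) / (norm z)\<^sup>2)" by simp
      moreover have "kappa * (e * Im z) / (norm z)\<^sup>2 \<ge> 0" using pos kappa_nonneg by simp
      ultimately show False using pos e by simp
    qed
    then have "s * s' * (rho e * rho (- e)) = of_real kappa" using 2 by (simp add: z_def z'_def mult_ac)
    then have "s * s' = of_real kappa" using rho_mult[OF assms(2)] by simp
    then have "s' = of_real kappa / s" "s = of_real kappa / s'" using nz by (simp_all add: field_simps)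
    then have "s + of_real kappa / s = s' + of_real kappa / s'" by (metis add.commute)
    then show ?thesis by (simp add: y_of_def eta_of_def)
  qed
qed

subsection \<open>The glued function near the origin\<close>

text \<open>\<open>s0\<close> is a parameter of \<open>y = 0\<close>. The larger root is taken, so
  that \<open>s + kappa / s\<close> increases to the right of \<open>s0\<close>; it is real because
  \<open>y_one p \<le> 0\<close> means \<open>v_real 0 \<ge> focus\<close>.\<close>

lemma sigma_exists:
  assumes "y_one p \<le> 0"
  obtains s0 :: real where "s0 > 0" "s0\<^sup>2 \<ge> kappa" "s0 + kappa / s0 = v_real 0"
proof -
  define v where "v = v_real 0"
  have v: "focus \<le> v" using focus_le_v_real_iff[of 0] assms by (simp add: v_def)
  have v0: "v > 0"
  proof (rule ccontr)
    assume "\<not> v > 0"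
    then have "v = 0" "focus = 0" using v focus_nonneg by auto
    then show False using v_real_mono[of "-1" 0] v_real_minus_one_bounds by (simp add: v_def)
  qed
  have "focus\<^sup>2 \<le> v\<^sup>2" using v focus_nonneg by (intro power_mono)
  then have d: "v\<^sup>2 - 4 * kappa \<ge> 0" by (simp add: focus_squared)
  define r where "r = sqrt (v\<^sup>2 - 4 * kappa)"
  have r: "r \<ge> 0" "r\<^sup>2 = v\<^sup>2 - 4 * kappa" using d by (simp_all add: r_def)
  define s0 where "s0 = (v + r) / 2"
  have s0: "s0 > 0" using v0 r by (simp add: s0_def)
  have "s0 * (v - s0) = (v\<^sup>2 - r\<^sup>2) / 4" by (simp add: s0_def power2_eq_square field_simps)
  then have k: "kappa = s0 * (v - s0)" using r by simp
  have "v - s0 \<le> s0" using r(1) by (simp add: s0_def field_simps)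
  then have "kappa \<le> s0\<^sup>2" using s0 unfolding k power2_eq_square by (intro mult_left_mono) auto
  moreover have "s0 + kappa / s0 = v" using s0 unfolding k by simp
  ultimately show ?thesis using that s0 by (simp add: v_def)
qed

lemma holomorphic_eta_of: "0 \<notin> S \<Longrightarrow> eta_of holomorphic_on S"
  unfolding eta_of_def by (intro holomorphic_intros) auto

lemma holomorphic_y_of: "0 \<notin> S \<Longrightarrow> (\<And>s. s \<in> S \<Longrightarrow> eta_of s \<noteq> 0) \<Longrightarrow> y_of holomorphic_on S"
  unfolding y_of_def using holomorphic_eta_of by (intro holomorphic_intros) auto

lemma holomorphic_x_of:
  assumes "0 \<notin> S" "e\<^sup>2 = 1" "\<And>s. s \<in> S \<Longrightarrow> xi_of (s * rho e) \<noteq> 0"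
  shows "x_of e holomorphic_on S"
  using assms rho_nonzero[OF assms(2)] unfolding x_of_def xi_of_def
  by (intro holomorphic_intros) auto

lemma open_sector: "open sector"
  unfolding sector_def by (intro open_Collect_conj open_Collect_less continuous_intros)

lemma y_of_of_real: "y_of (of_real s) = of_real (1 - 1 / (eta0 + scale * (s + kappa / s)))"
  by (simp add: y_of_def eta_of_def)

end

text \<open>\<open>B\<close> will be the power series supplied by \<open>kernel_mult_split\<close>
  for \<open>H 1 1\<close>. It extends \<open>y \<mapsto> w (X_plus p y)\<close> analytically across
  0, although \<open>X_plus p 0\<close> may lie on the boundary or at infinity.\<close>

locale glued_walk = zero_drift_walk +
  fixes w :: "complex \<Rightarrow> complex" and B :: "complex \<Rightarrow> complex" and r0 :: real
  assumes gluing: "conformal_gluing p w"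
    and r0: "r0 > 0"
    and B_hol: "B holomorphic_on ball 0 r0"
    and B_eq: "\<And>y. 0 < y \<Longrightarrow> y < r0 \<Longrightarrow> w (X_plus p (of_real y)) = B (of_real y)"
begin

lemma w_hol: "w holomorphic_on gluing_domain p"
  and w_inj: "inj_on w (gluing_domain p)"
  and w_cont: "continuous_on (closure (gluing_domain p) - {1}) w"
  and w_0: "w 0 = 0"
  using gluing by (auto simp: conformal_gluing_def)

text \<open>This is where the gluing condition enters: it makes the choice of the root, and hence of
  the branch of \<open>csqrt\<close>, irrelevant.\<close>

lemma w_on_branches:
  assumes "y_one p \<le> y" "y < 1" "walk_kernel p x (of_real y) = 0" "0 < y" "y < r0"
  shows "w x = B (of_real y)"
proof -
  note a = ker_a_nonzero[OF assms(1-3)]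
  have "w (X_plus p (of_real y)) = w (X_minus p (of_real y))"
    using gluing assms(1,2) a by (auto simp: conformal_gluing_def)
  moreover have "x = X_plus p (of_real y) \<or> x = X_minus p (of_real y)"
    using X_branches[OF a] assms(3) by blast
  ultimately show ?thesis using B_eq[OF assms(4,5)] by auto
qed

section \<open>Continuation from the boundary if \<open>y_one p \<le> 0\<close>\<close>

context
  fixes s0 d :: real
  assumes y_one_nonpos: "y_one p \<le> 0"
    and s0: "s0 > 0" "s0\<^sup>2 \<ge> kappa" "s0 + kappa / s0 = v_real 0"
    and d: "d > 0" "\<And>s. s \<in> ball (of_real s0) d \<Longrightarrow> s \<in> sector \<and> eta_of s \<noteq> 0 \<and> norm (y_of s) < r0"
begin

lemma ball_nonzero: "s \<in> ball (complex_of_real s0) d \<Longrightarrow> s \<noteq> 0"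
  using d(2)[of s] by (auto simp: sector_def)

text \<open>To the right of \<open>s0\<close>, the function \<open>s + kappa / s\<close> exceeds
  \<open>v_real 0\<close>, so \<open>y_of s\<close> is real and positive and
  \<open>w_on_branches\<close> applies to the kernel root \<open>x_of e s\<close>.\<close>

lemma on_real_axis:
  assumes "s \<in> ball (of_real s0) d" "Im s = 0" "Re s > s0" "e\<^sup>2 = 1"
  shows "xi_of (s * rho e) \<noteq> 0" "B (y_of s) = w (x_of e s)" "y_of s \<noteq> 0"
proof -
  define t where "t = Re s"
  have s: "s = of_real t" using assms(2) by (simp add: t_def complex_eq_iff)
  have t: "t > s0" using assms(3) by (simp add: t_def)
  have "s0 * s0 < t * s0" using t s0 by simp
  then have k: "kappa < t * s0" using s0(2) by (simp add: power2_eq_square)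
  have "t * s0 < t * t" using t s0 by simp
  then have "kappa < t * t" using k by simp
  then have kt: "kappa / t < t" using t s0 by (simp add: pos_divide_less_eq)
  have inv: "1 / rho e = rho (- e)" using rho_mult[OF assms(4)] rho_nonzero[OF assms(4)]
    by (simp add: field_simps)
  have "xi_of (s * rho e) = of_real xi0 + s * rho e + of_real kappa / s * (1 / rho e)"
    by (simp add: xi_of_def)
  then have "Im (xi_of (s * rho e)) = e * sin_angle * (t - kappa / t)"
    unfolding inv s by (simp add: rho_def Re_divide algebra_simps flip: of_real_divide)
  moreover have "e \<noteq> 0" using assms(4) by auto
  ultimately have "Im (xi_of (s * rho e)) \<noteq> 0" using kt less_imp_neq[OF sin_angle_pos] by simp
  then show xi: "xi_of (s * rho e) \<noteq> 0" by auto
  have "(t - s0) * (1 - kappa / (t * s0)) > 0"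
    using t s0 k by (intro mult_pos_pos) (auto simp: pos_divide_less_eq)
  moreover have "(t - s0) * (1 - kappa / (t * s0)) = (t + kappa / t) - (s0 + kappa / s0)"
    using t s0(1) by (simp add: field_simps)
  ultimately have "v_real 0 < t + kappa / t" using s0(3) by linarith
  then have "scale * v_real 0 < scale * (t + kappa / t)" by simp
  moreover have "eta0 + scale * v_real 0 = 1"
    using less_imp_neq[OF scale_pos] by (simp add: v_real_def)
  ultimately have eta: "eta0 + scale * (t + kappa / t) > 1" by linarith
  define y where "y = 1 - 1 / (eta0 + scale * (t + kappa / t))"
  have y: "0 < y" "y < 1" using eta by (simp_all add: y_def)
  have ys: "y_of s = of_real y" unfolding s y_def y_of_of_real ..
  then show "y_of s \<noteq> 0" using y by simp
  have "walk_kernel p (x_of e s) (of_real y) = 0"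
    using kernel_param[OF ball_nonzero[OF assms(1)] assms(4) xi] d(2)[OF assms(1)] by (simp add: ys)
  moreover have "y < r0" using d(2)[OF assms(1)] y by (simp add: ys)
  ultimately have "w (x_of e s) = B (of_real y)"
    using y y_one_nonpos by (intro w_on_branches) auto
  then show "B (y_of s) = w (x_of e s)" by (simp add: ys)
qed

text \<open>The boundary identity is available only to the right of \<open>s0\<close>. It is
  continued into a half-ball resting on that piece of the axis, and from there to the whole
  half-ball around \<open>s0\<close> by the identity theorem.\<close>

lemma half_ball_identity:
  assumes "e\<^sup>2 = 1" "s \<in> ball (of_real s0) d" "e * Im s < 0"
  shows "B (y_of s) = w (x_of e s)"
proof -
  have e: "e \<noteq> 0" "\<bar>e\<bar> = 1" using assms(1) by (auto simp: power2_eq_1_iff)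
  define D where "D = {s \<in> ball (of_real s0) d. e * Im s < 0}"
  \<comment> \<open>The ball of radius \<open>d / 2\<close> around \<open>c\<close> touches
    \<open>s0\<close> from the right, so all its real points are covered by
    \<open>on_real_axis\<close>.\<close>
  define c where "c = complex_of_real (s0 + d / 2)"
  have sub: "ball c (d / 2) \<subseteq> ball (of_real s0) d"
  proof
    fix z assume "z \<in> ball c (d / 2)"
    moreover have "dist c (complex_of_real s0) = d / 2" using d(1) by (simp add: c_def dist_norm)
    ultimately show "z \<in> ball (of_real s0) d"
      using dist_triangle[of "of_real s0" z c] by (simp add: dist_commute)
  qed
  have right: "Re z > s0" if "z \<in> ball c (d / 2)" for z
  proof -
    have "\<bar>Re (z - c)\<bar> < d / 2" using that abs_Re_le_cmod[of "z - c"] by (simp add: dist_norm norm_minus_commute)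
    then show ?thesis by (simp add: c_def abs_if split: if_splits)
  qed
  define C where "C = {z \<in> ball c (d / 2). e * Im z \<le> 0}"
  have xi: "xi_of (z * rho e) \<noteq> 0" if "z \<in> C \<union> D" for z
  proof (cases "e * Im z < 0")
    case True
    then show ?thesis using that sub d(2) x_of_in_region(2)[of z e] assms(1) by (auto simp: C_def D_def)
  next
    case False
    then have "z \<in> ball c (d / 2)" "Im z = 0" using that e by (auto simp: C_def D_def)
    then show ?thesis using on_real_axis(1)[of z e] sub right assms(1) by auto
  qed
  have nz: "z \<noteq> 0" if "z \<in> C \<union> D" for z
    using that subsetD[OF sub] ball_nonzero unfolding C_def D_def by blast
  have in_region: "x_of e z \<in> region" if "z \<in> ball (of_real s0) d" "e * Im z < 0" for z
    using that d(2) x_of_in_region(1) assms(1) by blast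
  have cont_x: "isCont (x_of e) z" if "z \<in> C \<union> D" for z
    using nz[OF that] xi[OF that] rho_nonzero[OF assms(1)] unfolding x_of_def xi_of_def
    by (intro continuous_intros) auto
  have closure: "x_of e z \<in> closure (gluing_domain p) - {1}" if "z \<in> C" for z
  proof -
    have z: "z \<in> ball c (d / 2)" "e * Im z \<le> 0" using that by (auto simp: C_def)
    \<comment> \<open>Moving in the direction \<open>- e * \<i>\<close> enters the half-ball, where
      \<open>x_of e\<close> takes values in \<open>region\<close>.\<close>
    let ?h = "\<lambda>t::real. z - of_real (t * e) * \<i>"
    have "((\<lambda>t. x_of e (?h t)) \<longlongrightarrow> x_of e z) (at_right 0)"
    proof (rule isCont_tendsto_compose[OF cont_x])
      show "z \<in> C \<union> D" using that by simp
      have "isCont ?h 0" by (intro continuous_intros)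
      then have "(?h \<longlongrightarrow> ?h 0) (at_right 0)"
        by (simp add: isCont_def filterlim_at_split)
      then show "(?h \<longlongrightarrow> z) (at_right 0)" by simp
    qed
    moreover have "\<forall>\<^sub>F t in at_right 0. x_of e (?h t) \<in> closure (gluing_domain p)"
    proof -
      define m where "m = d / 2 - dist c z"
      have m: "m > 0" using z by (simp add: m_def)
      have "\<forall>\<^sub>F t in at_right 0. t > 0 \<and> t < m"
        unfolding eventually_at_right_field using m by auto
      then show ?thesis
      proof eventually_elim
        case (elim t)
        have "dist z (?h t) = t" using elim e by (simp add: dist_norm norm_mult)
        then have "?h t \<in> ball c (d / 2)" using elim dist_triangle[of c "?h t" z] by (simp add: m_def)
        moreover have "e * Im (?h t) = e * Im z - t * e\<^sup>2" by (simp add: power2_eq_square algebra_simps)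
        then have "e * Im (?h t) < 0" using z(2) elim assms(1) by simp
        ultimately have "x_of e (?h t) \<in> region" using in_region sub by blast
        then show ?case using region_subset_gluing_domain closure_subset by blast
      qed
    qed
    ultimately have "x_of e z \<in> closure (gluing_domain p)"
      by (intro Lim_in_closed_set[OF closed_closure]) auto
    moreover have "x_of e z \<noteq> 1" using xi[of z] that by (simp add: x_of_def)
    ultimately show ?thesis by simp
  qed
  define f where "f z = B (y_of z) - w (x_of e z)" for z
  have y_hol: "y_of holomorphic_on ball (of_real s0) d"
    using ball_nonzero d(2) by (intro holomorphic_y_of) blast+
  have By_hol: "(\<lambda>z. B (y_of z)) holomorphic_on ball (of_real s0) d"
    using holomorphic_on_compose_gen[OF y_hol B_hol, unfolded o_def] d(2) by force
  have f_hol: "f holomorphic_on D"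
  proof -
    have "x_of e holomorphic_on D" using nz xi assms(1) by (intro holomorphic_x_of) blast+
    moreover have "x_of e ` D \<subseteq> gluing_domain p"
      using in_region region_subset_gluing_domain by (auto simp: D_def)
    ultimately have "(\<lambda>z. w (x_of e z)) holomorphic_on D"
      using holomorphic_on_compose_gen[OF _ w_hol, unfolded o_def] by blast
    then show ?thesis unfolding f_def
      by (intro holomorphic_intros holomorphic_on_subset[OF By_hol]) (auto simp: D_def)
  qed
  have half: "f z = 0" if "z \<in> ball c (d / 2)" "e * Im z < 0" for z
  proof (rule holomorphic_zero_from_boundary[OF e(1) _ _ _ _ that])
    show "Im c = 0" by (simp add: c_def)
    have "continuous_on C (\<lambda>z. w (x_of e z))"
      using closure cont_x by (intro continuous_on_compose2[OF w_cont] continuous_at_imp_continuous_on) auto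
    moreover have "continuous_on C (\<lambda>z. B (y_of z))"
      by (rule continuous_on_subset[OF holomorphic_on_imp_continuous_on[OF By_hol]])
         (use sub in \<open>auto simp: C_def\<close>)
    ultimately show "continuous_on {z \<in> ball c (d / 2). e * Im z \<le> 0} f"
      unfolding f_def C_def by (intro continuous_intros)
    show "f holomorphic_on {z \<in> ball c (d / 2). e * Im z < 0}"
      by (rule holomorphic_on_subset[OF f_hol]) (use sub in \<open>auto simp: D_def\<close>)
    show "f z = 0" if "z \<in> ball c (d / 2)" "Im z = 0" for z
      using on_real_axis(2)[of z e] that sub right assms(1) by (auto simp: f_def)
  qed
  define U where "U = {z \<in> ball c (d / 2). e * Im z < 0}"
  have U_eq: "U = ball c (d / 2) \<inter> {z. e * Im z < 0}" by (auto simp: U_def)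
  have D_eq: "D = ball (of_real s0) d \<inter> {z. e * Im z < 0}" by (auto simp: D_def)
  have opn: "open {z. e * Im z < 0}" by (intro open_Collect_less continuous_intros)
  have cvx: "convex {z. e * Im z < 0}"
  proof -
    have "{z. e * Im z < 0} = {z. (e *\<^sub>R \<i>) \<bullet> z < 0}" by auto
    then show ?thesis by (simp only: convex_halfspace_lt)
  qed
  define z1 where "z1 = c - of_real (e * d / 4) * \<i>"
  have z1: "z1 \<in> U" using d(1) e assms(1)
    by (simp add: U_def z1_def dist_norm norm_mult abs_mult c_def power2_eq_square
        mult.assoc[symmetric])
  have "f s = 0"
  proof (rule analytic_continuation[OF f_hol])
    show "open D" unfolding D_eq using opn by auto
    show "connected D" unfolding D_eq using cvx by (intro convex_connected convex_Int) auto
    show "U \<subseteq> D" using sub by (auto simp: U_def D_def)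
    then show "z1 \<in> D" using z1 by blast
    have "open U" unfolding U_eq using opn by auto
    then show "z1 islimpt U" using z1 by (intro interior_limit_point) (simp add: interior_open)
    show "f z = 0" if "z \<in> U" for z using that half by (simp add: U_def)
    show "s \<in> D" using assms by (simp add: D_def)
  qed
  then show ?thesis by (simp add: f_def)
qed

end

text \<open>If \<open>y_one p = 0\<close>, then \<open>s0\<close> is a critical point of
  \<open>y_of\<close>, and no local inverse exists. Openness of \<open>y_of\<close> still supplies a
  parameter for each small \<open>y\<close>, and an arbitrary choice suffices: the assertions on
  \<open>X\<close> are pointwise, and injectivity comes from \<open>x_of_inj\<close>.\<close>

lemma local_branch_nonpos:
  assumes "y_one p \<le> 0"
  obtains d X where "0 < d" "d \<le> r0"
    "\<And>y. norm y < d \<Longrightarrow> Im y \<noteq> 0 \<Longrightarrow> X y \<in> region \<and> walk_kernel p (X y) y = 0 \<and> B y = w (X y)"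
    "inj_on X {y \<in> ball 0 d. Im y \<noteq> 0}"
proof -
  obtain s0 where s0: "s0 > 0" "s0\<^sup>2 \<ge> kappa" "s0 + kappa / s0 = v_real 0"
    using sigma_exists[OF assms] .
  define c where "c = complex_of_real s0"
  have "eta0 + scale * (s0 + kappa / s0) = 1"
    unfolding s0(3) using less_imp_neq[OF scale_pos] by (simp add: v_real_def)
  moreover have "eta_of c = of_real (eta0 + scale * (s0 + kappa / s0))"
    by (simp add: eta_of_def c_def)
  ultimately have eta: "eta_of c = 1" by (simp only: of_real_1)
  then have yc: "y_of c = 0" by (simp add: y_of_def)
  have "c \<noteq> 0" using s0 by (simp add: c_def)
  then have cont_eta: "isCont eta_of c" unfolding eta_of_def by (intro continuous_intros) auto
  then have cont_y: "isCont y_of c" using eta unfolding y_of_def by (intro continuous_intros) auto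
  have "\<forall>\<^sub>F s in nhds c. s \<in> sector"
    using s0 by (intro eventually_nhds_in_open open_sector) (simp add: c_def sector_def)
  moreover have "\<forall>\<^sub>F s in nhds c. eta_of s \<in> - {0}"
    using cont_eta eta by (intro topological_tendstoD[of _ "eta_of c"])
      (auto simp: isCont_def tendsto_nhds_iff)
  moreover have "\<forall>\<^sub>F s in nhds c. y_of s \<in> ball 0 r0"
    using cont_y yc r0 by (intro topological_tendstoD[of _ "y_of c"])
      (auto simp: isCont_def tendsto_nhds_iff)
  ultimately have "\<forall>\<^sub>F s in nhds c. s \<in> sector \<and> eta_of s \<noteq> 0 \<and> norm (y_of s) < r0"
    by eventually_elim auto
  then obtain d where d: "d > 0"
    "\<And>s. s \<in> ball (of_real s0) d \<Longrightarrow> s \<in> sector \<and> eta_of s \<noteq> 0 \<and> norm (y_of s) < r0"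
    unfolding eventually_nhds_metric by (auto simp: c_def dist_commute)
  note loc = assms s0 d
  have "y_of holomorphic_on ball c d"
    using ball_nonzero[OF loc] d(2) unfolding c_def by (intro holomorphic_y_of) blast+
  moreover have "\<not> y_of constant_on ball c d"
  proof
    assume "y_of constant_on ball c d"
    moreover have "c \<in> ball c d" using d by simp
    moreover have c': "c + of_real (d / 2) \<in> ball c d" using d by (simp add: dist_norm)
    ultimately have "y_of (c + of_real (d / 2)) = 0" using yc unfolding constant_on_def by metis
    moreover have "y_of (c + of_real (d / 2)) \<noteq> 0"
      by (rule on_real_axis(3)[OF loc, of _ 1]) (use c' d in \<open>auto simp: c_def\<close>)
    ultimately show False by simp
  qed
  ultimately have "open (y_of ` ball c d)"
    by (intro open_mapping_thm[of y_of "ball c d"]) auto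
  moreover have "0 \<in> y_of ` ball c d" using yc d(1) by (metis centre_in_ball imageI)
  ultimately obtain d' where d': "d' > 0" "ball 0 d' \<subseteq> y_of ` ball c d"
    using open_contains_ball by blast
  define S where "S y = (SOME s. s \<in> ball c d \<and> y_of s = y)" for y
  \<comment> \<open>This sign gives \<open>E y * Im (S y) < 0\<close>. A nonreal \<open>y\<close>
    has a nonreal parameter, since \<open>y_of\<close> is real on the real axis.\<close>
  define E where "E y = - sgn (Im (S y))" for y
  define X where "X y = x_of (E y) (S y)" for y
  have S: "S y \<in> ball c d" "y_of (S y) = y" if "norm y < d'" for y
  proof -
    have "y \<in> y_of ` ball c d" using that d'(2) by auto
    then have "\<exists>s. s \<in> ball c d \<and> y_of s = y" by blast
    from someI_ex[OF this] show "S y \<in> ball c d" "y_of (S y) = y" unfolding S_def by auto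
  qed
  have E: "(E y)\<^sup>2 = 1" "E y * Im (S y) < 0" if "norm y < d'" "Im y \<noteq> 0" for y
  proof -
    have "Im (S y) \<noteq> 0"
    proof
      assume "Im (S y) = 0"
      then have "S y = of_real (Re (S y))" by (simp add: complex_eq_iff)
      then have "Im (y_of (S y)) = 0" using y_of_of_real[of "Re (S y)"] by (metis Im_complex_of_real)
      then show False using S(2)[OF that(1)] that(2) by simp
    qed
    then show "(E y)\<^sup>2 = 1" "E y * Im (S y) < 0"
      by (auto simp: E_def sgn_if)
  qed
  show ?thesis
  proof (rule that[of "min d' r0" X])
    show "0 < min d' r0" "min d' r0 \<le> r0" using d' r0 by auto
    show "X y \<in> region \<and> walk_kernel p (X y) y = 0 \<and> B y = w (X y)"
      if "norm y < min d' r0" "Im y \<noteq> 0" for y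
    proof -
      have y: "norm y < d'" using that by simp
      note S' = S[OF y] and E' = E[OF y that(2)]
      have sec: "S y \<in> sector" "eta_of (S y) \<noteq> 0" using d(2) S'(1) by (auto simp: c_def)
      have nz: "S y \<noteq> 0" using ball_nonzero[OF loc] S'(1) by (simp add: c_def)
      have "walk_kernel p (X y) (y_of (S y)) = 0"
        unfolding X_def using kernel_param[OF nz E'(1) x_of_in_region(2)[OF sec(1) E']] sec(2) by simp
      moreover have "B (y_of (S y)) = w (X y)"
        unfolding X_def using half_ball_identity[OF loc E'(1) _ E'(2)] S'(1) by (simp add: c_def)
      ultimately show ?thesis
        using x_of_in_region(1)[OF sec(1) E'] unfolding S'(2) by (simp add: X_def)
    qed
    show "inj_on X {y \<in> ball 0 (min d' r0). Im y \<noteq> 0}"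
    proof (rule inj_onI)
      fix y y' assume "y \<in> {y \<in> ball 0 (min d' r0). Im y \<noteq> 0}" "y' \<in> {y \<in> ball 0 (min d' r0). Im y \<noteq> 0}"
        and eq: "X y = X y'"
      then have y: "norm y < d'" "Im y \<noteq> 0" "norm y' < d'" "Im y' \<noteq> 0" by auto
      have "S y \<in> sector" "S y' \<in> sector" using d(2) S(1) y by (auto simp: c_def)
      then have "y_of (S y) = y_of (S y')"
        using eq E[OF y(1,2)] E[OF y(3,4)] unfolding X_def by (intro x_of_inj[of _ "E y" _ "E y'"]) auto
      then show "y = y'" using S(2)[OF y(1)] S(2)[OF y(3)] by simp
    qed
  qed
qed


section \<open>The kernel as a polynomial in \<open>y\<close>, and the case
  \<open>y_one p > 0\<close>\<close>

definition col_a :: "'a::real_normed_field \<Rightarrow> 'a" where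
  "col_a x = of_real (p 1 (-1)) + of_real (p 0 (-1)) * x + of_real (p (-1) (-1)) * x\<^sup>2"
definition col_b :: "'a::real_normed_field \<Rightarrow> 'a" where
  "col_b x = of_real (p 1 0) + of_real (p 0 0 - 1) * x + of_real (p (-1) 0) * x\<^sup>2"
definition col_c :: "'a::real_normed_field \<Rightarrow> 'a" where
  "col_c x = of_real (p 1 1) + of_real (p 0 1) * x + of_real (p (-1) 1) * x\<^sup>2"

lemma kernel_col: "walk_kernel p x y = col_a x * y\<^sup>2 + col_b x * y + col_c x"
  by (simp add: walk_kernel_quadratic ker_expand col_a_def col_b_def col_c_def algebra_simps)

lemma kernel_col_real:
  "walk_kernel p (of_real x) (of_real y) = of_real (col_a x * y\<^sup>2 + col_b x * y + col_c x)"
  by (simp add: kernel_col col_a_def col_b_def col_c_def)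

lemma col_b_pos:
  assumes "x < (0::real)"
  shows "col_b x > 0"
proof -
  have "(p 0 0 - 1) * x > 0" using assms p_00_less_1 by (intro mult_neg_neg) auto
  moreover have "p 1 0 \<ge> 0" "p (-1) 0 * x\<^sup>2 \<ge> 0" by simp_all
  ultimately show ?thesis unfolding col_b_def of_real_eq_id id_apply by linarith
qed

text \<open>At the vertex \<open>x = 1 - 1 / xi_star\<close>, the kernel as a quadratic in
  \<open>y\<close> vanishes at \<open>y_one p\<close>, is positive at 1 and has a positive linear
  coefficient. A nonnegative constant term would make it concave because of the zero, hence positive
  throughout \<open>(0, 1)\<close>.\<close>

lemma xi_star_pos_case:
  assumes "y_one p > 0"
  shows "0 < xi_star" "xi_star < 1" "col_c (1 - 1 / xi_star) < 0"
proof -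
  obtain q where q: "q > 0" "a_real (y_one p) = q * xi_star\<^sup>2" "c_real (y_one p) = q * (1 - xi_star)\<^sup>2"
    by (rule kernel_at_y_one)
  have "xi_star \<noteq> 0" using ac_pos(1)[OF assms] q by auto
  moreover have "xi_star \<noteq> 1" using ac_pos(2)[OF assms] q by auto
  ultimately show xi: "0 < xi_star" "xi_star < 1" using xi_star_bounds by auto
  define x where "x = 1 - 1 / xi_star"
  have x: "x < 0" using xi by (simp add: x_def)
  define y where "y = y_one p"
  have y: "0 < y" "y < 1" using assms y_one_less by (auto simp: y_def)
  have x1: "complex_of_real x \<noteq> 1" using x by (simp add: complex_eq_iff)
  have "1 / (1 - complex_of_real x) = of_real xi_star" using xi by (simp add: x_def)
  then have "walk_kernel p (of_real x) (of_real y) = 0"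
    using x1 y by (subst kernel_zero_iff)
      (auto simp: y_def v_coord_of_real v_real_y_one normal_conic_focus xi_star_def)
  then have zero: "col_a x * y\<^sup>2 + col_b x * y + col_c x = 0"
    unfolding kernel_col_real of_real_eq_0_iff .
  have "complex_of_real (col_a x + col_b x + col_c x) = of_real (var_x / 2 * (1 - x)\<^sup>2)"
    using kernel_col_real[of x 1] kernel_at_one(1)[of "of_real x"] by simp
  then have "col_a x + col_b x + col_c x = var_x / 2 * (1 - x)\<^sup>2" unfolding of_real_eq_iff .
  moreover have "var_x / 2 * (1 - x)\<^sup>2 > 0" using x by simp
  ultimately have one: "col_a x + col_b x + col_c x > 0" by linarith
  have "col_c x < 0"
  proof (rule ccontr)
    assume "\<not> col_c x < 0"
    then have c: "col_c x \<ge> 0" by simp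
    have "col_b x * y > 0" using col_b_pos[OF x] y by simp
    then have "col_a x * y\<^sup>2 < 0" using zero c by linarith
    then have "col_a x < 0" using y by (simp add: mult_less_0_iff)
    then have "col_a x * y < 0" using y by (simp add: mult_neg_pos)
    then have "col_c x - col_a x * y > 0" using c by linarith
    then have "(1 - y) * (col_c x - col_a x * y) > 0" using y by simp
    moreover have "y * (col_a x + col_b x + col_c x) > 0" using y one by simp
    moreover have "col_a x * y\<^sup>2 + col_b x * y + col_c x =
        y * (col_a x + col_b x + col_c x) + (1 - y) * (col_c x - col_a x * y)"
      by (simp add: power2_eq_square algebra_simps)
    ultimately show False using zero by linarith
  qed
  then show "col_c (1 - 1 / xi_star) < 0" by (simp add: x_def)
qed

lemma y_one_pos_iff: "y_one p > 0 \<longleftrightarrow> (p 0 1)\<^sup>2 - 4 * p (-1) 1 * p 1 1 > 0"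
  using discr_nonneg_iff(1)[of 0] by (simp add: a_real_def b_real_def c_real_def)


text \<open>The discriminant is positive at 0, so the branch is analytic there, and its value
  \<open>x0\<close> lies in \<open>region\<close>. The equation \<open>B = w \<circ> X\<close>
  follows from the identity theorem on the positive half-axis.\<close>

lemma local_branch_pos:
  assumes "y_one p > 0"
  obtains d X where "0 < d" "d \<le> r0"
    "\<And>y. norm y < d \<Longrightarrow> X y \<in> region \<and> walk_kernel p (X y) y = 0 \<and> B y = w (X y)"
    "p 1 1 = 0 \<Longrightarrow> X 0 = 0"
    "p 1 1 \<noteq> 0 \<Longrightarrow> inj_on X (ball 0 d)"
proof -
  define R where "R = sqrt ((p 0 1)\<^sup>2 - 4 * p (-1) 1 * p 1 1)"
  have D: "(p 0 1)\<^sup>2 - 4 * p (-1) 1 * p 1 1 > 0" using assms y_one_pos_iff by simp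
  then have R: "R > 0" "R\<^sup>2 = (p 0 1)\<^sup>2 - 4 * p (-1) 1 * p 1 1" by (simp_all add: R_def)
  define q where "q = p 0 1 + R"
  have q: "q > 0" using R p_nonneg(4) unfolding q_def by linarith
  define x0 where "x0 = - 2 * p 1 1 / q"
  have x0: "x0 \<le> 0" using q by (simp add: x0_def)
  \<comment> \<open>\<open>X_plus\<close> with rationalised numerator, because
    \<open>ker_a p 0\<close> may vanish.\<close>
  define X where "X y = - 2 * ker_c p y / (ker_b p y + csqrt (discr p y))" for y
  have at0: "discr p 0 = of_real ((p 0 1)\<^sup>2 - 4 * p (-1) 1 * p 1 1)"
    by (simp add: discr_def ker_expand)
  then have sq0: "csqrt (discr p 0) = of_real R"
    using D by (simp add: R_def csqrt_of_real_nonneg del: of_real_diff)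
  have den0: "ker_b p 0 + csqrt (discr p 0) = of_real q" by (simp add: sq0 q_def ker_expand)
  have X0: "X 0 = of_real x0" unfolding X_def den0 by (simp add: x0_def ker_expand)
  \<comment> \<open>The left side is the derivative of \<open>col_c\<close> at its root
    \<open>x0\<close>.\<close>
  have slope: "p 0 1 + 2 * p (-1) 1 * x0 = R"
  proof -
    have "(p 0 1 + 2 * p (-1) 1 * x0) * q = p 0 1 * q - 4 * p (-1) 1 * p 1 1"
      using q by (simp add: x0_def field_simps)
    also have "\<dots> = R * q" using R(2) by (simp add: q_def power2_eq_square algebra_simps)
    finally show ?thesis using q by simp
  qed
  have root: "col_c x0 = 0"
  proof -
    have "2 * col_c x0 = 2 * p 1 1 + x0 * (p 0 1 + (p 0 1 + 2 * p (-1) 1 * x0))"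
      by (simp add: col_c_def power2_eq_square algebra_simps)
    also have "\<dots> = 2 * p 1 1 + x0 * q" unfolding slope q_def ..
    also have "\<dots> = 0" using q by (simp add: x0_def)
    finally show ?thesis by simp
  qed
  \<comment> \<open>\<open>col_c\<close> is convex with positive slope at its root
    \<open>x0\<close>, hence nonnegative to the right of it, but it is negative at the
    vertex.\<close>
  have star: "1 - 1 / xi_star < x0"
  proof (rule ccontr)
    define x where "x = 1 - 1 / xi_star"
    assume "\<not> 1 - 1 / xi_star < x0"
    then have le: "x \<ge> x0" by (simp add: x_def)
    have "col_c x - col_c x0 = (x - x0) * ((p 0 1 + 2 * p (-1) 1 * x0) + p (-1) 1 * (x - x0))"
      by (simp add: col_c_def power2_eq_square algebra_simps)
    also have "\<dots> \<ge> 0" unfolding slope using le R by simp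
    finally show False using root xi_star_pos_case(3)[OF assms] by (simp add: x_def)
  qed
  have "of_real x0 \<in> region"
  proof -
    have "1 - x0 < 1 / xi_star" using star by simp
    then have "xi_star < 1 / (1 - x0)"
      using xi_star_pos_case(1)[OF assms] x0 by (simp add: field_simps)
    then have "side (of_real (1 / (1 - x0))) > 0" using side_real(1) by blast
    then show ?thesis using x0 by (auto simp: region_def complex_eq_iff)
  qed
  then have X0_region: "X 0 \<in> region" by (simp add: X0)
  have d0: "discr p 0 \<notin> \<real>\<^sub>\<le>\<^sub>0" unfolding at0 using D by (simp del: of_real_diff)
  have cont: "isCont (discr p) y" "isCont (ker_b p) y" "isCont (ker_c p) y" for y
    unfolding discr_def ker_expand[abs_def] by (intro continuous_intros)+
  have cont_s: "isCont (\<lambda>y. csqrt (discr p y)) 0"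
    using cont(1) d0 by (rule isCont_csqrt')
  have den_ne: "ker_b p 0 + csqrt (discr p 0) \<noteq> 0" unfolding den0 using q by simp
  have cont_X: "isCont X 0"
    unfolding X_def using den_ne cont cont_s by (intro continuous_intros) auto
  have ev: "\<forall>\<^sub>F y in nhds 0. F y \<in> S" if "isCont F 0" "open S" "F 0 \<in> S" for F :: "complex \<Rightarrow> complex" and S
    using that by (intro topological_tendstoD[of F "F 0"]) (auto simp: isCont_def tendsto_nhds_iff)
  have "\<forall>\<^sub>F y in nhds 0. discr p y \<in> - \<real>\<^sub>\<le>\<^sub>0"
    using cont d0 by (intro ev) (auto simp: open_Compl)
  moreover have "\<forall>\<^sub>F y in nhds 0. ker_b p y + csqrt (discr p y) \<in> - {0}"
    using cont cont_s den_ne by (intro ev continuous_intros) auto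
  moreover have "\<forall>\<^sub>F y in nhds 0. X y \<in> region"
    using cont_X X0_region open_region by (intro ev)
  moreover have "\<forall>\<^sub>F y in nhds 0. y \<in> ball (0::complex) r0"
    using r0 by (intro eventually_nhds_in_open) auto
  ultimately have "\<forall>\<^sub>F y in nhds 0. discr p y \<notin> \<real>\<^sub>\<le>\<^sub>0 \<and> ker_b p y + csqrt (discr p y) \<noteq> 0
      \<and> X y \<in> region \<and> norm y < r0"
    by eventually_elim auto
  then obtain d1 where d1: "d1 > 0" "\<And>y. norm y < d1 \<Longrightarrow> discr p y \<notin> \<real>\<^sub>\<le>\<^sub>0
      \<and> ker_b p y + csqrt (discr p y) \<noteq> 0 \<and> X y \<in> region \<and> norm y < r0"
    unfolding eventually_nhds_metric by auto
  define d where "d = min d1 r0"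
  have d: "d > 0" "d \<le> r0" "\<And>y. norm y < d \<Longrightarrow> discr p y \<notin> \<real>\<^sub>\<le>\<^sub>0"
      "\<And>y. norm y < d \<Longrightarrow> ker_b p y + csqrt (discr p y) \<noteq> 0" "\<And>y. norm y < d \<Longrightarrow> X y \<in> region"
    using d1 r0 by (auto simp: d_def)
  have K: "walk_kernel p (X y) y = 0" if "norm y < d" for y
  proof -
    define a b c s where "a = ker_a p y" and "b = ker_b p y" and "c = ker_c p y" and "s = csqrt (discr p y)"
    have s: "s * s = b * b - 4 * a * c"
      using power2_csqrt[of "discr p y"] by (simp add: s_def a_def b_def c_def discr_def power2_eq_square)
    have ne: "b + s \<noteq> 0" using d(4)[OF that] by (simp add: b_def s_def)
    have X: "X y * (b + s) = - 2 * c" using ne by (simp add: X_def b_def s_def c_def)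
    have "m * m * (a * z\<^sup>2 + b * z + c) = a * (z * m)\<^sup>2 + b * m * (z * m) + c * m * m" for m z
      by (simp add: power2_eq_square algebra_simps)
    then have "(b + s) * (b + s) * (a * (X y)\<^sup>2 + b * X y + c) =
        a * (- 2 * c)\<^sup>2 + b * (b + s) * (- 2 * c) + c * (b + s) * (b + s)"
      unfolding X[symmetric] by blast
    also have "\<dots> = c * (s * s - (b * b - 4 * a * c))" by (simp add: power2_eq_square algebra_simps)
    finally show ?thesis using ne s by (simp add: walk_kernel_quadratic a_def b_def c_def)
  qed
  have X_hol: "X holomorphic_on ball 0 d"
  proof -
    have k: "discr p holomorphic_on ball 0 d" "ker_b p holomorphic_on ball 0 d" "ker_c p holomorphic_on ball 0 d"
      unfolding discr_def ker_expand[abs_def] by (intro holomorphic_intros)+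
    have "(\<lambda>y. csqrt (discr p y)) holomorphic_on ball 0 d"
      using k(1) d(3) by (intro holomorphic_on_csqrt') auto
    then show ?thesis unfolding X_def using k d(3,4) by (intro holomorphic_intros) auto
  qed
  have BX: "B y = w (X y)" if "norm y < d" for y
  proof -
    have "(\<lambda>y. B y - w (X y)) holomorphic_on ball 0 d"
    proof (intro holomorphic_intros)
      show "B holomorphic_on ball 0 d" using B_hol d(2) by (auto intro: holomorphic_on_subset)
      show "(\<lambda>y. w (X y)) holomorphic_on ball 0 d"
        using holomorphic_on_compose_gen[OF X_hol w_hol, unfolded o_def] d(5) region_subset_gluing_domain
        by force
    qed
    moreover have "B z - w (X z) = 0" if z: "z \<in> of_real ` {0<..<d}" for z
    proof -
      obtain y where y: "z = of_real y" "0 < y" "y < d" using z by auto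
      have a: "ker_a p z \<noteq> 0" using ac_pos(1)[OF y(2)] by (simp add: y(1) ker_of_real)
      have ne: "ker_b p z + csqrt (discr p z) \<noteq> 0" using d(4)[of z] y by simp
      have "(- ker_b p z + csqrt (discr p z)) * (ker_b p z + csqrt (discr p z)) =
          (csqrt (discr p z))\<^sup>2 - (ker_b p z)\<^sup>2" by (simp add: power2_eq_square algebra_simps)
      also have "\<dots> = - 4 * ker_a p z * ker_c p z" by (simp add: discr_def)
      finally have "X_plus p z = X z" using a ne unfolding X_plus_def X_def by (simp add: field_simps)
      then show ?thesis using B_eq[of y] y d(2) by simp
    qed
    ultimately have "B y - w (X y) = 0"
      using that d(1) of_real_interval_islimpt[OF d(1)]
      by (intro analytic_continuation[of "\<lambda>y. B y - w (X y)" "ball 0 d" "of_real ` {0<..<d}" 0 y]) auto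
    then show ?thesis by simp
  qed
  show ?thesis
  proof (cases "p 1 1 = 0")
    case True
    then have "X 0 = 0" by (simp add: X0 x0_def)
    with True show ?thesis using d K BX by (intro that[of d X]) auto
  next
    case False
    then have x0': "x0 < 0" using q p_nonneg(1) by (auto simp: x0_def zero_less_mult_iff less_le)
    \<comment> \<open>Two values of \<open>y\<close> with the same \<open>X y\<close> are roots of
      one quadratic polynomial, so \<open>col_a * (y + z) = - col_b\<close>. Near 0 the left side is
      at most \<open>A * (2 * e) \<le> b / 2\<close>, whereas \<open>col_b\<close> stays larger than
      \<open>b / 2\<close> because \<open>col_b x0 > 0\<close> for \<open>x0 < 0\<close>.\<close>
    define A where "A = norm (col_a (X 0)) + 1"
    define b where "b = norm (col_b (X 0))"
    have A: "A > 0" by (simp add: A_def add_nonneg_pos)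
    have "col_b (X 0) = of_real (col_b x0)" by (simp add: X0 col_b_def)
    then have b: "b > 0" using col_b_pos[OF x0'] by (simp add: b_def)
    have "isCont (\<lambda>y. norm (col_a (X y))) 0" "isCont (\<lambda>y. norm (col_b (X y))) 0"
      unfolding col_a_def col_b_def using cont_X by (intro continuous_intros; simp)+
    then have "\<forall>\<^sub>F y in nhds 0. norm (col_a (X y)) < A" "\<forall>\<^sub>F y in nhds 0. norm (col_b (X y)) > b / 2"
      using order_tendstoD(2)[of "\<lambda>y. norm (col_a (X y))" "norm (col_a (X 0))" "nhds 0" A]
        order_tendstoD(1)[of "\<lambda>y. norm (col_b (X y))" "norm (col_b (X 0))" "nhds 0" "b / 2"] b
      by (auto simp: isCont_def tendsto_nhds_iff A_def b_def)
    then have "\<forall>\<^sub>F y in nhds 0. norm (col_a (X y)) < A \<and> norm (col_b (X y)) > b / 2"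
      by (rule eventually_conj)
    then obtain d2 where d2: "d2 > 0" "\<And>y. norm y < d2 \<Longrightarrow> norm (col_a (X y)) < A"
      "\<And>y. norm y < d2 \<Longrightarrow> norm (col_b (X y)) > b / 2"
      unfolding eventually_nhds_metric by auto
    define e where "e = min d (min d2 (b / (4 * A)))"
    have e: "e > 0" "e \<le> d" "e \<le> d2" "e \<le> b / (4 * A)" using d d2 b A by (auto simp: e_def)
    have "inj_on X (ball 0 e)"
    proof (rule inj_onI, rule ccontr)
      fix y z assume yz: "y \<in> ball 0 e" "z \<in> ball 0 e" "X y = X z" "y \<noteq> z"
      have "walk_kernel p (X y) y = 0" "walk_kernel p (X y) z = 0"
        using K[of y] K[of z] yz e by auto
      moreover have "(y - z) * (col_a (X y) * (y + z) + col_b (X y)) =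
          walk_kernel p (X y) y - walk_kernel p (X y) z"
        unfolding kernel_col by (simp add: power2_eq_square algebra_simps)
      ultimately have "(y - z) * (col_a (X y) * (y + z) + col_b (X y)) = 0" by simp
      then have "col_b (X y) = - (col_a (X y) * (y + z))" using yz(4) by (simp add: add_eq_0_iff)
      then have "norm (col_b (X y)) = norm (col_a (X y)) * norm (y + z)" by (simp add: norm_mult)
      also have "\<dots> \<le> A * (2 * e)"
        using d2(2)[of y] yz e A norm_triangle_ineq[of y z] by (intro mult_mono) auto
      also have "\<dots> \<le> b / 2" using e(4) A by (simp add: field_simps)
      finally show False using d2(3)[of y] yz e by simp
    qed
    with False show ?thesis using d K BX e by (intro that[of e X]) auto
  qed
qed

text \<open>If \<open>y_one p > 0\<close>, then \<open>p 0 1\<close> is nonzero or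
  \<open>p 1 1\<close> would have to be negative; the assumption therefore yields
  \<open>p 1 1 \<noteq> 0\<close>, the injective case of \<open>local_branch_pos\<close>.\<close>

lemma local_branch:
  assumes "p 1 1 \<noteq> 0 \<or> p 0 1 = 0"
  obtains d X where "0 < d" "d \<le> r0"
    "\<And>y. norm y < d \<Longrightarrow> Im y \<noteq> 0 \<Longrightarrow> X y \<in> region \<and> walk_kernel p (X y) y = 0 \<and> B y = w (X y)"
    "inj_on X {y \<in> ball 0 d. Im y \<noteq> 0}"
proof (cases "y_one p > 0")
  case True
  then have "p 1 1 \<noteq> 0" using assms y_one_pos_iff by auto
  obtain d X where d: "0 < d" "d \<le> r0"
    and X: "\<And>y. norm y < d \<Longrightarrow> X y \<in> region \<and> walk_kernel p (X y) y = 0 \<and> B y = w (X y)"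
    and "p 1 1 = 0 \<Longrightarrow> X 0 = 0" and inj: "p 1 1 \<noteq> 0 \<Longrightarrow> inj_on X (ball 0 d)"
    by (rule local_branch_pos[OF True]) blast
  show ?thesis
  proof (rule that[of d X])
    show "inj_on X {y \<in> ball 0 d. Im y \<noteq> 0}"
      using inj[OF \<open>p 1 1 \<noteq> 0\<close>] by (rule inj_on_subset) auto
  qed (use d X in auto)
next
  case False
  then have "y_one p \<le> 0" by simp
  then show ?thesis by (rule local_branch_nonpos) (rule that)
qed

section \<open>Value and derivative of \<open>B\<close> at the origin\<close>

lemma deriv_B_nonzero:
  assumes "p 1 1 \<noteq> 0 \<or> p 0 1 = 0"
  shows "deriv B 0 \<noteq> 0"
proof -
  obtain d X where d: "0 < d" "d \<le> r0"
    and X: "\<And>y. norm y < d \<Longrightarrow> Im y \<noteq> 0 \<Longrightarrow> X y \<in> region \<and> walk_kernel p (X y) y = 0 \<and> B y = w (X y)"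
    and inj: "inj_on X {y \<in> ball 0 d. Im y \<noteq> 0}"
    by (rule local_branch[OF assms]) blast
  have hol: "B holomorphic_on ball 0 d" using B_hol d(2) by (auto intro: holomorphic_on_subset)
  have "inj_on B {y \<in> ball 0 d. Im y \<noteq> 0}"
  proof (rule inj_onI)
    fix y z assume yz: "y \<in> {y \<in> ball 0 d. Im y \<noteq> 0}" "z \<in> {y \<in> ball 0 d. Im y \<noteq> 0}" "B y = B z"
    then have "w (X y) = w (X z)" "X y \<in> gluing_domain p" "X z \<in> gluing_domain p"
      using X[of y] X[of z] region_subset_gluing_domain by auto
    then have "X y = X z" using w_inj by (auto dest: inj_onD)
    then show "y = z" using inj yz by (auto dest: inj_onD)
  qed
  then have "inj_on B (ball 0 d)" by (rule inj_on_if_inj_on_nonreal[OF hol])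
  then show ?thesis using hol d by (intro holomorphic_injective_imp_regular[of B "ball 0 d"]) auto
qed

lemma B_continuous: "isCont B 0"
  using holomorphic_on_imp_continuous_on[OF B_hol] r0
  unfolding continuous_on_eq_continuous_at[OF open_ball] by simp

lemma B_along_imaginary_axis: "((\<lambda>t. B (of_real t * \<i>)) \<longlongrightarrow> B 0) (at_right 0)"
proof (rule isCont_tendsto_compose[OF B_continuous])
  have "isCont (\<lambda>t::real. of_real t * \<i>) 0" by (intro continuous_intros)
  then show "((\<lambda>t::real. of_real t * \<i>) \<longlongrightarrow> 0) (at_right 0)"
    by (simp add: isCont_def filterlim_at_split)
qed

text \<open>If \<open>B 0 = w 0\<close>, openness of \<open>w\<close> at the interior point 0 writes
  \<open>B y\<close>, for small \<open>y\<close>, as \<open>w x\<close> with \<open>x\<close> near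
  0. Injectivity gives \<open>X y = x\<close>, a kernel zero close to the origin, where the kernel
  is close to \<open>p 1 1\<close>. Imaginary \<open>y\<close> are used since \<open>X\<close> is
  described off the real axis.\<close>

lemma B_0_nonzero:
  assumes "p 1 1 \<noteq> 0"
  shows "B 0 \<noteq> 0"
proof
  assume B0: "B 0 = 0"
  obtain d X where d: "0 < d" "d \<le> r0"
    and X: "\<And>y. norm y < d \<Longrightarrow> Im y \<noteq> 0 \<Longrightarrow> X y \<in> region \<and> walk_kernel p (X y) y = 0 \<and> B y = w (X y)"
    and "inj_on X {y \<in> ball 0 d. Im y \<noteq> 0}"
    by (rule local_branch[OF disjI1[OF assms]]) blast
  have "isCont (\<lambda>z. walk_kernel p (fst z) (snd z)) (0, 0)"
    unfolding walk_kernel_def by (intro continuous_intros)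
  moreover have "walk_kernel p 0 0 \<noteq> 0" using assms by (simp add: walk_kernel_quadratic ker_expand)
  ultimately have "\<forall>\<^sub>F z in nhds (0, 0). walk_kernel p (fst z) (snd z) \<in> - {0}"
    by (intro topological_tendstoD[of _ "walk_kernel p 0 0"]) (auto simp: isCont_def tendsto_nhds_iff)
  then obtain e where e: "e > 0" "\<And>x y. dist (x, y) (0, 0) < e \<Longrightarrow> walk_kernel p x y \<noteq> 0"
    unfolding eventually_nhds_metric by auto
  have K: "walk_kernel p x y \<noteq> 0" if "norm x < e / 2" "norm y < e / 2" for x y
  proof (rule e(2))
    have "dist (x, y) (0, 0) \<le> norm x + norm y"
      using sqrt_sum_squares_le_sum[of "norm x" "norm y"] by (simp add: dist_Pair_Pair)
    then show "dist (x, y) (0, 0) < e" using that by simp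
  qed
  define V where "V = region \<inter> ball 0 (e / 2)"
  have V: "open V" "0 \<in> V" "V \<subseteq> gluing_domain p"
    using open_region zero_in_region assms e(1) region_subset_gluing_domain by (auto simp: V_def)
  have "open (w ` V)"
    using V w_hol w_inj by (intro open_mapping_thm3) (auto intro: holomorphic_on_subset inj_on_subset)
  moreover have "B 0 \<in> w ` V" using V(2) w_0 B0 by (metis imageI)
  ultimately have "\<forall>\<^sub>F t in at_right 0. B (of_real t * \<i>) \<in> w ` V"
    using B_along_imaginary_axis by (intro topological_tendstoD)
  moreover have "\<forall>\<^sub>F t in at_right 0. t > 0 \<and> t < min d (e / 2)"
    unfolding eventually_at_right_field using d e by (intro exI[of _ "min d (e / 2)"]) auto
  ultimately have "\<forall>\<^sub>F t in at_right 0. B (of_real t * \<i>) \<in> w ` V \<and> t > 0 \<and> t < min d (e / 2)"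
    by (rule eventually_conj)
  then have "\<exists>t. B (of_real t * \<i>) \<in> w ` V \<and> t > 0 \<and> t < min d (e / 2)"
    by (rule eventually_happens'[rotated]) simp
  then obtain t where t: "B (of_real t * \<i>) \<in> w ` V" "t > 0" "t < d" "t < e / 2" by auto
  define y where "y = of_real t * \<i>"
  have y: "norm y < d" "Im y \<noteq> 0" "norm y < e / 2" using t by (auto simp: y_def norm_mult)
  obtain x where x: "x \<in> V" "B y = w x" using t(1) by (auto simp: y_def)
  have Xy: "X y \<in> region" "walk_kernel p (X y) y = 0" "w (X y) = w x"
    using X[OF y(1,2)] x(2) by auto
  have "X y = x"
    using inj_onD[OF w_inj Xy(3)] subsetD[OF region_subset_gluing_domain Xy(1)] subsetD[OF V(3) x(1)]
    by blast
  then show False using Xy(2) K[of x y] x(1) y(3) by (auto simp: V_def)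
qed

text \<open>For \<open>p 0 1 \<noteq> 0\<close> the analytic branch starts at 0. For
  \<open>p 0 1 = 0\<close> the point 0 is on the gluing curve: the kernel roots over
  \<open>y\<close> tend to 0, and continuity of \<open>w\<close> on the closure transfers the
  limit.\<close>

lemma B_0_zero:
  assumes "p 1 1 = 0"
  shows "B 0 = 0"
proof (cases "p 0 1 = 0")
  case False
  then have "y_one p > 0" using assms y_one_pos_iff by simp
  then obtain d X where d: "0 < d" "d \<le> r0"
    and X: "\<And>y. norm y < d \<Longrightarrow> X y \<in> region \<and> walk_kernel p (X y) y = 0 \<and> B y = w (X y)"
    and X0: "p 1 1 = 0 \<Longrightarrow> X 0 = 0" and "p 1 1 \<noteq> 0 \<Longrightarrow> inj_on X (ball 0 d)"
    by (rule local_branch_pos) blast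
  then show ?thesis using X[of 0] X0[OF assms] w_0 d by auto
next
  case True
  obtain d X where d: "0 < d" "d \<le> r0"
    and X: "\<And>y. norm y < d \<Longrightarrow> Im y \<noteq> 0 \<Longrightarrow> X y \<in> region \<and> walk_kernel p (X y) y = 0 \<and> B y = w (X y)"
    and "inj_on X {y \<in> ball 0 d. Im y \<noteq> 0}"
    by (rule local_branch[OF disjI2[OF True]]) blast
  define Z where "Z t = X (of_real t * \<i>)" for t
  have small: "\<forall>\<^sub>F t in at_right 0. t > 0 \<and> t < d"
    unfolding eventually_at_right_field using d by (intro exI[of _ d]) auto
  have Z: "Z t \<in> region" "walk_kernel p (Z t) (of_real t * \<i>) = 0" "B (of_real t * \<i>) = w (Z t)"
    if "t > 0" "t < d" for t
    using X[of "of_real t * \<i>"] that by (auto simp: Z_def norm_mult)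
  have lim_Z: "(Z \<longlongrightarrow> 0) (at_right 0)"
  proof (rule tendstoI)
    fix e :: real assume e: "e > 0"
    have "p (-1) 1 > 0" using True assms p_nondeg(7) p_nonneg(7) by (auto simp: less_le)
    then have pos: "norm (ker_a p 0) > norm (ker_b p 0) / e + norm (ker_c p 0) / e\<^sup>2"
      using True assms by (simp add: ker_expand)
    let ?g = "\<lambda>t::real. norm (ker_a p (of_real t * \<i>)) - (norm (ker_b p (of_real t * \<i>)) / e
      + norm (ker_c p (of_real t * \<i>)) / e\<^sup>2)"
    have "isCont ?g 0" unfolding ker_expand using e by (intro continuous_intros) auto
    then have "(?g \<longlongrightarrow> ?g 0) (at_right 0)" by (simp add: isCont_def filterlim_at_split)
    then have "\<forall>\<^sub>F t in at_right 0. ?g t > 0" using pos by (intro order_tendstoD(1)) auto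
    then show "\<forall>\<^sub>F t in at_right 0. dist (Z t) 0 < e"
      using small
    proof eventually_elim
      case (elim t)
      define a b c where "a = norm (ker_a p (of_real t * \<i>))" and "b = norm (ker_b p (of_real t * \<i>))"
        and "c = norm (ker_c p (of_real t * \<i>))"
      show ?case
      proof (rule ccontr)
        assume "\<not> dist (Z t) 0 < e"
        then have z: "norm (Z t) \<ge> e" by simp
        define n where "n = norm (Z t)"
        have n: "n > 0" "1 / n \<le> 1 / e" using z e by (auto simp: n_def intro: frac_le)
        have "ker_a p (of_real t * \<i>) * (Z t)\<^sup>2 =
            - (ker_b p (of_real t * \<i>) * Z t + ker_c p (of_real t * \<i>))"
          using Z(2)[of t] elim by (simp add: walk_kernel_quadratic algebra_simps eq_neg_iff_add_eq_0)
        then have "a * n\<^sup>2 = norm (ker_b p (of_real t * \<i>) * Z t + ker_c p (of_real t * \<i>))"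
          unfolding a_def n_def by (metis norm_minus_cancel norm_mult norm_power)
        also have "\<dots> \<le> b * n + c"
          unfolding b_def c_def n_def by (metis norm_mult norm_triangle_ineq)
        finally have "a \<le> b * (1 / n) + c * (1 / n)\<^sup>2"
          using n by (simp add: field_simps power2_eq_square)
        also have "\<dots> \<le> b * (1 / e) + c * (1 / e)\<^sup>2"
          using n by (intro add_mono mult_left_mono power_mono) (auto simp: b_def c_def)
        finally show False using elim by (simp add: a_def b_def c_def power_divide)
      qed
    qed
  qed
  have "((\<lambda>t. w (Z t)) \<longlongrightarrow> w 0) (at_right 0)"
  proof (rule continuous_on_tendsto_compose[OF w_cont lim_Z])
    show "0 \<in> closure (gluing_domain p) - {1}" using zero_in_closure by simp
    show "\<forall>\<^sub>F t in at_right 0. Z t \<in> closure (gluing_domain p) - {1}"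
      using small
    proof eventually_elim
      case (elim t)
      then have "Z t \<in> region" using Z(1) by simp
      then show ?case using region_subset_closure by blast
    qed
  qed
  moreover have "\<forall>\<^sub>F t in at_right 0. w (Z t) = B (of_real t * \<i>)"
    using small by eventually_elim (use Z in auto)
  ultimately have "((\<lambda>t. B (of_real t * \<i>)) \<longlongrightarrow> 0) (at_right 0)"
    using w_0 tendsto_cong by force
  then show ?thesis using B_along_imaginary_axis tendsto_unique trivial_limit_at_right_real by blast
qed

end

subsection \<open>Expansion of harmonic functions\<close>

definition base_fps :: "complex \<Rightarrow> nat \<Rightarrow> complex fps \<Rightarrow> complex fps" where
  "base_fps d k F = F ^ ((k + 1) div 2) * (F - fps_const d) ^ (k div 2)"

lemma poly_base_poly: "poly (base_poly d k) z = z ^ ((k + 1) div 2) * (z - d) ^ (k div 2)"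
  by (cases "even k") (auto simp: base_poly_def Let_def)

lemma base_fps_radius: "fps_conv_radius (base_fps d k F) \<ge> fps_conv_radius F"
proof -
  have "fps_conv_radius (F ^ n) \<ge> fps_conv_radius F" for n by (rule fps_conv_radius_power)
  moreover have "fps_conv_radius (F - fps_const d) \<ge> fps_conv_radius F"
    using fps_conv_radius_diff[of F "fps_const d"] by simp
  then have "fps_conv_radius ((F - fps_const d) ^ n) \<ge> fps_conv_radius F" for n
    using fps_conv_radius_power order_trans by blast
  ultimately have "fps_conv_radius F \<le> min (fps_conv_radius (F ^ ((k + 1) div 2)))
      (fps_conv_radius ((F - fps_const d) ^ (k div 2)))" by simp
  also have "\<dots> \<le> fps_conv_radius (base_fps d k F)" unfolding base_fps_def by (rule fps_conv_radius_mult)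
  finally show ?thesis .
qed

lemma eval_base_fps:
  assumes "ereal (norm z) < fps_conv_radius F"
  shows "eval_fps (base_fps d k F) z = poly (base_poly d k) (eval_fps F z)"
proof -
  have "fps_conv_radius (F - fps_const d) \<ge> fps_conv_radius F"
    using fps_conv_radius_diff[of F "fps_const d"] by simp
  then have d: "ereal (norm z) < fps_conv_radius (F - fps_const d)" using assms by (rule less_le_trans[rotated])
  have "eval_fps (base_fps d k F) z =
      eval_fps (F ^ ((k + 1) div 2)) z * eval_fps ((F - fps_const d) ^ (k div 2)) z"
    unfolding base_fps_def using less_le_trans[OF assms fps_conv_radius_power]
      less_le_trans[OF d fps_conv_radius_power] by (intro eval_fps_mult)
  also have "\<dots> = eval_fps F z ^ ((k + 1) div 2) * (eval_fps F z - d) ^ (k div 2)"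
    using assms d by (simp add: eval_fps_power eval_fps_diff)
  finally show ?thesis by (simp add: poly_base_poly)
qed

lemma fps_power_mult_nth:
  fixes F G :: "'a::field fps"
  assumes "fps_nth F 0 = 0"
  shows "i < m \<Longrightarrow> fps_nth (F ^ m * G) i = 0"
    and "fps_nth (F ^ m * G) m = fps_nth F 1 ^ m * fps_nth G 0"
proof -
  define E where "E = fps_shift 1 F"
  have F: "F = fps_X * E"
    by (rule fps_ext) (auto simp: E_def assms)
  have "F ^ m * G = fps_X ^ m * (E ^ m * G)" by (simp add: F power_mult_distrib mult.assoc)
  then have *: "fps_nth (F ^ m * G) i = (if i < m then 0 else fps_nth (E ^ m * G) (i - m))" for i
    by (simp only: fps_X_power_mult_nth)
  show "i < m \<Longrightarrow> fps_nth (F ^ m * G) i = 0" by (simp add: *)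
  show "fps_nth (F ^ m * G) m = fps_nth F 1 ^ m * fps_nth G 0"
    by (simp add: * E_def fps_nth_power_0)
qed

text \<open>Only the factors \<open>A\<close> vanish at 0, while \<open>A - d\<close> starts with
  \<open>- d\<close>. In \<open>base_fps_nth_B\<close> the roles are exchanged, and for
  \<open>d = 0\<close> both kinds of factors vanish.\<close>

lemma base_fps_nth_A:
  assumes "fps_nth A 0 = 0"
  shows "i < (k + 1) div 2 \<Longrightarrow> fps_nth (base_fps d k A) i = 0"
    "fps_nth (base_fps d k A) ((k + 1) div 2) = fps_nth A 1 ^ ((k + 1) div 2) * (- d) ^ (k div 2)"
  unfolding base_fps_def using fps_power_mult_nth[OF assms, where G = "(A - fps_const d) ^ (k div 2)"] assms
  by (simp_all add: fps_nth_power_0)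

lemma base_fps_nth_B:
  assumes "fps_nth B 0 = d"
  shows "i < k div 2 \<Longrightarrow> fps_nth (base_fps d k B) i = 0"
    "fps_nth (base_fps d k B) (k div 2) = fps_nth B 1 ^ (k div 2) * d ^ ((k + 1) div 2)"
proof -
  have z: "fps_nth (B - fps_const d) 0 = 0" using assms by simp
  have eq: "base_fps d k B = (B - fps_const d) ^ (k div 2) * B ^ ((k + 1) div 2)"
    by (simp add: base_fps_def mult.commute)
  show "i < k div 2 \<Longrightarrow> fps_nth (base_fps d k B) i = 0"
    "fps_nth (base_fps d k B) (k div 2) = fps_nth B 1 ^ (k div 2) * d ^ ((k + 1) div 2)"
    unfolding eq using fps_power_mult_nth[OF z, where G = "B ^ ((k + 1) div 2)"] assms
    by (simp_all add: fps_nth_power_0)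
qed

lemma base_fps_0_nth:
  assumes "fps_nth F 0 = 0"
  shows "i < k \<Longrightarrow> fps_nth (base_fps 0 k F) i = 0" "fps_nth (base_fps 0 k F) k = fps_nth F 1 ^ k"
proof -
  have "(k + 1) div 2 + k div 2 = k" by presburger
  then have eq: "base_fps 0 k F = F ^ k * 1"
    by (simp add: base_fps_def power_add[symmetric])
  show "i < k \<Longrightarrow> fps_nth (base_fps 0 k F) i = 0" "fps_nth (base_fps 0 k F) k = fps_nth F 1 ^ k"
    unfolding eq using fps_power_mult_nth[OF assms, where G = 1] by simp_all
qed

text \<open>The coefficients are matched in the order \<open>1, x, y, x\<^sup>2, y\<^sup>2, \<dots>\<close> if \<open>p 1 1 \<noteq> 0\<close>. If
  \<open>p 1 1 = 0\<close>, the kernel vanishes at the origin, one of the two variables is a power series in the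
  other one along the kernel curve, and the coefficients of the powers of one variable suffice.\<close>

lemma harmonic_expansion:
  assumes conv: "\<And>a. \<exists>S. formal_sums (\<lambda>k i j. a k * F k i j) S"
    and ker: "\<And>k i j. k \<ge> 1 \<Longrightarrow> complex_of_real (kernel_mult p (F k) i j) =
      (if j = 0 then fps_nth (base_fps d k A) i else 0) - (if i = 0 then fps_nth (base_fps d k B) j else 0)"
    and A0: "fps_nth A 0 = 0" and B0: "fps_nth B 0 = d"
    and cases: "p 1 1 \<noteq> 0 \<and> d \<noteq> 0 \<and> fps_nth A 1 \<noteq> 0 \<and> fps_nth B 1 \<noteq> 0 \<or>
      p 1 1 = 0 \<and> p 0 1 \<noteq> 0 \<and> d = 0 \<and> fps_nth A 1 \<noteq> 0 \<or>
      p 1 1 = 0 \<and> p 1 0 \<noteq> 0 \<and> d = 0 \<and> fps_nth B 1 \<noteq> 0"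
    and h: "h \<in> polyharmonic p 1"
  shows "\<exists>a. formal_sums (\<lambda>k i j. a k * F k i j) h"
proof -
  have ker_h: "kernel_mult p h (Suc i) (Suc j) = 0" for i j
  proof -
    have "laplacian p h = (\<lambda>i j. 0)" using h by (simp add: polyharmonic_def)
    then show ?thesis by (simp add: laplacian_eq_kernel_mult[symmetric])
  qed
  have ker_F: "kernel_mult p (F k) (Suc i) (Suc j) = 0" if "k \<ge> 1" for k i j
    using ker[OF that, of "Suc i" "Suc j"] by simp
  have ker_S: "kernel_mult p S (Suc i) (Suc j) = 0" if S: "formal_sums (\<lambda>k i j. a k * F k i j) S" for a S i j
  proof -
    have "\<forall>\<^sub>F N in sequentially.
        (\<Sum>k=1..N. a k * kernel_mult p (F k) (Suc i) (Suc j)) = kernel_mult p S (Suc i) (Suc j)"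
      using formal_sums_kernel_mult[OF S, of p] by (simp add: formal_sums_def)
    moreover have "(\<Sum>k=1..N. a k * kernel_mult p (F k) (Suc i) (Suc j)) = 0" for N
      by (intro sum.neutral) (simp add: ker_F)
    ultimately show ?thesis by simp
  qed
  \<comment> \<open>Each case reduces to a sequence \<open>c\<close> of positions for which the
    system is triangular and which, with the interior coefficients, determine a function.\<close>
  have expand: ?thesis
    if diag: "\<And>k. complex_of_real (kernel_mult p (F (Suc k)) (fst (c k)) (snd (c k))) \<noteq> 0"
      and upper: "\<And>i k. i < k \<Longrightarrow> complex_of_real (kernel_mult p (F (Suc k)) (fst (c i)) (snd (c i))) = 0"
      and unique: "\<And>D. (\<And>i. kernel_mult p D (fst (c i)) (snd (c i)) = 0) \<Longrightarrow>
        (\<And>i j. kernel_mult p D (Suc i) (Suc j) = 0) \<Longrightarrow> D = (\<lambda>i j. 0)" for c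
  proof -
    obtain a S where S: "formal_sums (\<lambda>k i j. a k * F k i j) S"
      "\<And>i. kernel_mult p S (fst (c i)) (snd (c i)) = kernel_mult p h (fst (c i)) (snd (c i))"
      by (rule kernel_mult_expansion_exists[OF conv, of p c h]) (use diag upper in auto)
    have "(\<lambda>i j. h i j - S i j) = (\<lambda>i j. 0)"
      by (rule unique) (simp_all add: kernel_mult_diff S(2) ker_h ker_S[OF S(1)])
    then have "h = S" by (simp add: fun_eq_iff)
    then show ?thesis using S(1) by blast
  qed
  from cases consider
    (corner) "p 1 1 \<noteq> 0" "d \<noteq> 0" "fps_nth A 1 \<noteq> 0" "fps_nth B 1 \<noteq> 0"
    | (x) "p 1 1 = 0" "p 0 1 \<noteq> 0" "d = 0" "fps_nth A 1 \<noteq> 0"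
    | (y) "p 1 1 = 0" "p 1 0 \<noteq> 0" "d = 0" "fps_nth B 1 \<noteq> 0" by blast
  then show ?thesis
  proof cases
    case corner
    \<comment> \<open>Even \<open>i\<close> stands for the power \<open>i div 2\<close> of
      \<open>y\<close>, odd \<open>i\<close> for the power \<open>i div 2 + 1\<close> of
      \<open>x\<close>. The constant term is counted with \<open>y\<close>, since the series in
      \<open>x\<close> has none there.\<close>
    define c where "c i = (if even i then (0, i div 2) else (Suc (i div 2), 0))" for i :: nat
    have even: "complex_of_real (kernel_mult p (F (Suc k)) (fst (c i)) (snd (c i))) =
        - fps_nth (base_fps d (Suc k) B) (i div 2)" if "even i" for i k
      using that base_fps_nth_A(1)[OF A0, of 0 "Suc k" d] by (simp add: c_def ker)
    have odd: "complex_of_real (kernel_mult p (F (Suc k)) (fst (c i)) (snd (c i))) =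
        fps_nth (base_fps d (Suc k) A) (Suc (i div 2))" if "odd i" for i k
      using that by (simp add: c_def ker)
    show ?thesis
    proof (rule expand[of c])
      fix k
      show "complex_of_real (kernel_mult p (F (Suc k)) (fst (c k)) (snd (c k))) \<noteq> 0"
      proof (cases "even k")
        case True
        then have "k div 2 = Suc k div 2" by simp
        then show ?thesis
          unfolding even[OF True] using base_fps_nth_B(2)[OF B0, of "Suc k"] corner by simp
      next
        case False
        then have "Suc (k div 2) = (Suc k + 1) div 2" by simp
        then show ?thesis
          unfolding odd[OF False] using base_fps_nth_A(2)[OF A0, where k = "Suc k" and d = d] corner by simp
      qed
    next
      fix i k :: nat assume "i < k"
      show "complex_of_real (kernel_mult p (F (Suc k)) (fst (c i)) (snd (c i))) = 0"
      proof (cases "even i")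
        case True
        then have "i div 2 < Suc k div 2" using \<open>i < k\<close> by (auto elim!: evenE)
        then show ?thesis unfolding even[OF True] using base_fps_nth_B(1)[OF B0] by simp
      next
        case False
        then have "Suc (i div 2) < (Suc k + 1) div 2" using \<open>i < k\<close> by (auto elim!: oddE)
        then show ?thesis unfolding odd[OF False] using base_fps_nth_A(1)[OF A0] by blast
      qed
    next
      fix D assume D: "\<And>i. kernel_mult p D (fst (c i)) (snd (c i)) = 0"
        "\<And>i j. kernel_mult p D (Suc i) (Suc j) = 0"
      have "kernel_mult p D i j = 0" for i j
      proof (cases i)
        case 0
        then show ?thesis using D(1)[of "2 * j"] by (simp add: c_def)
      next
        case (Suc i')
        then show ?thesis using D(1)[of "2 * i' + 1"] D(2)[of i' "j - 1"] by (cases j) (simp_all add: c_def)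
      qed
      then show "D = (\<lambda>i j. 0)" using eq_zero_if_kernel_mult_zero[of p D] corner(1) by blast
    qed
  next
    case x
    note nth = base_fps_0_nth[OF A0]
    show ?thesis
    proof (rule expand[of "\<lambda>i. (Suc i, 0)"])
      show "complex_of_real (kernel_mult p (F (Suc k)) (fst (Suc k, 0)) (snd (Suc k, 0))) \<noteq> 0" for k
        using x nth(2)[of "Suc k"] by (simp add: ker)
      show "complex_of_real (kernel_mult p (F (Suc k)) (fst (Suc i, 0)) (snd (Suc i, 0))) = 0"
        if "i < k" for i k
        using x nth(1)[of "Suc i" "Suc k"] that by (simp add: ker)
      fix D assume D: "\<And>i. kernel_mult p D (fst (Suc i, 0)) (snd (Suc i, 0)) = 0"
        "\<And>i j. kernel_mult p D (Suc i) (Suc j) = 0"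
      have "kernel_mult p D (Suc i) j = 0" for i j using D(1)[of i] D(2)[of i "j - 1"] by (cases j) auto
      then show "D = (\<lambda>i j. 0)" using eq_zero_if_kernel_mult_zero_x[of p D] x(1,2) by blast
    qed
  next
    case y
    then have "fps_nth B 0 = 0" using B0 by simp
    note nth = base_fps_0_nth[OF this]
    show ?thesis
    proof (rule expand[of "\<lambda>i. (0, Suc i)"])
      show "complex_of_real (kernel_mult p (F (Suc k)) (fst (0, Suc k)) (snd (0, Suc k))) \<noteq> 0" for k
        using y nth(2)[of "Suc k"] by (simp add: ker)
      show "complex_of_real (kernel_mult p (F (Suc k)) (fst (0, Suc i)) (snd (0, Suc i))) = 0"
        if "i < k" for i k
        using y nth(1)[of "Suc i" "Suc k"] that by (simp add: ker)
      fix D assume D: "\<And>i. kernel_mult p D (fst (0, Suc i)) (snd (0, Suc i)) = 0"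
        "\<And>i j. kernel_mult p D (Suc i) (Suc j) = 0"
      have "kernel_mult p D i (Suc j) = 0" for i j using D(1)[of j] D(2)[of "i - 1" j] by (cases i) auto
      then show "D = (\<lambda>i j. 0)" using eq_zero_if_kernel_mult_zero_y[of p D] y(1,2) by blast
    qed
  qed
qed

context zero_drift_walk
begin

lemma kernel_nonzero_near_0:
  obtains r where "r > 0" "\<And>x. 0 < norm x \<Longrightarrow> norm x < r \<Longrightarrow> walk_kernel p x 0 \<noteq> 0"
proof -
  define q where "q = [:complex_of_real (p 1 1), of_real (p 0 1), of_real (p (-1) 1):]"
  have "q \<noteq> 0" using p_nondeg(7) by (auto simp: q_def)
  then have fin: "finite {x. poly q x = 0}" by (rule poly_roots_finite)
  have K: "walk_kernel p x 0 = poly q x" for x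
    by (simp add: walk_kernel_quadratic ker_expand q_def power2_eq_square algebra_simps)
  obtain r where r: "r > 0" "\<forall>x\<in>{x. poly q x = 0}. x \<noteq> 0 \<longrightarrow> r \<le> dist 0 x"
    using finite_set_avoid[OF fin, of 0] by blast
  show ?thesis
  proof (rule that[OF r(1)])
    fix x :: complex assume "0 < norm x" "norm x < r"
    then show "walk_kernel p x 0 \<noteq> 0" using r(2) unfolding K by auto
  qed
qed

lemma finite_kernel_roots:
  assumes "0 < (y::real)"
  shows "finite {x. walk_kernel p x (of_real y) = 0}"
proof -
  have "ker_a p (of_real y) \<noteq> 0" using ac_pos(1)[OF assms] by (simp add: ker_of_real)
  then have "{x. walk_kernel p x (of_real y) = 0} \<subseteq> {X_plus p (of_real y), X_minus p (of_real y)}"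
    using X_branches by auto
  then show ?thesis by (rule finite_subset) simp
qed

end

theorem theorem5:
  fixes p :: "int \<Rightarrow> int \<Rightarrow> real"
    and w :: "complex \<Rightarrow> complex"
    and H :: "nat \<Rightarrow> nat \<Rightarrow> nat \<Rightarrow> nat \<Rightarrow> real"
  assumes "transition_probs p" and "non_degenerate p" and "zero_drift p"
    and "conformal_gluing p w"
    and polyh: "\<And>n k. n \<ge> 1 \<Longrightarrow> k \<ge> 1 \<Longrightarrow> \<exists>m\<ge>1. H n k \<in> polyharmonic p m"
    and base: "\<And>k. k \<ge> 1 \<Longrightarrow>
      \<exists>\<epsilon>>0. \<forall>x\<in>gluing_domain p. \<forall>y::real.
        norm x < \<epsilon> \<longrightarrow> 0 < y \<longrightarrow> y < \<epsilon> \<longrightarrow> walk_kernel p x (of_real y) \<noteq> 0 \<longrightarrow>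
        ((\<lambda>(i, j). of_real (H 1 k i j) * x ^ i * of_real y ^ j) has_sum
          ((poly (base_poly (d_zero p w) k) (w x)
             - poly (base_poly (d_zero p w) k) (w (X_plus p (of_real y))))
           / walk_kernel p x (of_real y))) UNIV"
    and step: "\<And>n k. n \<ge> 1 \<Longrightarrow> k \<ge> 1 \<Longrightarrow> laplacian p (H (n + 1) k) = H n k"
    and conv: "\<And>n (a :: nat \<Rightarrow> real). n \<ge> 1 \<Longrightarrow>
      \<exists>S. formal_sums (\<lambda>k i j. a k * H n k i j) S"
  shows "\<forall>n\<ge>1. \<forall>h\<in>polyharmonic p n.
    \<exists>(a :: nat \<Rightarrow> nat \<Rightarrow> real) (S :: nat \<Rightarrow> nat \<Rightarrow> nat \<Rightarrow> real).
      (\<forall>i\<in>{1..n}. formal_sums (\<lambda>j r s. a i j * H i j r s) (S i)) \<and>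
      h = (\<lambda>r s. \<Sum>i=1..n. S i r s)"
proof -
  interpret zero_drift_walk p by standard fact+
  define G where "G = gluing_domain p"
  define d where "d = d_zero p w"
  define P where "P k = poly (base_poly d k)" for k
  have split: "\<exists>A B r. fps_conv_radius A > 0 \<and> fps_conv_radius B > 0 \<and> r > 0 \<and>
      (\<forall>x\<in>G. x \<noteq> 0 \<longrightarrow> norm x < r \<longrightarrow> P k (w x) = eval_fps A x) \<and>
      (\<forall>y. 0 < y \<longrightarrow> y < r \<longrightarrow> P k (w (X_plus p (of_real y))) = eval_fps B (of_real y)) \<and>
      (\<forall>i j. complex_of_real (kernel_mult p (H 1 k) i j) =
         (if j = 0 then fps_nth A i else 0) - (if i = 0 then fps_nth B j else 0))"
    if k: "k \<ge> 1" for k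
  proof -
    obtain \<epsilon> where \<epsilon>: "\<epsilon> > 0" "\<And>x y. x \<in> G \<Longrightarrow> norm x < \<epsilon> \<Longrightarrow> 0 < y \<Longrightarrow> y < \<epsilon> \<Longrightarrow>
        walk_kernel p x (of_real y) \<noteq> 0 \<Longrightarrow>
        ((\<lambda>(i, j). of_real (H 1 k i j) * x ^ i * of_real y ^ j) has_sum
          ((P k (w x) - P k (w (X_plus p (of_real y)))) / walk_kernel p x (of_real y))) UNIV"
      using base[OF k] unfolding G_def P_def d_def by blast
    obtain rk where rk: "rk > 0" "\<And>x. 0 < norm x \<Longrightarrow> norm x < rk \<Longrightarrow> walk_kernel p x 0 \<noteq> 0"
      by (rule kernel_nonzero_near_0) blast
    show ?thesis
      by (rule kernel_mult_split[where G = G and g = "\<lambda>x. P k (w x)" and h = "H 1 k" and p = p and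
          f = "\<lambda>y. P k (w (X_plus p (of_real y)))", OF _ rk finite_kernel_roots \<epsilon>(1)])
         (use zero_islimpt_gluing_domain \<epsilon>(2) in \<open>auto simp: G_def\<close>)
  qed
  obtain A B r where AB: "fps_conv_radius A > 0" "fps_conv_radius B > 0" "r > 0"
    and wA: "\<And>x. x \<in> G \<Longrightarrow> x \<noteq> 0 \<Longrightarrow> norm x < r \<Longrightarrow> P 1 (w x) = eval_fps A x"
    and wB: "\<And>y. 0 < y \<Longrightarrow> y < r \<Longrightarrow> P 1 (w (X_plus p (of_real y))) = eval_fps B (of_real y)"
    using split[of 1] by auto
  \<comment> \<open>Thus \<open>A\<close> and \<open>B\<close> are expansions of \<open>w\<close>
    and of \<open>w \<circ> X_plus\<close> themselves.\<close>
  have P1: "P 1 z = z" for z by (simp add: P_def poly_base_poly)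
  note wA = wA[unfolded P1] and wB = wB[unfolded P1]
  obtain r1 where r1: "0 < r1" "ereal r1 < fps_conv_radius A" "ereal r1 < fps_conv_radius B"
    using ereal_dense2[of 0 "min (fps_conv_radius A) (fps_conv_radius B)"] AB(1,2)
    by (auto simp: zero_ereal_def)
  define r0 where "r0 = min r r1"
  have r0_bounds: "r0 > 0" "r0 \<le> r" "r0 \<le> r1" using AB r1 by (auto simp: r0_def)
  have radA: "ereal (norm z) < fps_conv_radius A" and radB: "ereal (norm z) < fps_conv_radius B"
    if "norm z < r0" for z :: complex
    using that r0_bounds r1 by (auto intro: less_trans[of _ "ereal r1"])
  interpret glued_walk p w "eval_fps B" r0
  proof
    show "eval_fps B holomorphic_on ball 0 r0"
      by (rule holomorphic_on_eval_fps) (use radB in auto)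
    show "w (X_plus p (of_real y)) = eval_fps B (of_real y)" if "0 < y" "y < r0" for y
      using wB[of y] that r0_bounds by simp
  qed (use assms(4) r0_bounds in auto)
  have right_0: "\<forall>\<^sub>F t in at_right 0. 0 < t \<and> t < min r0 1"
    unfolding eventually_at_right_field using r0_bounds by (intro exI[of _ "min r0 1"]) auto
  have of_real_lim: "((\<lambda>t. complex_of_real t) \<longlongrightarrow> 0) (at_right 0)"
    using tendsto_of_real[OF tendsto_ident_at, of 0 "{0<..}"] by simp
  have eval_lim: "((\<lambda>t. eval_fps F (complex_of_real t)) \<longlongrightarrow> fps_nth F 0) (at_right 0)"
    if "fps_conv_radius F > 0" for F
  proof -
    have "isCont (eval_fps F) 0" using that by (intro continuous_eval_fps) (auto simp: zero_ereal_def)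
    from isCont_tendsto_compose[OF this of_real_lim] show ?thesis by (simp add: eval_fps_at_0)
  qed
  have A0: "fps_nth A 0 = 0"
  proof -
    have "((\<lambda>t. w (complex_of_real t)) \<longlongrightarrow> w 0) (at_right 0)"
    proof (rule continuous_on_tendsto_compose[OF w_cont of_real_lim])
      show "0 \<in> closure (gluing_domain p) - {1}" using zero_in_closure by simp
      show "\<forall>\<^sub>F t in at_right 0. complex_of_real t \<in> closure (gluing_domain p) - {1}"
        using right_0
      proof eventually_elim
        case (elim t)
        then have "complex_of_real t \<in> region" using unit_interval_in_region by simp
        then show ?case using region_subset_closure by blast
      qed
    qed
    moreover have "\<forall>\<^sub>F t in at_right 0. w (complex_of_real t) = eval_fps A (complex_of_real t)"
      using right_0
    proof eventually_elim
      case (elim t)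
      then have "complex_of_real t \<in> G"
        using unit_interval_in_region region_subset_gluing_domain by (auto simp: G_def)
      then show ?case using wA[of "complex_of_real t"] elim r0_bounds by simp
    qed
    ultimately have "((\<lambda>t. eval_fps A (complex_of_real t)) \<longlongrightarrow> w 0) (at_right 0)"
      using tendsto_cong by force
    then show ?thesis
      using eval_lim[OF AB(1)] w_0 tendsto_unique[OF trivial_limit_at_right_real] by fastforce
  qed
  have B0: "fps_nth B 0 = d"
  proof -
    have "\<forall>\<^sub>F t in at_right 0. eval_fps B (complex_of_real t) = w (X_plus p (complex_of_real t))"
      using right_0 by eventually_elim (use wB r0_bounds in auto)
    then have "((\<lambda>t. w (X_plus p (complex_of_real t))) \<longlongrightarrow> fps_nth B 0) (at_right 0)"
      using eval_lim[OF AB(2)] tendsto_cong by force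
    then show ?thesis unfolding d_def d_zero_def by (intro tendsto_Lim[symmetric]) auto
  qed
  have ker: "complex_of_real (kernel_mult p (H 1 k) i j) =
      (if j = 0 then fps_nth (base_fps d k A) i else 0) - (if i = 0 then fps_nth (base_fps d k B) j else 0)"
    if k: "k \<ge> 1" for k i j
  proof -
    obtain A' B' r' where A'B': "fps_conv_radius A' > 0" "fps_conv_radius B' > 0" "r' > 0"
      and wA': "\<And>x. x \<in> G \<Longrightarrow> x \<noteq> 0 \<Longrightarrow> norm x < r' \<Longrightarrow> P k (w x) = eval_fps A' x"
      and wB': "\<And>y. 0 < y \<Longrightarrow> y < r' \<Longrightarrow> P k (w (X_plus p (of_real y))) = eval_fps B' (of_real y)"
      and ker': "\<And>i j. complex_of_real (kernel_mult p (H 1 k) i j) =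
         (if j = 0 then fps_nth A' i else 0) - (if i = 0 then fps_nth B' j else 0)"
      using split[OF k] by auto
    define r2 where "r2 = min r0 r'"
    have r2: "r2 > 0" "r2 \<le> r0" "r2 \<le> r'" using r0_bounds A'B' by (auto simp: r2_def)
    \<comment> \<open>Both series represent \<open>P k (w x)\<close> on a set accumulating at 0, so
      the expansions for all \<open>k\<close> come from the single pair \<open>A\<close>,
      \<open>B\<close>.\<close>
    have "A' = base_fps d k A"
    proof (rule fps_eqI_near_0[OF A'B'(1) _ _ _ r2(1)])
      show "fps_conv_radius (base_fps d k A) > 0" using AB(1) base_fps_radius less_le_trans by blast
      show "0 islimpt (G - {0})"
        using zero_islimpt_gluing_domain islimpt_punctured[of 0 G] by (simp add: G_def)
      fix x assume x: "x \<in> G - {0}" "norm x < r2"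
      then have "w x = eval_fps A x" using wA[of x] r0_bounds r2 by simp
      then show "eval_fps A' x = eval_fps (base_fps d k A) x"
        using wA'[of x] x r2 eval_base_fps[OF radA, of x d k] by (simp add: P_def)
    qed
    moreover have "B' = base_fps d k B"
    proof (rule fps_eqI_near_0[OF A'B'(2) _ of_real_interval_islimpt[OF r2(1)] _ r2(1)])
      show "fps_conv_radius (base_fps d k B) > 0" using AB(2) base_fps_radius less_le_trans by blast
      fix x :: complex assume x: "x \<in> of_real ` {0<..<r2}" "norm x < r2"
      then obtain y where y: "x = of_real y" "0 < y" "y < r2" by auto
      then have "w (X_plus p (of_real y)) = eval_fps B (of_real y)" using wB[of y] r0_bounds r2 by simp
      then show "eval_fps B' x = eval_fps (base_fps d k B) x"
        using wB'[of y] x y r2 eval_base_fps[OF radB, of x d k] by (simp add: P_def)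
    qed
    ultimately show ?thesis using ker' by simp
  qed
  \<comment> \<open>If 0 is an interior point, \<open>A\<close> is the Taylor series of the
    injective function \<open>w\<close> there.\<close>
  have A1: "fps_nth A 1 \<noteq> 0" if "0 \<in> region"
  proof -
    have 0: "0 \<in> G" using that region_subset_gluing_domain by (auto simp: G_def)
    have "\<forall>\<^sub>F x in nhds 0. x \<in> G \<inter> ball 0 r"
      using 0 open_gluing_domain AB(3) by (intro eventually_nhds_in_open open_Int) (auto simp: G_def)
    then have "\<forall>\<^sub>F x in nhds 0. eval_fps A x = w x"
    proof eventually_elim
      case (elim x)
      then show ?case using wA[of x] A0 w_0 by (cases "x = 0") (auto simp: eval_fps_at_0)
    qed
    then have "w has_fps_expansion A" using AB(1) by (simp add: has_fps_expansion_def)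
    then have "fps_nth A 1 = deriv w 0" by (simp add: fps_nth_fps_expansion)
    then show ?thesis
      using holomorphic_injective_imp_regular[OF w_hol open_gluing_domain w_inj] 0 by (simp add: G_def)
  qed
  have B1: "fps_nth B 1 \<noteq> 0" if "p 1 1 \<noteq> 0 \<or> p 0 1 = 0"
    using deriv_B_nonzero[OF that] fps_nth_fps_expansion[OF eval_fps_has_fps_expansion[OF AB(2)], of 1]
    by simp
  have d0: "d \<noteq> 0" if "p 1 1 \<noteq> 0"
    using B_0_nonzero[OF that] by (simp add: eval_fps_at_0 B0)
  have d0': "d = 0" if "p 1 1 = 0"
    using B_0_zero[OF that] by (simp add: eval_fps_at_0 B0)
  \<comment> \<open>If \<open>p 1 1 = 0\<close>, either \<open>p 0 1 \<noteq> 0\<close> and 0 is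
    interior, or \<open>p 0 1 = 0\<close>, when non-degeneracy gives \<open>p 1 0 \<noteq> 0\<close>
    and \<open>B1\<close> applies.\<close>
  have cases: "p 1 1 \<noteq> 0 \<and> d \<noteq> 0 \<and> fps_nth A 1 \<noteq> 0 \<and> fps_nth B 1 \<noteq> 0 \<or>
      p 1 1 = 0 \<and> p 0 1 \<noteq> 0 \<and> d = 0 \<and> fps_nth A 1 \<noteq> 0 \<or>
      p 1 1 = 0 \<and> p 1 0 \<noteq> 0 \<and> d = 0 \<and> fps_nth B 1 \<noteq> 0"
    using A1 B1 d0 d0' zero_in_region p_nondeg(8) by blast
  show ?thesis
  proof (intro allI impI ballI)
    fix n h assume "1 \<le> n" "h \<in> polyharmonic p n"
    then show "\<exists>(a :: nat \<Rightarrow> nat \<Rightarrow> real) (S :: nat \<Rightarrow> nat \<Rightarrow> nat \<Rightarrow> real).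
      (\<forall>i\<in>{1..n}. formal_sums (\<lambda>j r s. a i j * H i j r s) (S i)) \<and>
      h = (\<lambda>r s. \<Sum>i=1..n. S i r s)"
      using harmonic_expansion[OF conv[OF order_refl] ker A0 B0 cases] step conv
      by (intro polyharmonic_expansion[of p H]) auto
  qed
qed

end
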